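(* Let $d\ge2$ and assume that there exists a constant $A\in(0,\infty)$ such that $\mathbb{Q}([0,A])=1$ and $\mathbb{Q}([0,A-\varepsilon])<1$ for all $\varepsilon\in(0,A)$. Let $\{s_{d,\rho}\}_{\rho\ge1}$ be any correct shift. Denote by $R_{\max,\rho}$ the maximal inradius of a cell of the Poisson--Laguerre tessellation with nucleus in $W_\rho$, i.e. the maximum of $r((x,m),\eta)$ over $(x,m)\in\eta\cap(W_\rho\times[0,\infty))$, and by $(X_{\max,\rho},M_{\max,\rho})$ the corresponding nucleus and its mark. Then, as $\rho\to\infty$, $$\Big(\frac1\rho X_{\max,\rho},\,M_{\max,\rho},\,c_d\gamma R_{\max,\rho}^d-s_{d,\rho}\Big)\overset{d}{\longrightarrow}(X,M_d,G)$$ with independent $X\sim\operatorname{Unif}(W)$, $M_d\sim\mathbb{Q}^{LIM}_d$ and $G$ standard Gumbel, i.e. $\mathbb{P}(G\le u)=e^{-e^{-u}}$ for $u\in\mathbb{R}$.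
   Context: Fix $\gamma>0$ and a compact convex set $W\subseteq\mathbb{R}^d$ of volume one; $W_\rho:=\rho W$ for $\rho\ge1$; $\operatorname{Unif}(W)$ is the uniform distribution on $W$. $\lambda_d$ is Lebesgue measure on $\mathbb{R}^d$, $v_d$ the volume of the $d$-dimensional unit ball, $c_d:=2^dv_d$, and $B^d(x,r)$ the closed ball with center $x$ and radius $r$. $\mathbb{Q}$ is a probability measure on $[0,\infty)$ (mark distribution), $M\sim\mathbb{Q}$, and $\eta$ is a Poisson process on $\mathbb{R}^d\times[0,\infty)$ with intensity measure $\gamma\lambda_d\otimes\mathbb{Q}$. Counting measures are also treated as sets of points. For a collection $\varphi$ of points of $\mathbb{R}^d\times[0,\infty)$ and $\mathbf{x}=(x,s)\in\varphi$, the Laguerre cell is $L(\mathbf{x},\varphi):=\{z\in\mathbb{R}^d:\|z-x\|^2-s^2\le\|z-y\|^2-t^2\text{ for all }(y,t)\in\varphi\}$, and the inradius is $r(\mathbf{x},\varphi):=\sup\{r\ge0:B^d(x,r)\subseteq L(\mathbf{x},\varphi)\}$ if $x\in L(\mathbf{x},\varphi)$ and $r(\mathbf{x},\varphi):=0$ otherwise. A correct shift is a family of real numbers $\{s_{d,\rho}\}_{\rho\ge1}$ with $$\lim_{\rho\to\infty}\mathbb{E}\sum_{\mathbf{x}\in\eta\cap(W_\rho\times[0,A])}\mathbf{1}\Big[r(\mathbf{x},\eta)^d\ge\frac{u+s_{d,\rho}}{c_d\gamma}\Big]=e^{-u}\quad\text{for all }u\in\mathbb{R}.$$ $\mathbb{Q}^{LIM}_d$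 is the probability measure $\mathbb{E}[\mathbf{1}[M\in\cdot\,]e^{2v_2\gamma M^2}]/\mathbb{E}[e^{2v_2\gamma M^2}]$ if $d=2$ and $\delta_A$ (Dirac measure at $A$) if $d\ge3$. Convention: on the event that $\eta\cap(W_\rho\times[0,\infty))$ has no point, or that the maximal inradius is not attained by a unique point, the triple $(\frac1\rho X_{\max,\rho},M_{\max,\rho},c_d\gamma R_{\max,\rho}^d-s_{d,\rho})$ is set equal to $0\in\mathbb{R}^{d+2}$. *)

theory Defs
  imports "HOL-Probability.Probability"
begin

section \<open>Point processes\<close>

text \<open>
  Realisations of a point process are counting measures: they vanish outside the state space
  \<open>S\<close> and take finite values in the natural numbers on bounded Borel sets.
\<close>

definition counting_measure_on :: "'b set \<Rightarrow> 'b::metric_space measure \<Rightarrow> bool" where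
  "counting_measure_on S \<mu> \<longleftrightarrow>
     sets \<mu> = sets borel \<and> emeasure \<mu> (- S) = 0 \<and>
     (\<forall>B\<in>sets borel. bounded B \<longrightarrow> (\<exists>n::nat. emeasure \<mu> B = of_nat n))"

definition points :: "'b measure \<Rightarrow> 'b set" where
  "points \<mu> = {p. emeasure \<mu> {p} \<noteq> 0}"

definition point_process ::
    "'w measure \<Rightarrow> 'b set \<Rightarrow> ('w \<Rightarrow> 'b::metric_space measure) \<Rightarrow> bool" where
  "point_process P S \<eta> \<longleftrightarrow>
     (\<forall>\<omega>\<in>space P. counting_measure_on S (\<eta> \<omega>)) \<and>
     (\<forall>B\<in>sets borel. (\<lambda>\<omega>. emeasure (\<eta> \<omega>) B) \<in> borel_measurable P)"

text \<open>
  In the Poisson weights, \<open>0 ^ 0 = 1\<close> covers sets of intensity zero; on sets of infinite intensity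
  the process has infinitely many points almost surely.
\<close>

definition poisson_process ::
    "'w measure \<Rightarrow> 'b set \<Rightarrow> 'b measure \<Rightarrow>
     ('w \<Rightarrow> 'b::metric_space measure) \<Rightarrow> bool" where
  "poisson_process P S \<Lambda> \<eta> \<longleftrightarrow>
     point_process P S \<eta> \<and>
     (\<forall>B\<in>sets borel. emeasure \<Lambda> B \<noteq> \<infinity> \<longrightarrow>
        (\<forall>k::nat. measure P {\<omega>\<in>space P. emeasure (\<eta> \<omega>) B = of_nat k}
                    = measure \<Lambda> B ^ k / fact k * exp (- measure \<Lambda> B))) \<and>
     (\<forall>B\<in>sets borel. emeasure \<Lambda> B = \<infinity> \<longrightarrow> (AE \<omega> in P. emeasure (\<eta> \<omega>) B = \<infinity>)) \<and>
     (\<forall>(n::nat) B. (\<forall>i<n. B i \<in> sets borel) \<longrightarrow> disjoint_family_on B {..<n} \<longrightarrow>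
        prob_space.indep_vars P (\<lambda>_. borel) (\<lambda>i \<omega>. emeasure (\<eta> \<omega>) (B i)) {..<n})"


section \<open>Laguerre cells and their inradii\<close>

definition laguerre_cell :: "'a \<times> real \<Rightarrow> ('a::euclidean_space \<times> real) set \<Rightarrow> 'a set" where
  "laguerre_cell p \<phi> =
     {z. \<forall>q\<in>\<phi>. (norm (z - fst p))\<^sup>2 - (snd p)\<^sup>2 \<le> (norm (z - fst q))\<^sup>2 - (snd q)\<^sup>2}"

text \<open>
  The supremum may be infinite (for instance if \<open>p\<close> is the only point of \<open>\<phi>\<close>), so it is taken in
  the extended reals.
\<close>

definition inradius :: "'a \<times> real \<Rightarrow> ('a::euclidean_space \<times> real) set \<Rightarrow> ereal" where
  "inradius p \<phi> =
     (if fst p \<in> laguerre_cell p \<phi>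
      then SUP r\<in>{r. 0 \<le> r \<and> cball (fst p) r \<subseteq> laguerre_cell p \<phi>}. ereal r
      else 0)"

definition window :: "real \<Rightarrow> 'a::euclidean_space set \<Rightarrow> 'a set" where
  "window \<rho> W = (\<lambda>x. \<rho> *\<^sub>R x) ` W"

definition ball_const :: "nat \<Rightarrow> real" where
  "ball_const d = 2 ^ d * unit_ball_vol (real d)"

definition correct_shift ::
    "'w measure \<Rightarrow> ('w \<Rightarrow> ('a::euclidean_space \<times> real) measure) \<Rightarrow> real \<Rightarrow> 'a set \<Rightarrow> real \<Rightarrow>
     (real \<Rightarrow> real) \<Rightarrow> bool" where
  "correct_shift P \<eta> \<gamma> W A s \<longleftrightarrow>
     (\<forall>u::real.
       ((\<lambda>\<rho>. \<integral>\<^sup>+\<omega>.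
           (\<integral>\<^sup>+p. indicator {q. inradius q (points (\<eta> \<omega>)) ^ DIM('a)
                               \<ge> ereal ((u + s \<rho>) / (ball_const (DIM('a)) * \<gamma>))} p
              \<partial>count_space (points (\<eta> \<omega>) \<inter> window \<rho> W \<times> {0..A})) \<partial>P)
         \<longlongrightarrow> ennreal (exp (- u))) at_top)"

definition max_nucleus ::
    "real \<Rightarrow> 'a set \<Rightarrow> ('a::euclidean_space \<times> real) set \<Rightarrow> 'a \<times> real \<Rightarrow> bool" where
  "max_nucleus \<rho> W \<phi> p \<longleftrightarrow>
     p \<in> \<phi> \<inter> window \<rho> W \<times> {0..} \<and>
     (\<forall>q \<in> \<phi> \<inter> window \<rho> W \<times> {0..}. inradius q \<phi> \<le> inradius p \<phi>)"

text \<open>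
  Rescaled nucleus, mark and centred power of the maximal inradius; the value is \<open>0\<close> if the
  maximum does not exist or is not attained by a unique point.  An infinite maximal inradius,
  an event of probability zero for the Poisson processes considered here, is read as \<open>0\<close> by
  \<open>real_of_ereal\<close>.
\<close>

definition max_triple ::
    "real \<Rightarrow> (real \<Rightarrow> real) \<Rightarrow> 'a set \<Rightarrow> real \<Rightarrow> ('a::euclidean_space \<times> real) set \<Rightarrow>
     'a \<times> real \<times> real" where
  "max_triple \<gamma> s W \<rho> \<phi> =
     (if \<exists>!p. max_nucleus \<rho> W \<phi> p
      then let p = (THE p. max_nucleus \<rho> W \<phi> p)
           in ((1 / \<rho>) *\<^sub>R fst p, snd p,
               ball_const (DIM('a)) * \<gamma> * real_of_ereal (inradius p \<phi>) ^ DIM('a) - s \<rho>)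
      else 0)"


section \<open>Limit distributions and convergence in distribution\<close>

definition limit_mark_distr :: "nat \<Rightarrow> real \<Rightarrow> real measure \<Rightarrow> real \<Rightarrow> real measure" where
  "limit_mark_distr d \<gamma> Q A =
     (if d = 2
      then density Q (\<lambda>m. ennreal (exp (2 * unit_ball_vol 2 * \<gamma> * m\<^sup>2)
                                   / (\<integral>t. exp (2 * unit_ball_vol 2 * \<gamma> * t\<^sup>2) \<partial>Q)))
      else return borel A)"

definition gumbel_distr :: "real measure" where
  "gumbel_distr = interval_measure (\<lambda>u. exp (- exp (- u)))"

lemma real_distribution_gumbel: "real_distribution gumbel_distr"
  and cdf_gumbel: "cdf gumbel_distr u = exp (- exp (- u))"
proof -
  have mono: "exp (- exp (- x)) \<le> exp (- exp (- y))" if "x \<le> y" for x y :: real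
    using that by simp
  have cont: "continuous (at_right a) (\<lambda>u. exp (- exp (- u)))" for a :: real
    by (intro continuous_intros)
  have bot: "((\<lambda>u::real. exp (- exp (- u))) \<longlongrightarrow> 0) at_bot"
    by (intro filterlim_compose[OF exp_at_bot] filterlim_compose[OF filterlim_uminus_at_bot_at_top]
          filterlim_compose[OF exp_at_top] filterlim_uminus_at_top_at_bot)
  have "((\<lambda>u::real. exp (- exp (- u))) \<longlongrightarrow> exp (- 0)) at_top"
    by (intro tendsto_intros filterlim_compose[OF exp_at_bot] filterlim_uminus_at_bot_at_top)
  then have top: "((\<lambda>u::real. exp (- exp (- u))) \<longlongrightarrow> 1) at_top"
    by simp
  show "real_distribution gumbel_distr"
    unfolding gumbel_distr_def using real_distribution_interval_measure[OF mono cont bot top] .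
  show "cdf gumbel_distr u = exp (- exp (- u))"
    unfolding gumbel_distr_def using cdf_interval_measure[OF mono cont bot] by simp
qed

text \<open>The random elements \<open>X i\<close>, all defined on \<open>P\<close>, converge in distribution to the law \<open>\<mu>\<close>.\<close>

definition conv_in_distr ::
    "'w measure \<Rightarrow> ('i \<Rightarrow> 'w \<Rightarrow> 'b::metric_space) \<Rightarrow> 'b measure \<Rightarrow> 'i filter \<Rightarrow> bool" where
  "conv_in_distr P X \<mu> F \<longleftrightarrow>
     (\<forall>\<^sub>F i in F. X i \<in> borel_measurable P) \<and>
     (\<forall>f :: 'b \<Rightarrow> real. continuous_on UNIV f \<longrightarrow> bounded (range f) \<longrightarrow>
        ((\<lambda>i. \<integral>\<omega>. f (X i \<omega>) \<partial>P) \<longlongrightarrow> (\<integral>x. f x \<partial>\<mu>)) F)"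

end

theory Submission
  imports Defs
begin

text \<open>
  A nucleus \<open>(x, m)\<close> has inradius at least \<open>R\<close> iff no other point lies in an explicit region around it,
  a spherical shell whose width depends on the marks. So the exceedances of a threshold are described
  by void events of the Poisson process alone. Cutting space into small cells turns their number into
  a sum of indicators of void events: letting the mesh tend to zero gives its mean (a special case of
  the Mecke formula), and the Chen-Stein argument gives the probability that there is none. Two
  exceedances are at distance at least about \<open>2 R\<close>, and the region of the second then contains a ball
  of radius \<open>R / 4\<close> disjoint from that of the first, which makes the error terms exponentially small.

  For a small box of positions and marks and a short interval \<open>[a, b)\<close> of heights, the maximum lies in
  them if there is no exceedance of level \<open>b\<close> in the box, none of level \<open>a\<close> outside it, and exactly one
  of level \<open>a\<close> inside. Since \<open>Unif(W)\<close> has no atoms, the resulting lower bounds of the box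
  probabilities sum up to one in the limit, and this already forces convergence in distribution.

  The mark distribution comes from the volume of the shells: given the mark \<open>m\<close>, its mean over the mark
  \<open>t\<close> of the other point is \<open>v\<^sub>2 (4 R\<^sup>2 + 2 (E t\<^sup>2 - m\<^sup>2)) + o(1)\<close> in the plane, whereas in higher dimensions
  its dependence on \<open>m\<close> is unbounded as \<open>R\<close> grows, and the largest mark wins.
\<close>

subsection \<open>Finite labelled partitions of vanishing mesh\<close>

text \<open>The shift \<open>s\<close> is known only through the limit of one mean, so its size has
  to be recovered: with bounded thresholds that mean would grow like \<open>\<rho> ^ d\<close>,
  hence the radii diverge. Every other mean is a volume times a ratio of mark weights times the
  prescribed mean, so no expansion of \<open>s\<close> is required. Regions must be open for the
  mesh limit and bounded in space for finite-range dependence; both are obtained by restricting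
  marks to an open strip around \<open>[0, A]\<close>, which almost surely changes nothing.
  Measurability concerns every realisation and is proved with unrestricted regions. The level
  \<open>b\<close> inside a box and the level \<open>a\<close> outside it are tested by one void
  event. Thresholds are therefore functions with finitely many values, within a factor 9/8 of each
  other. The probability of two exceedances in a box is quadratic in its volume but does not see its
  height interval. A mesh of order \<open>1 / n\<close> has of order \<open>n\<close> height
  intervals above each spatial cell, and the errors sum to zero because a spatial cell has volume
  \<open>O(1 / n ^ 2)\<close>, which is where dimension at least two enters.\<close>

lemma mesh_labels_exist:
  "\<exists>\<kappa>::nat \<Rightarrow> 'b::euclidean_space \<Rightarrow> nat. (\<forall>n k. {p. \<kappa> n p = k} \<in> sets borel) \<and>
     (\<forall>n D. bounded D \<longrightarrow> finite (\<kappa> n ` D)) \<and>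
     (\<forall>n p q. \<kappa> n p = \<kappa> n q \<longrightarrow> dist p q < 1 / Suc n)"
proof -
  obtain D :: "'b set" where D: "countable D" "\<And>X. open X \<Longrightarrow> X \<noteq> {} \<Longrightarrow> \<exists>d\<in>D. d \<in> X"
    using countable_dense_setE by blast
  have "D \<noteq> {}" using D(2)[of UNIV] by auto
  define e where "e = from_nat_into D"
  define r :: "nat \<Rightarrow> real" where "r n = 1 / (2 * Suc n)" for n
  have r: "r n > 0" for n by (simp add: r_def)
  \<comment> \<open>The first ball of a countable cover that contains the point. A label class is
    thus a ball minus finitely many earlier balls, and compactness bounds the labels of a bounded
    set. The radius is half the mesh because diameters are to be controlled.\<close>
  define \<kappa> where "\<kappa> n p = (LEAST k. dist p (e k) < r n)" for n p
  have near: "\<exists>k. dist p (e k) < r n" for n p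
  proof -
    obtain d where "d \<in> D" "d \<in> ball p (r n)"
      using D(2)[of "ball p (r n)"] r[of n] by auto
    then show ?thesis
      using D(1) \<open>D \<noteq> {}\<close> by (metis e_def from_nat_into_surj mem_ball)
  qed
  have \<kappa>: "dist p (e (\<kappa> n p)) < r n" for n p
    unfolding \<kappa>_def by (rule LeastI_ex[OF near])
  have "{p. \<kappa> n p = k} \<in> sets borel" for n k
  proof -
    have "{p. \<kappa> n p = k} = ball (e k) (r n) - (\<Union>j<k. ball (e j) (r n))"
    proof (intro set_eqI iffI)
      fix p assume "p \<in> {p. \<kappa> n p = k}"
      then have k: "\<kappa> n p = k" by simp
      have "\<not> dist p (e j) < r n" if "j < k" for j
        using not_less_Least[of j "\<lambda>k. dist p (e k) < r n"] that k by (simp add: \<kappa>_def)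
      then show "p \<in> ball (e k) (r n) - (\<Union>j<k. ball (e j) (r n))"
        using \<kappa>[of p n] k by (auto simp: dist_commute)
    next
      fix p assume p: "p \<in> ball (e k) (r n) - (\<Union>j<k. ball (e j) (r n))"
      have "\<kappa> n p = k" unfolding \<kappa>_def
        by (rule Least_equality) (use p in \<open>auto simp: dist_commute not_le[symmetric]\<close>)
      then show "p \<in> {p. \<kappa> n p = k}" by simp
    qed
    then show ?thesis by simp
  qed
  moreover have "finite (\<kappa> n ` S)" if "bounded S" for n S
  proof -
    have c: "compact (closure S)" using that by simp
    have cov: "closure S \<subseteq> \<Union> ((\<lambda>k. ball (e k) (r n)) ` UNIV)"
      using near by (auto simp: dist_commute)
    obtain K where K: "finite K" "closure S \<subseteq> (\<Union>k\<in>K. ball (e k) (r n))"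
      using compactE_image[OF c _ cov] by (metis open_ball)
    have "\<kappa> n p \<le> Max K" if "p \<in> S" for p
    proof -
      have "p \<in> closure S" using that closure_subset by blast
      then obtain k where "k \<in> K" "dist p (e k) < r n" using K(2) by (auto simp: dist_commute)
      then have "\<kappa> n p \<le> k" unfolding \<kappa>_def by (intro Least_le)
      then show ?thesis using \<open>k \<in> K\<close> K(1) Max_ge order_trans by blast
    qed
    then have "\<kappa> n ` S \<subseteq> {..Max K}" by auto
    then show ?thesis using finite_subset by blast
  qed
  moreover have "dist p q < 1 / Suc n" if "\<kappa> n p = \<kappa> n q" for n p q
  proof -
    have "dist p q \<le> dist p (e (\<kappa> n p)) + dist q (e (\<kappa> n q))"
      using that by (metis dist_triangle2)
    also have "\<dots> < r n + r n" using \<kappa>[of p n] \<kappa>[of q n] by linarith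
    also have "\<dots> = 1 / Suc n" by (simp add: r_def field_simps)
    finally show ?thesis .
  qed
  ultimately show ?thesis by blast
qed

text \<open>Fixed once for every Euclidean type: the same labels cut the marked space
  \<open>'a \<times> real\<close> of the process and the space \<open>'a\<close> of the rescaled
  nucleus.\<close>

definition mesh_label :: "nat \<Rightarrow> 'b::euclidean_space \<Rightarrow> nat" where
  "mesh_label = (SOME \<kappa>. (\<forall>n k. {p. \<kappa> n p = k} \<in> sets borel) \<and>
     (\<forall>n D. bounded D \<longrightarrow> finite (\<kappa> n ` D)) \<and>
     (\<forall>n p q. \<kappa> n p = \<kappa> n q \<longrightarrow> dist p q < 1 / Suc n))"

lemma sets_mesh_label: "{p. mesh_label n p = k} \<in> sets borel"
  and finite_mesh_label: "bounded D \<Longrightarrow> finite (mesh_label n ` D)"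
  and dist_mesh_label: "mesh_label n p = mesh_label n q \<Longrightarrow> dist p q < 1 / Suc n"
  using someI_ex[OF mesh_labels_exist, folded mesh_label_def] by blast+

lemma measurable_mesh_label [measurable]: "mesh_label n \<in> borel \<rightarrow>\<^sub>M count_space UNIV"
  using sets_mesh_label[of n] by (auto simp: measurable_count_space_eq2_countable vimage_def)

lemma eventually_mesh: "\<delta> > 0 \<Longrightarrow> eventually (\<lambda>n. 1 / real (Suc n) < \<delta>) sequentially"
  by (rule order_tendstoD(2)[OF LIMSEQ_inverse_real_of_nat[unfolded inverse_eq_divide]])

subsection \<open>Counting measures\<close>

lemma counting_measure_cases:
  assumes "counting_measure_on S \<mu>" "B \<in> sets borel" "bounded B" "emeasure \<mu> B \<noteq> 0"
  shows "emeasure \<mu> B \<ge> 1"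
proof -
  obtain n :: nat where n: "emeasure \<mu> B = of_nat n"
    using assms unfolding counting_measure_on_def by blast
  then have "n \<ge> 1" using assms(4) by (cases n) auto
  then show ?thesis unfolding n using of_nat_mono[of 1 n] by simp
qed

text \<open>A bounded set of positive mass is cut into pieces of ever smaller diameter, keeping mass at
  least one; the intersection of the pieces is an atom.\<close>
lemma counting_measure_has_point:
  fixes \<mu> :: "'b::euclidean_space measure"
  assumes \<mu>: "counting_measure_on S \<mu>" and B: "B \<in> sets borel" "bounded B" and pos: "emeasure \<mu> B \<noteq> 0"
  shows "points \<mu> \<inter> B \<noteq> {}"
proof -
  have sets: "sets \<mu> = sets borel" using \<mu> by (simp add: counting_measure_on_def)
  define Q where "Q n C \<longleftrightarrow> C \<in> sets borel \<and> C \<subseteq> B \<and> emeasure \<mu> C \<noteq> 0" for n :: nat and C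
  have "\<exists>f. \<forall>n. Q n (f n) \<and> (f (Suc n) \<subseteq> f n \<and> (\<forall>p\<in>f (Suc n). \<forall>q\<in>f (Suc n). dist p q < 1 / Suc n))"
  proof (rule dependent_nat_choice)
    show "\<exists>x. Q 0 x" using B pos by (auto simp: Q_def)
    fix C n assume C: "Q n C"
    define E where "E k = C \<inter> {p. mesh_label n p = k}" for k
    have E: "E k \<in> sets borel" for k
      unfolding E_def using C sets_mesh_label[of n k] by (auto simp: Q_def)
    have "C = (\<Union>k. E k)" by (auto simp: E_def)
    then have "\<exists>k. emeasure \<mu> (E k) \<noteq> 0"
      using emeasure_UN_eq_0[of \<mu> E] E sets C by (auto simp: Q_def)
    then obtain k where "emeasure \<mu> (E k) \<noteq> 0" by blast
    then show "\<exists>y. Q (Suc n) y \<and> y \<subseteq> C \<and> (\<forall>p\<in>y. \<forall>q\<in>y. dist p q < 1 / Suc n)"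
      using C E[of k] by (intro exI[of _ "E k"]) (auto simp: Q_def E_def intro!: dist_mesh_label[of n, simplified])
  qed
  then obtain f where f: "\<And>n. Q n (f n)" "\<And>n. f (Suc n) \<subseteq> f n"
      "\<And>n p q. p \<in> f (Suc n) \<Longrightarrow> q \<in> f (Suc n) \<Longrightarrow> dist p q < 1 / Suc n" by metis
  have fin: "emeasure \<mu> (f n) \<noteq> \<infinity>" for n
  proof -
    have "bounded (f n)" using f(1)[of n] B(2) bounded_subset by (auto simp: Q_def)
    then obtain m :: nat where "emeasure \<mu> (f n) = of_nat m"
      using \<mu> f(1)[of n] unfolding counting_measure_on_def Q_def by blast
    then show ?thesis by simp
  qed
  have "emeasure \<mu> (\<Inter>n. f n) = (INF n. emeasure \<mu> (f n))"
    by (rule INF_emeasure_decseq[symmetric])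
      (use f(1,2) fin sets in \<open>auto simp: Q_def decseq_Suc_iff\<close>)
  also have "\<dots> \<ge> 1"
    using f(1) bounded_subset[OF B(2)]
    by (intro INF_greatest counting_measure_cases[OF \<mu>]) (auto simp: Q_def)
  finally have ge: "emeasure \<mu> (\<Inter>n. f n) \<ge> 1" .
  then have "(\<Inter>n. f n) \<noteq> {}" by auto
  then obtain p where p: "\<And>n. p \<in> f n" by auto
  have "q = p" if "\<And>n. q \<in> f n" for q
  proof (rule ccontr)
    assume "q \<noteq> p"
    then obtain n where "1 / real (Suc n) < dist q p"
      using eventually_mesh[of "dist q p"] by (auto simp: eventually_sequentially)
    moreover have "dist q p < 1 / Suc n" by (rule f(3)) (use that p in auto)
    ultimately show False by simp
  qed
  then have "(\<Inter>n. f n) = {p}" using p by auto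
  then have "p \<in> points \<mu>" using ge by (auto simp: points_def)
  moreover have "p \<in> B" using p f(1)[of 0] by (auto simp: Q_def)
  ultimately show ?thesis by auto
qed

text \<open>Positive mass yields an atom only on bounded sets, so passing from no atom to no mass
  goes through the pieces \<open>B \<inter> cball 0 n\<close>.\<close>

lemma counting_measure_eq_0_iff:
  fixes \<mu> :: "'b::euclidean_space measure"
  assumes \<mu>: "counting_measure_on S \<mu>" and B: "B \<in> sets borel"
  shows "emeasure \<mu> B = 0 \<longleftrightarrow> points \<mu> \<inter> B = {}"
proof
  have sets: "sets \<mu> = sets borel" using \<mu> by (simp add: counting_measure_on_def)
  assume *: "emeasure \<mu> B = 0"
  show "points \<mu> \<inter> B = {}"
  proof (rule ccontr)
    assume "points \<mu> \<inter> B \<noteq> {}"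
    then obtain p where "p \<in> B" "emeasure \<mu> {p} \<noteq> 0" by (auto simp: points_def)
    then show False using emeasure_mono[of "{p}" B \<mu>] * B sets by auto
  qed
next
  have sets: "sets \<mu> = sets borel" using \<mu> by (simp add: counting_measure_on_def)
  assume *: "points \<mu> \<inter> B = {}"
  have 0: "emeasure \<mu> (B \<inter> cball 0 (real n)) = 0" for n
    using counting_measure_has_point[OF \<mu>, of "B \<inter> cball 0 (real n)"] * B by auto
  have "B = (\<Union>n. B \<inter> cball 0 (real n))"
    using real_arch_simple by (auto simp: dist_norm)
  moreover have "emeasure \<mu> (\<Union>n. B \<inter> cball 0 (real n)) = 0"
    by (rule emeasure_UN_eq_0) (use 0 B sets in auto)
  ultimately show "emeasure \<mu> B = 0" by simp
qed

text \<open>Every atom has mass at least one. Multiple points are allowed, which is why the mass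
  only bounds the number of atoms.\<close>

lemma counting_measure_points:
  fixes \<mu> :: "'b::euclidean_space measure"
  assumes \<mu>: "counting_measure_on S \<mu>" and B: "B \<in> sets borel" "bounded B"
  shows "finite (points \<mu> \<inter> B)" "of_nat (card (points \<mu> \<inter> B)) \<le> emeasure \<mu> B"
proof -
  have sets: "sets \<mu> = sets borel" using \<mu> by (simp add: counting_measure_on_def)
  obtain n :: nat where n: "emeasure \<mu> B = of_nat n"
    using \<mu> B unfolding counting_measure_on_def by blast
  have *: "of_nat (card F) \<le> emeasure \<mu> B" if F: "finite F" "F \<subseteq> points \<mu> \<inter> B" for F
  proof -
    have "of_nat (card F) = (\<Sum>p\<in>F. 1::ennreal)" by simp
    also have "\<dots> \<le> (\<Sum>p\<in>F. emeasure \<mu> {p})"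
      using F(2) by (intro sum_mono counting_measure_cases[OF \<mu>]) (auto simp: points_def)
    also have "\<dots> = emeasure \<mu> F"
      using F(1) sets by (intro emeasure_eq_sum_singleton[symmetric]) auto
    also have "\<dots> \<le> emeasure \<mu> B" using F(2) B(1) sets by (intro emeasure_mono) auto
    finally show ?thesis .
  qed
  show fin: "finite (points \<mu> \<inter> B)"
  proof (rule ccontr)
    assume "infinite (points \<mu> \<inter> B)"
    then obtain F where F: "finite F" "card F = Suc n" "F \<subseteq> points \<mu> \<inter> B"
      using infinite_arbitrarily_large by blast
    then have "of_nat (Suc n) \<le> (of_nat n :: ennreal)" using *[of F] n by simp
    then show False unfolding of_nat_le_iff by simp
  qed
  show "of_nat (card (points \<mu> \<inter> B)) \<le> emeasure \<mu> B" using *[OF fin] by simp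
qed

subsection \<open>Poisson approximation of void probabilities\<close>

lemma (in prob_space) expectation_finite_nat:
  fixes f :: "nat \<Rightarrow> real"
  assumes W: "W \<in> measurable M (count_space UNIV)" "\<And>\<omega>. \<omega> \<in> space M \<Longrightarrow> W \<omega> \<le> n"
  shows "expectation (\<lambda>\<omega>. f (W \<omega>)) = (\<Sum>k\<le>n. f k * prob {\<omega>\<in>space M. W \<omega> = k})"
proof -
  note [measurable] = W(1)
  have "expectation (\<lambda>\<omega>. f (W \<omega>))
    = expectation (\<lambda>\<omega>. \<Sum>k\<le>n. f k * indicator {\<omega>\<in>space M. W \<omega> = k} \<omega>)"
    using W(2) by (intro Bochner_Integration.integral_cong refl)
      (auto simp: indicator_def if_distrib[of "\<lambda>x. _ * x"] sum.delta' cong: if_cong)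
  also have "\<dots> = (\<Sum>k\<le>n. f k * prob {\<omega>\<in>space M. W \<omega> = k})"
    by (subst Bochner_Integration.integral_sum)
      (auto intro!: integrable_mult_right integrable_real_indicator sum.cong simp: emeasure_eq_measure)
  finally show ?thesis .
qed

text \<open>With \<open>W\<close> the number of events that occur and \<open>\<lambda>\<close> its mean, \<open>exp (- \<lambda> s) E s^W\<close> equals
  \<open>prob (W = 0)\<close> at \<open>s = 0\<close> and \<open>exp (- \<lambda>)\<close> at \<open>s = 1\<close>; local dependence makes its derivative
  small, by the two error terms of the Chen-Stein method.\<close>
lemma (in prob_space) poisson_approximation_void:
  fixes A :: "'i \<Rightarrow> 'a set" and B :: "'i \<Rightarrow> 'i set"
  assumes I: "finite I" and A: "\<And>i. i \<in> I \<Longrightarrow> A i \<in> events"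
    and indep: "\<And>i S. i \<in> I \<Longrightarrow> S \<subseteq> I - B i \<Longrightarrow>
      prob (A i \<inter> (space M \<inter> (\<Inter>j\<in>S. A j))) = prob (A i) * prob (space M \<inter> (\<Inter>j\<in>S. A j))"
    and self: "\<And>i. i \<in> I \<Longrightarrow> i \<in> B i"
  defines "b \<equiv> (\<Sum>i\<in>I. \<Sum>j\<in>I \<inter> B i. prob (A i) * prob (A j) + (if j = i then 0 else prob (A i \<inter> A j)))"
  shows "\<bar>prob (space M - (\<Union>i\<in>I. A i)) - exp (- (\<Sum>i\<in>I. prob (A i)))\<bar> \<le> b"
proof -
  note [measurable] = A
  define \<Lambda> where "\<Lambda> = (\<Sum>i\<in>I. prob (A i))"
  define W where "W J \<omega> = card {j\<in>J. \<omega> \<in> A j}" for J \<omega>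
  have Wreal: "real (W J \<omega>) = (\<Sum>j\<in>J. indicator (A j) \<omega>)" if "J \<subseteq> I" for J \<omega>
  proof -
    have "finite J" using that I finite_subset by blast
    then show ?thesis
      by (simp add: W_def indicator_def sum.If_cases Int_def conj_commute)
  qed
  have Wle: "W J \<omega> \<le> card I" if "J \<subseteq> I" for J \<omega>
    unfolding W_def using I that by (intro card_mono) auto
  have Wm: "W J \<in> measurable M (count_space UNIV)" if J: "J \<subseteq> I" for J
  proof -
    have "W J -` {k} \<inter> space M \<in> events" for k
    proof -
      have "W J -` {k} \<inter> space M = {\<omega>\<in>space M. (\<Sum>j\<in>J. indicator (A j) \<omega>) = real k}"
        using Wreal[OF J] by (auto simp flip: Wreal[OF J])
      also have "\<dots> \<in> events"
        using J A by (intro borel_measurable_eq borel_measurable_sum borel_measurable_indicator) auto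
      finally show ?thesis .
    qed
    then show ?thesis by (auto simp: measurable_count_space_eq2_countable)
  qed
  have pm: "(\<lambda>\<omega>. s ^ W J \<omega>) \<in> borel_measurable M" if "J \<subseteq> I" for s :: real and J
    by (rule measurable_compose[OF Wm[OF that]]) simp
  have pint: "integrable M (\<lambda>\<omega>. s ^ W J \<omega>)" if "J \<subseteq> I" "0 \<le> s" "s \<le> 1" for s :: real and J
    using pm[OF that(1)] that(2,3) by (intro integrable_const_bound[where B=1]) (auto simp: power_le_one)
  have iint: "integrable M (\<lambda>\<omega>. indicator (A i) \<omega> * s ^ W J \<omega>)"
    if "J \<subseteq> I" "0 \<le> s" "s \<le> 1" "i \<in> I" for s :: real and J i
    using pm[OF that(1)] that(2-) A
    by (intro integrable_const_bound[where B=1] borel_measurable_times borel_measurable_indicator)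
      (auto simp: power_le_one indicator_def)
  \<comment> \<open>Writing each factor as \<open>1 + (s - 1) * indicator\<close> expands the power
    into indicators of intersections, the events for which independence is assumed.\<close>
  have prodW: "s ^ W J \<omega> = (\<Sum>S\<in>Pow J. (s - 1) ^ card S * indicator (space M \<inter> (\<Inter>j\<in>S. A j)) \<omega>)"
    if "J \<subseteq> I" "\<omega> \<in> space M" for s :: real and J \<omega>
  proof -
    have fJ: "finite J" using that I finite_subset by blast
    have "s ^ W J \<omega> = (\<Prod>j\<in>J. if \<omega> \<in> A j then s else 1)"
      using fJ by (simp add: W_def prod.If_cases Int_def conj_commute)
    also have "\<dots> = (\<Prod>j\<in>J. (s - 1) * indicator (A j) \<omega> + 1)"
      by (intro prod.cong) (auto simp: indicator_def)
    also have "\<dots> = (\<Sum>S\<in>Pow J. (\<Prod>j\<in>S. (s - 1) * indicator (A j) \<omega>))"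
      using prod_add[OF fJ, of "\<lambda>j. (s - 1) * indicator (A j) \<omega>" "\<lambda>_. 1"] by simp
    also have "\<dots> = (\<Sum>S\<in>Pow J. (s - 1) ^ card S * indicator (space M \<inter> (\<Inter>j\<in>S. A j)) \<omega>)"
    proof (intro sum.cong refl)
      fix S assume "S \<in> Pow J"
      then have "finite S" using fJ finite_subset by auto
      then have "(\<Prod>j\<in>S. indicator (A j) \<omega> :: real) = indicator (space M \<inter> (\<Inter>j\<in>S. A j)) \<omega>"
        using that(2) by (induction S rule: finite_induct) (auto simp: indicator_def)
      then show "(\<Prod>j\<in>S. (s - 1) * indicator (A j) \<omega>) =
          (s - 1) ^ card S * indicator (space M \<inter> (\<Inter>j\<in>S. A j)) \<omega>"
        by (simp add: prod.distrib)
    qed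
    finally show ?thesis .
  qed
  have Im: "space M \<inter> (\<Inter>j\<in>S. A j) \<in> events" if "S \<subseteq> I" for S
  proof -
    have "finite S" using that I finite_subset by blast
    then show ?thesis using that
      by (induction S rule: finite_induct) (auto intro: sets.Int simp: Int_left_commute A)
  qed
  have factor: "expectation (\<lambda>\<omega>. indicator (A i) \<omega> * s ^ W (I - B i) \<omega>)
      = prob (A i) * expectation (\<lambda>\<omega>. s ^ W (I - B i) \<omega>)" if i: "i \<in> I" for i and s :: real
  proof -
    let ?J = "I - B i"
    have S: "S \<subseteq> I" if "S \<in> Pow ?J" for S using that by auto
    have "expectation (\<lambda>\<omega>. indicator (A i) \<omega> * s ^ W ?J \<omega>) = expectation (\<lambda>\<omega>.
       \<Sum>S\<in>Pow ?J. (s - 1) ^ card S * indicator (A i \<inter> (space M \<inter> (\<Inter>j\<in>S. A j))) \<omega>)"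
      by (intro Bochner_Integration.integral_cong refl)
        (auto simp: prodW sum_distrib_left indicator_inter_arith mult_ac intro!: sum.cong)
    also have "\<dots> = (\<Sum>S\<in>Pow ?J. (s - 1) ^ card S * prob (A i \<inter> (space M \<inter> (\<Inter>j\<in>S. A j))))"
      using A[OF i] Im[OF S]
      by (subst Bochner_Integration.integral_sum)
        (auto intro!: integrable_mult_right integrable_real_indicator sum.cong simp: emeasure_eq_measure
          simp del: INT_simps)
    also have "\<dots> = prob (A i) * (\<Sum>S\<in>Pow ?J. (s - 1) ^ card S * prob (space M \<inter> (\<Inter>j\<in>S. A j)))"
      using indep[OF i] by (simp add: sum_distrib_left mult_ac)
    also have "(\<Sum>S\<in>Pow ?J. (s - 1) ^ card S * prob (space M \<inter> (\<Inter>j\<in>S. A j))) = expectation (\<lambda>\<omega>.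
       \<Sum>S\<in>Pow ?J. (s - 1) ^ card S * indicator (space M \<inter> (\<Inter>j\<in>S. A j)) \<omega>)"
      using Im[OF S]
      by (subst Bochner_Integration.integral_sum)
        (auto intro!: integrable_mult_right integrable_real_indicator sum.cong simp: emeasure_eq_measure
          simp del: INT_simps)
    also have "\<dots> = expectation (\<lambda>\<omega>. s ^ W ?J \<omega>)"
      by (intro Bochner_Integration.integral_cong refl) (simp add: prodW)
    finally show ?thesis .
  qed
  \<comment> \<open>Summing over the finitely many values of \<open>W I\<close> gives an exponential
    times a polynomial, so nothing has to be differentiated under the expectation.\<close>
  define h where "h s = exp (- \<Lambda> * s) * (\<Sum>k\<le>card I. s ^ k * prob {\<omega>\<in>space M. W I \<omega> = k})" for s :: real
  define h' where "h' s = exp (- \<Lambda> * s) *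
     (expectation (\<lambda>\<omega>. real (W I \<omega>) * s ^ (W I \<omega> - 1)) - \<Lambda> * expectation (\<lambda>\<omega>. s ^ W I \<omega>))" for s :: real
  have deriv: "(h has_real_derivative h' s) (at s)" for s
    unfolding h_def h'_def
    by (subst (1 2) expectation_finite_nat[OF Wm[OF order_refl] Wle[OF order_refl]])
      (auto intro!: derivative_eq_intros simp: algebra_simps sum_distrib_left sum_distrib_right sum_subtractf)
  have bound: "\<bar>expectation (\<lambda>\<omega>. real (W I \<omega>) * s ^ (W I \<omega> - 1)) - \<Lambda> * expectation (\<lambda>\<omega>. s ^ W I \<omega>)\<bar> \<le> b"
    if s: "0 \<le> s" "s \<le> 1" for s :: real
  proof -
    have WW: "real (W I \<omega>) * s ^ (W I \<omega> - 1) = (\<Sum>i\<in>I. indicator (A i) \<omega> * s ^ W (I - {i}) \<omega>)" for \<omega>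
    proof -
      have "indicator (A i) \<omega> * s ^ W (I - {i}) \<omega> = indicator (A i) \<omega> * s ^ (W I \<omega> - 1)" if "i \<in> I" for i
      proof (cases "\<omega> \<in> A i")
        case True
        have "{j \<in> I - {i}. \<omega> \<in> A j} = {j\<in>I. \<omega> \<in> A j} - {i}" by auto
        then show ?thesis using True that I by (simp add: W_def)
      qed simp
      then show ?thesis
        unfolding Wreal[OF order_refl] sum_distrib_right by (intro sum.cong refl) (rule sym)
    qed
    have split: "W J \<omega> = W (J - K) \<omega> + W (J \<inter> K) \<omega>" if "J \<subseteq> I" for J K \<omega>
    proof -
      have "finite J" using that I finite_subset by blast
      then show ?thesis unfolding W_def
        by (subst card_Un_disjoint[symmetric]) (auto intro!: arg_cong[of _ _ card])
    qed
    \<comment> \<open>Both powers lie in the unit interval, so they differ by at most one, and only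
      if a deleted event occurs.\<close>
    have pw: "\<bar>s ^ W J \<omega> - s ^ W (J - K) \<omega>\<bar> \<le> real (W (J \<inter> K) \<omega>)" if "J \<subseteq> I" for J K \<omega>
    proof -
      have "\<bar>s ^ (v + z) - s ^ v\<bar> \<le> real z" for v z :: nat
      proof (cases "z = 0")
        case False
        have "s ^ (v + z) \<le> s ^ v" "0 \<le> s ^ (v + z)" "s ^ v \<le> 1"
          using s by (auto intro: power_decreasing power_le_one)
        then show ?thesis using False by linarith
      qed simp
      then show ?thesis using split[OF that] by metis
    qed
    \<comment> \<open>Both terms are compared through the count over \<open>I - B i\<close>: leaving
      \<open>W (I - {i})\<close> costs joint probabilities, \<open>factor\<close> splits the
      expectation, and returning to \<open>W I\<close> costs products of probabilities.\<close>
    have one: "\<bar>expectation (\<lambda>\<omega>. indicator (A i) \<omega> * s ^ W (I - {i}) \<omega>) - prob (A i) * expectation (\<lambda>\<omega>. s ^ W I \<omega>)\<bar>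
       \<le> (\<Sum>j\<in>I \<inter> B i. prob (A i) * prob (A j) + (if j = i then 0 else prob (A i \<inter> A j)))" if i: "i \<in> I" for i
    proof -
      have eq: "I - {i} - B i = I - B i" "(I - {i}) \<inter> B i = I \<inter> B i - {i}" using self[OF i] by auto
      have sub: "I \<inter> B i - {i} \<subseteq> I" by auto
      have "\<bar>expectation (\<lambda>\<omega>. indicator (A i) \<omega> * s ^ W (I - {i}) \<omega>)
          - expectation (\<lambda>\<omega>. indicator (A i) \<omega> * s ^ W (I - B i) \<omega>)\<bar>
        = \<bar>expectation (\<lambda>\<omega>. indicator (A i) \<omega> * s ^ W (I - {i}) \<omega> - indicator (A i) \<omega> * s ^ W (I - B i) \<omega>)\<bar>"
        using i s iint by (subst Bochner_Integration.integral_diff) auto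
      also have "\<dots> \<le> expectation (\<lambda>\<omega>. \<bar>indicator (A i) \<omega> * s ^ W (I - {i}) \<omega> - indicator (A i) \<omega> * s ^ W (I - B i) \<omega>\<bar>)"
        by (rule integral_abs_bound)
      also have "\<dots> \<le> expectation (\<lambda>\<omega>. \<Sum>j\<in>I \<inter> B i - {i}. indicator (A i \<inter> A j) \<omega>)"
      proof (rule integral_mono)
        show "integrable M (\<lambda>\<omega>. \<bar>indicator (A i) \<omega> * s ^ W (I - {i}) \<omega> - indicator (A i) \<omega> * s ^ W (I - B i) \<omega>\<bar>)"
          using i s iint by (intro integrable_abs Bochner_Integration.integrable_diff) auto
        show "integrable M (\<lambda>\<omega>. \<Sum>j\<in>I \<inter> B i - {i}. indicator (A i \<inter> A j) \<omega> :: real)"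
          using A i by (intro Bochner_Integration.integrable_sum integrable_real_indicator) (auto simp: emeasure_eq_measure)
        fix \<omega>
        show "\<bar>indicator (A i) \<omega> * s ^ W (I - {i}) \<omega> - indicator (A i) \<omega> * s ^ W (I - B i) \<omega>\<bar>
          \<le> (\<Sum>j\<in>I \<inter> B i - {i}. indicator (A i \<inter> A j) \<omega>)"
          using pw[of "I - {i}" \<omega> "B i"] Wreal[OF sub, of \<omega>]
          by (cases "\<omega> \<in> A i") (auto simp: eq indicator_inter_arith intro!: sum_nonneg)
      qed
      also have "\<dots> = (\<Sum>j\<in>I \<inter> B i - {i}. prob (A i \<inter> A j))"
        using A i by (subst Bochner_Integration.integral_sum) (auto intro!: sum.cong simp: emeasure_eq_measure)
      also have "\<dots> = (\<Sum>j\<in>I \<inter> B i. if j = i then 0 else prob (A i \<inter> A j))"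
        using I by (intro sum.mono_neutral_cong_left) auto
      finally have 1: "\<bar>expectation (\<lambda>\<omega>. indicator (A i) \<omega> * s ^ W (I - {i}) \<omega>)
          - prob (A i) * expectation (\<lambda>\<omega>. s ^ W (I - B i) \<omega>)\<bar> \<le> (\<Sum>j\<in>I \<inter> B i. if j = i then 0 else prob (A i \<inter> A j))"
        by (simp add: factor[OF i])
      have "\<bar>expectation (\<lambda>\<omega>. s ^ W (I - B i) \<omega>) - expectation (\<lambda>\<omega>. s ^ W I \<omega>)\<bar>
        = \<bar>expectation (\<lambda>\<omega>. s ^ W (I - B i) \<omega> - s ^ W I \<omega>)\<bar>"
        using s pint by (subst Bochner_Integration.integral_diff) auto
      also have "\<dots> \<le> expectation (\<lambda>\<omega>. \<bar>s ^ W (I - B i) \<omega> - s ^ W I \<omega>\<bar>)"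
        by (rule integral_abs_bound)
      also have "\<dots> \<le> expectation (\<lambda>\<omega>. \<Sum>j\<in>I \<inter> B i. indicator (A j) \<omega>)"
      proof (rule integral_mono)
        show "integrable M (\<lambda>\<omega>. \<bar>s ^ W (I - B i) \<omega> - s ^ W I \<omega>\<bar>)"
          using s pint by (intro integrable_abs Bochner_Integration.integrable_diff) auto
        show "integrable M (\<lambda>\<omega>. \<Sum>j\<in>I \<inter> B i. indicator (A j) \<omega> :: real)"
          using A i by (intro Bochner_Integration.integrable_sum integrable_real_indicator) (auto simp: emeasure_eq_measure)
        fix \<omega> show "\<bar>s ^ W (I - B i) \<omega> - s ^ W I \<omega>\<bar> \<le> (\<Sum>j\<in>I \<inter> B i. indicator (A j) \<omega>)"
          using pw[of I \<omega> "B i"] Wreal[OF Int_lower1, of "B i" \<omega>] by (simp add: abs_minus_commute)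
      qed
      also have "\<dots> = (\<Sum>j\<in>I \<inter> B i. prob (A j))"
        using A i by (subst Bochner_Integration.integral_sum) (auto intro!: sum.cong simp: emeasure_eq_measure)
      finally have 2: "\<bar>expectation (\<lambda>\<omega>. s ^ W (I - B i) \<omega>) - expectation (\<lambda>\<omega>. s ^ W I \<omega>)\<bar> \<le> (\<Sum>j\<in>I \<inter> B i. prob (A j))" .
      have "\<bar>prob (A i) * expectation (\<lambda>\<omega>. s ^ W (I - B i) \<omega>) - prob (A i) * expectation (\<lambda>\<omega>. s ^ W I \<omega>)\<bar>
         \<le> prob (A i) * (\<Sum>j\<in>I \<inter> B i. prob (A j))"
        using mult_left_mono[OF 2, of "prob (A i)"] by (simp add: abs_mult flip: right_diff_distrib)
      with 1 show ?thesis by (simp add: sum.distrib sum_distrib_left)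
    qed
    have "expectation (\<lambda>\<omega>. real (W I \<omega>) * s ^ (W I \<omega> - 1)) - \<Lambda> * expectation (\<lambda>\<omega>. s ^ W I \<omega>)
      = (\<Sum>i\<in>I. expectation (\<lambda>\<omega>. indicator (A i) \<omega> * s ^ W (I - {i}) \<omega>) - prob (A i) * expectation (\<lambda>\<omega>. s ^ W I \<omega>))"
      unfolding WW \<Lambda>_def using iint s
      by (subst Bochner_Integration.integral_sum) (auto simp: sum_subtractf sum_distrib_right)
    also have "\<bar>\<dots>\<bar> \<le> b" unfolding b_def
      by (rule order_trans[OF sum_abs]) (rule sum_mono[OF one])
    finally show ?thesis .
  qed
  have "\<Lambda> \<ge> 0" by (simp add: \<Lambda>_def sum_nonneg)
  have h'b: "\<bar>h' s\<bar> \<le> b" if "0 \<le> s" "s \<le> 1" for s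
  proof -
    have "\<bar>h' s\<bar> \<le> 1 * b" unfolding h'_def abs_mult
      using bound[OF that] \<open>\<Lambda> \<ge> 0\<close> that by (intro mult_mono) auto
    then show ?thesis by simp
  qed
  obtain z where z: "0 < z" "z < 1" "h 1 - h 0 = (1 - 0) * h' z"
    using MVT2[of 0 1 h h'] deriv by auto
  \<comment> \<open>The convention \<open>0 ^ 0 = 1\<close> keeps exactly the summand with
    \<open>k = 0\<close>.\<close>
  have "prob {\<omega>\<in>space M. W I \<omega> = 0} = h 0"
    by (simp add: h_def power_0_left if_distrib[of "\<lambda>x. x * _"] cong: if_cong)
  moreover have "h 1 = exp (- \<Lambda>)"
    using expectation_finite_nat[OF Wm[OF order_refl] Wle[OF order_refl], of "\<lambda>_. 1"]
    by (simp add: h_def prob_space)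
  moreover have "{\<omega>\<in>space M. W I \<omega> = 0} = space M - (\<Union>i\<in>I. A i)"
    using I by (auto simp: W_def)
  ultimately show ?thesis using z h'b[of z] by (simp add: \<Lambda>_def)
qed

subsection \<open>Point processes determined by their void probabilities\<close>

locale void_process = prob_space P for P :: "'w measure" +
  fixes \<eta> :: "'w \<Rightarrow> 'b::euclidean_space measure" and \<Lambda> :: "'b measure" and S :: "'b set"
  assumes sets_intensity [simp]: "sets \<Lambda> = sets borel"
    and counting: "\<omega> \<in> space P \<Longrightarrow> counting_measure_on S (\<eta> \<omega>)"
    and emeasure_measurable [measurable]: "B \<in> sets borel \<Longrightarrow> (\<lambda>\<omega>. emeasure (\<eta> \<omega>) B) \<in> borel_measurable P"
    and void_prob: "B \<in> sets borel \<Longrightarrow> emeasure \<Lambda> B \<noteq> \<infinity> \<Longrightarrow>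
      prob {\<omega>\<in>space P. emeasure (\<eta> \<omega>) B = 0} = exp (- measure \<Lambda> B)"
begin

definition void :: "'b set \<Rightarrow> 'w set" where
  "void B = {\<omega>\<in>space P. points (\<eta> \<omega>) \<inter> B = {}}"

lemma void_eq: "B \<in> sets borel \<Longrightarrow> void B = {\<omega>\<in>space P. emeasure (\<eta> \<omega>) B = 0}"
  unfolding void_def using counting counting_measure_eq_0_iff by blast

lemma void_events [measurable]: "B \<in> sets borel \<Longrightarrow> void B \<in> events"
  by (simp add: void_eq)

lemma prob_void: "B \<in> sets borel \<Longrightarrow> emeasure \<Lambda> B \<noteq> \<infinity> \<Longrightarrow> prob (void B) = exp (- measure \<Lambda> B)"
  by (simp add: void_eq void_prob)

lemma void_Un: "void (B \<union> C) = void B \<inter> void C"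
  by (auto simp: void_def)

definition finite_borel :: "'b set \<Rightarrow> bool" where
  "finite_borel B \<longleftrightarrow> B \<in> sets borel \<and> emeasure \<Lambda> B \<noteq> \<infinity>"

lemma finite_borel_subset: "finite_borel C \<Longrightarrow> B \<in> sets borel \<Longrightarrow> B \<subseteq> C \<Longrightarrow> finite_borel B"
  unfolding finite_borel_def
  by (metis emeasure_mono ennreal_top_neq_one infinity_ennreal_def neq_top_trans sets_intensity)

lemma finite_borel_Un: "finite_borel B \<Longrightarrow> finite_borel C \<Longrightarrow> finite_borel (B \<union> C)"
  unfolding finite_borel_def
  using emeasure_subadditive[of B \<Lambda> C] by (auto simp: top_unique ennreal_add_eq_top)

lemma measure_intensity_Un:
  "finite_borel B \<Longrightarrow> finite_borel C \<Longrightarrow> B \<inter> C = {} \<Longrightarrow> measure \<Lambda> (B \<union> C) = measure \<Lambda> B + measure \<Lambda> C"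
  unfolding finite_borel_def by (intro measure_Union) (auto simp: less_top)

lemma prob_hit:
  assumes "finite_borel a" "finite_borel c" "a \<inter> c = {}"
  shows "prob (void c - void a) = exp (- measure \<Lambda> c) * (1 - exp (- measure \<Lambda> a))"
proof -
  have "void c - void a = void c - void (a \<union> c)" by (auto simp: void_Un)
  also have "prob \<dots> = prob (void c) - prob (void (a \<union> c))"
    using assms by (intro finite_measure_Diff) (auto simp: finite_borel_def void_Un)
  also have "\<dots> = exp (- measure \<Lambda> c) * (1 - exp (- measure \<Lambda> a))"
    using assms finite_borel_Un[of a c] measure_intensity_Un[of a c]
    by (simp add: finite_borel_def prob_void algebra_simps flip: exp_add)
  finally show ?thesis .
qed

text \<open>Meant for two simultaneous cell events: two cells are hit while a region disjoint from
  both is void.\<close>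

lemma prob_hit2:
  assumes f: "finite_borel a" "finite_borel b" "finite_borel c"
    and d: "a \<inter> b = {}" "a \<inter> c = {}" "b \<inter> c = {}"
  shows "prob (void c - void a - void b)
    = exp (- measure \<Lambda> c) * (1 - exp (- measure \<Lambda> a)) * (1 - exp (- measure \<Lambda> b))"
proof -
  have "void c - void a - void b = (void c - void a) - (void (b \<union> c) - void a)" by (auto simp: void_Un)
  also have "prob \<dots> = prob (void c - void a) - prob (void (b \<union> c) - void a)"
    using f by (intro finite_measure_Diff) (auto simp: finite_borel_def void_Un)
  also have "\<dots> = exp (- measure \<Lambda> c) * (1 - exp (- measure \<Lambda> a))
      - exp (- measure \<Lambda> (b \<union> c)) * (1 - exp (- measure \<Lambda> a))"
    using f d finite_borel_Un[of b c] by (subst (1 2) prob_hit) auto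
  also have "\<dots> = exp (- measure \<Lambda> c) * (1 - exp (- measure \<Lambda> a)) * (1 - exp (- measure \<Lambda> b))"
    using measure_intensity_Un[OF f(2,3) d(3)] by (simp add: algebra_simps flip: exp_add)
  finally show ?thesis .
qed

definition local_events :: "'b set \<Rightarrow> 'w set set" where
  "local_events U = sigma_sets (space P) {void B |B. finite_borel B \<and> B \<subseteq> U}"

lemma void_local: "finite_borel B \<Longrightarrow> B \<subseteq> U \<Longrightarrow> void B \<in> local_events U"
  unfolding local_events_def by (intro sigma_sets.Basic) auto

lemma local_sigma_algebra: "sigma_algebra (space P) (local_events U)"
  unfolding local_events_def by (rule sigma_algebra_sigma_sets) (auto simp: void_def)

text \<open>Void events are closed under intersection, by \<open>void_Un\<close>, and for disjoint
  sets their probabilities multiply because the intensity is additive in the exponent. The pi-lambda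
  argument extends this to the generated sigma-algebras.\<close>

lemma local_indep:
  assumes "U \<inter> U' = {}" "X \<in> local_events U" "Y \<in> local_events U'"
  shows "prob (X \<inter> Y) = prob X * prob Y"
proof -
  let ?E = "\<lambda>U. {void B |B. finite_borel B \<and> B \<subseteq> U}"
  have ind: "indep_set (?E U) (?E U')"
  proof (rule indep_setI)
    show "?E U \<subseteq> events" "?E U' \<subseteq> events" by (auto simp: finite_borel_def)
    fix a b assume "a \<in> ?E U" "b \<in> ?E U'"
    then obtain B C where BC: "a = void B" "finite_borel B" "B \<subseteq> U" "b = void C" "finite_borel C" "C \<subseteq> U'"
      by blast
    then have "B \<inter> C = {}" using assms(1) by auto
    then show "prob (a \<inter> b) = prob a * prob b"
      using BC finite_borel_Un[of B C] measure_intensity_Un[of B C]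
      by (simp add: finite_borel_def prob_void flip: void_Un exp_add)
  qed
  have stable: "Int_stable (?E V)" for V
    unfolding Int_stable_def
  proof safe
    fix B C assume "finite_borel B" "B \<subseteq> V" "finite_borel C" "C \<subseteq> V"
    then show "\<exists>D. void B \<inter> void C = void D \<and> finite_borel D \<and> D \<subseteq> V"
      using void_Un[of B C] finite_borel_Un[of B C] by (intro exI[of _ "B \<union> C"]) auto
  qed
  have "indep_set (local_events U) (local_events U')"
    unfolding local_events_def by (rule indep_set_sigma_sets[OF ind stable stable])
  then show ?thesis using assms(2,3) by (rule indep_setD)
qed

lemma points_Int:
  assumes "\<omega> \<in> space P" "B \<in> sets borel" "bounded B"
  shows "finite (points (\<eta> \<omega>) \<inter> B)" "of_nat (card (points (\<eta> \<omega>) \<inter> B)) \<le> emeasure (\<eta> \<omega>) B"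
  using counting_measure_points[OF counting[OF assms(1)] assms(2,3)] by auto

end

text \<open>A family of exclusion regions \<open>reg \<tau> p = {q. (p, q) \<in> U \<tau>}\<close>, one for each threshold \<open>\<tau>\<close>.\<close>
locale exclusion_process = void_process P \<eta> \<Lambda> S for P :: "'w measure" and \<eta> and \<Lambda> :: "'b::euclidean_space measure" and S +
  fixes U :: "real \<Rightarrow> ('b \<times> 'b) set"
  assumes open_region: "open (U \<tau>)"
    and region_irrefl: "(p, p) \<notin> U \<tau>"
    and finite_intensity: "bounded B \<Longrightarrow> B \<in> sets borel \<Longrightarrow> emeasure \<Lambda> B \<noteq> \<infinity>"
    and diffuse: "e > 0 \<Longrightarrow> \<exists>\<delta>>0. \<forall>p. measure \<Lambda> (cball p \<delta>) \<le> e"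
    and mean_finite: "bounded B \<Longrightarrow> B \<in> sets borel \<Longrightarrow> (\<integral>\<^sup>+\<omega>. emeasure (\<eta> \<omega>) B \<partial>P) < \<infinity>"
begin

section \<open>Discretisation of exceedances into void events\<close>

definition reg :: "real \<Rightarrow> 'b \<Rightarrow> 'b set" where "reg \<tau> p = {q. (p, q) \<in> U \<tau>}"

text \<open>Taking the closure of \<open>K\<close> makes this set open for bounded \<open>K\<close>:
  its complement is the projection of a closed set along a compact factor.\<close>

definition common_reg :: "real \<Rightarrow> 'b set \<Rightarrow> 'b set" where
  "common_reg \<tau> K = {q. \<forall>p\<in>closure K. (p, q) \<in> U \<tau>}"

definition exceed :: "('b \<Rightarrow> real) \<Rightarrow> 'b set \<Rightarrow> 'b set" where
  "exceed T \<phi> = {p\<in>\<phi>. \<phi> \<inter> reg (T p) p = {}}"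

text \<open>The threshold value is part of the index, so that \<open>T\<close> is constant on each
  cell.\<close>

definition cell :: "nat \<Rightarrow> ('b \<Rightarrow> real) \<Rightarrow> 'b set \<Rightarrow> nat \<times> real \<Rightarrow> 'b set" where
  "cell n T D i = {p\<in>D. mesh_label n p = fst i \<and> T p = snd i}"

definition cells :: "nat \<Rightarrow> ('b \<Rightarrow> real) \<Rightarrow> 'b set \<Rightarrow> (nat \<times> real) set" where
  "cells n T D = (\<lambda>p. (mesh_label n p, T p)) ` D"

definition inner_reg :: "nat \<Rightarrow> ('b \<Rightarrow> real) \<Rightarrow> 'b set \<Rightarrow> nat \<times> real \<Rightarrow> 'b set" where
  "inner_reg n T D i = common_reg (snd i) (cell n T D i)"

text \<open>The exact location of the point in the cell is unknown, so only the region shared by all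
  possible centres is required to be void. That region is disjoint from the cell
  (\<open>inner_disjoint\<close>), which makes the probability explicit.\<close>

definition cell_event :: "nat \<Rightarrow> ('b \<Rightarrow> real) \<Rightarrow> 'b set \<Rightarrow> nat \<times> real \<Rightarrow> 'w set" where
  "cell_event n T D i = void (inner_reg n T D i) - void (cell n T D i)"

lemma open_common_reg:
  assumes "bounded K"
  shows "open (common_reg \<tau> K)"
proof -
  have c: "compact (closure K)" using assms by simp
  have "common_reg \<tau> K = - {q. \<exists>p. p \<in> closure K \<and> (p, q) \<in> - U \<tau>}"
    by (auto simp: common_reg_def)
  moreover have "closed {q. \<exists>p. p \<in> closure K \<and> (p, q) \<in> - U \<tau>}"
  proof -
    have "{q. \<exists>p. p \<in> closure K \<and> (p, q) \<in> - U \<tau>} = snd ` ((closure K \<times> UNIV) \<inter> - U \<tau>)"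
      by force
    also have "\<dots> = {q. \<exists>p. p \<in> closure K \<and> (p, q) \<in> (closure K \<times> UNIV) \<inter> - U \<tau>}"
      by force
    also have "closed \<dots>"
    proof (rule closed_compact_projection[OF c])
      show "closed ((closure K \<times> UNIV) \<inter> - U \<tau>)"
        using open_region[of \<tau>] by (intro closed_Int closed_Times closed_Compl) auto
    qed
    finally show ?thesis .
  qed
  ultimately show ?thesis by (simp add: open_Compl)
qed

lemma common_reg_subset: "p \<in> K \<Longrightarrow> common_reg \<tau> K \<subseteq> reg \<tau> p"
  using closure_subset by (auto simp: common_reg_def reg_def)

lemma open_reg: "open (reg \<tau> p)"
  using open_common_reg[of "{p}" \<tau>] by (simp add: common_reg_def reg_def)

lemma cell_props:
  "cell n T D i \<subseteq> D"
  "p \<in> cell n T D i \<Longrightarrow> q \<in> cell n T D i \<Longrightarrow> dist p q < 1 / Suc n"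
  "p \<in> cell n T D i \<longleftrightarrow> p \<in> D \<and> i = (mesh_label n p, T p)"
  "i \<in> cells n T D \<longleftrightarrow> cell n T D i \<noteq> {}"
  by (cases i; auto simp: cell_def cells_def image_iff prod_eq_iff intro!: dist_mesh_label[of n, simplified])+

lemma inner_disjoint: "cell n T D i \<inter> inner_reg n T D i = {}"
proof -
  have "\<And>p. p \<in> cell n T D i \<Longrightarrow> p \<notin> inner_reg n T D i"
    using common_reg_subset region_irrefl by (fastforce simp: inner_reg_def reg_def)
  then show ?thesis by auto
qed

lemma inner_subset: "p \<in> cell n T D i \<Longrightarrow> inner_reg n T D i \<subseteq> reg (T p) p"
  using common_reg_subset[of p "cell n T D i" "snd i"] by (auto simp: inner_reg_def cell_props(3))

lemma closure_cell_subset: "p \<in> cell n T D i \<Longrightarrow> closure (cell n T D i) \<subseteq> cball p (1 / Suc n)"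
  by (intro closure_minimal subsetI) (auto dest!: cell_props(2)[of p])

lemma finite_cells: "bounded D \<Longrightarrow> finite (T ` D) \<Longrightarrow> finite (cells n T D)"
  by (rule finite_subset[of _ "mesh_label n ` D \<times> T ` D"])
    (auto simp: cells_def finite_mesh_label)

text \<open>By openness of \<open>U\<close>, a point that excludes \<open>p\<close> also excludes
  all centres near \<open>p\<close>, hence eventually the whole closed cell of
  \<open>p\<close>.\<close>

lemma eventually_inner:
  assumes "p \<in> D" "q \<in> reg (T p) p"
  shows "eventually (\<lambda>n. q \<in> inner_reg n T D (mesh_label n p, T p)) sequentially"
proof -
  have "open ((\<lambda>x. (x, q)) -` U (T p))"
    by (intro open_vimage open_region continuous_intros)
  then obtain e where e: "e > 0" "cball p e \<subseteq> (\<lambda>x. (x, q)) -` U (T p)"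
    using assms(2) unfolding reg_def open_contains_cball by blast
  show ?thesis
    using eventually_mesh[OF e(1)]
  proof eventually_elim
    case (elim n)
    have "p \<in> cell n T D (mesh_label n p, T p)" using assms by (simp add: cell_props)
    then have "closure (cell n T D (mesh_label n p, T p)) \<subseteq> cball p e"
      using closure_cell_subset[of p n T D] elim by (force simp: dist_commute)
    then show ?case using e(2) by (auto simp: inner_reg_def common_reg_def)
  qed
qed

lemma cells_hit:
  assumes "\<omega> \<in> space P"
  shows "{i\<in>cells n T D. \<omega> \<in> cell_event n T D i} =
    (\<lambda>p. (mesh_label n p, T p)) ` {p\<in>points (\<eta> \<omega>) \<inter> D. points (\<eta> \<omega>) \<inter> inner_reg n T D (mesh_label n p, T p) = {}}"
  using assms by (auto simp: cell_event_def void_def cell_props image_iff)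

text \<open>A fixed realisation has finitely many points in \<open>D\<close>. A fine mesh separates
  them, and every one that is not an exceedance eventually has a point in its inner region; from
  then on the two counts agree exactly.\<close>

lemma eventually_card_cells:
  assumes \<omega>: "\<omega> \<in> space P" and D: "D \<in> sets borel" "bounded D"
  shows "eventually (\<lambda>n. card {i\<in>cells n T D. \<omega> \<in> cell_event n T D i} = card (exceed T (points (\<eta> \<omega>)) \<inter> D)) sequentially"
proof -
  let ?\<phi> = "points (\<eta> \<omega>)"
  have fin: "finite (?\<phi> \<inter> D)" by (rule points_Int[OF \<omega> D])
  have inj: "eventually (\<lambda>n. \<forall>p\<in>?\<phi> \<inter> D. \<forall>q\<in>?\<phi> \<inter> D. p \<noteq> q \<longrightarrow> mesh_label n p \<noteq> mesh_label n q) sequentially"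
  proof (intro eventually_ball_finite fin ballI)
    fix p q
    show "eventually (\<lambda>n. p \<noteq> q \<longrightarrow> mesh_label n p \<noteq> mesh_label n q) sequentially"
    proof (cases "p = q")
      case False
      then have "dist p q > 0" by simp
      from eventually_mesh[OF this] show ?thesis
        by eventually_elim (metis dist_mesh_label less_asym)
    qed simp
  qed
  have ex: "eventually (\<lambda>n. \<forall>p\<in>?\<phi> \<inter> D. ?\<phi> \<inter> reg (T p) p \<noteq> {} \<longrightarrow>
      ?\<phi> \<inter> inner_reg n T D (mesh_label n p, T p) \<noteq> {}) sequentially"
  proof (intro eventually_ball_finite fin ballI)
    fix p assume p: "p \<in> ?\<phi> \<inter> D"
    show "eventually (\<lambda>n. ?\<phi> \<inter> reg (T p) p \<noteq> {} \<longrightarrow>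
      ?\<phi> \<inter> inner_reg n T D (mesh_label n p, T p) \<noteq> {}) sequentially"
    proof (cases "?\<phi> \<inter> reg (T p) p = {}")
      case False
      then obtain q where "q \<in> ?\<phi>" "q \<in> reg (T p) p" by auto
      then have "eventually (\<lambda>n. q \<in> inner_reg n T D (mesh_label n p, T p)) sequentially"
        using eventually_inner[of p D q T] p by simp
      then show ?thesis by eventually_elim (use \<open>q \<in> ?\<phi>\<close> in auto)
    qed simp
  qed
  show ?thesis using inj ex
  proof eventually_elim
    case (elim n)
    have eq: "{p\<in>?\<phi> \<inter> D. ?\<phi> \<inter> inner_reg n T D (mesh_label n p, T p) = {}} = exceed T ?\<phi> \<inter> D"
    proof -
      have "inner_reg n T D (mesh_label n p, T p) \<subseteq> reg (T p) p" if "p \<in> D" for p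
        using inner_subset[of p n T D "(mesh_label n p, T p)"] that by (simp add: cell_props(3))
      then show ?thesis using elim(2) unfolding exceed_def by blast
    qed
    have "inj_on (\<lambda>p. (mesh_label n p, T p)) (exceed T ?\<phi> \<inter> D)"
      using elim(1) by (auto simp: inj_on_def exceed_def)
    then show ?case
      unfolding cells_hit[OF \<omega>] eq by (rule card_image)
  qed
qed

definition simple_threshold :: "('b \<Rightarrow> real) \<Rightarrow> 'b set \<Rightarrow> bool" where
  "simple_threshold T D \<longleftrightarrow>
     D \<in> sets borel \<and> bounded D \<and> T \<in> borel_measurable borel \<and> finite (T ` D)"

text \<open>Finite intensity of the regions enters the formulas for probabilities; measurability of
  counts rests on \<open>simple_threshold\<close> alone and is thus available for unrestricted
  regions too.\<close>

definition admissible :: "('b \<Rightarrow> real) \<Rightarrow> 'b set \<Rightarrow> bool" where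
  "admissible T D \<longleftrightarrow> simple_threshold T D \<and> (\<forall>p\<in>D. finite_borel (reg (T p) p))"

lemma admissible_simple: "admissible T D \<Longrightarrow> simple_threshold T D"
  by (simp add: admissible_def)

lemma cell_borel: "simple_threshold T D \<Longrightarrow> cell n T D i \<in> sets borel"
proof -
  assume "simple_threshold T D"
  then have [measurable]: "D \<in> sets borel" "T \<in> borel_measurable borel" by (auto simp: simple_threshold_def)
  have "{p\<in>space borel. p \<in> D \<and> mesh_label n p = fst i \<and> T p = snd i} \<in> sets borel" by measurable
  then show ?thesis by (simp add: cell_def)
qed

lemma cell_bounded: "simple_threshold T D \<Longrightarrow> bounded (cell n T D i)"
  unfolding simple_threshold_def by (rule bounded_subset[OF _ cell_props(1)]) auto

lemma cell_finite_borel: "simple_threshold T D \<Longrightarrow> finite_borel (cell n T D i)"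
  using cell_borel cell_bounded finite_intensity by (auto simp: finite_borel_def)

lemma inner_open: "simple_threshold T D \<Longrightarrow> open (inner_reg n T D i)"
  unfolding inner_reg_def by (intro open_common_reg cell_bounded)

lemma inner_finite_borel:
  assumes "admissible T D" "i \<in> cells n T D"
  shows "finite_borel (inner_reg n T D i)"
proof -
  obtain p where p: "p \<in> cell n T D i" using assms(2) by (auto simp: cell_props(4))
  then have "p \<in> D" using cell_props(1) by blast
  then have "finite_borel (reg (T p) p)" using assms(1) unfolding admissible_def by blast
  then show ?thesis
    by (rule finite_borel_subset[OF _ borel_open[OF inner_open[OF admissible_simple[OF assms(1)]]] inner_subset[OF p]])
qed

lemma cell_event_events:
  assumes "simple_threshold T D"
  shows "cell_event n T D i \<in> events"
  unfolding cell_event_def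
  by (intro sets.Diff void_events cell_borel[OF assms] borel_open inner_open[OF assms])

lemma prob_cell_event:
  assumes "admissible T D" "i \<in> cells n T D"
  shows "prob (cell_event n T D i) =
    exp (- measure \<Lambda> (inner_reg n T D i)) * (1 - exp (- measure \<Lambda> (cell n T D i)))"
  unfolding cell_event_def using inner_disjoint
  by (intro prob_hit cell_finite_borel inner_finite_borel admissible_simple assms)

section \<open>The Mecke formula for the mean number of exceedances\<close>

definition cell_sum :: "nat \<Rightarrow> ('b \<Rightarrow> real) \<Rightarrow> 'b set \<Rightarrow> real" where
  "cell_sum n T D = (\<Sum>i\<in>cells n T D. measure \<Lambda> (cell n T D i) * exp (- measure \<Lambda> (inner_reg n T D i)))"

text \<open>The right-hand side of the Mecke formula: a point added at \<open>p\<close> is an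
  exceedance iff the process has no point in the exclusion region of \<open>p\<close>.\<close>

definition intensity_exceed :: "('b \<Rightarrow> real) \<Rightarrow> 'b set \<Rightarrow> real" where
  "intensity_exceed T D = (LINT p:D|\<Lambda>. exp (- measure \<Lambda> (reg (T p) p)))"

lemma threshold_finite:
  assumes "simple_threshold T D"
  shows "finite (cells n T D)" "finite_borel D"
  using assms finite_cells finite_intensity by (auto simp: simple_threshold_def finite_borel_def)

lemma sum_indicator_cells:
  assumes "admissible T D"
  shows "(\<Sum>i\<in>cells n T D. f i * indicator (cell n T D i) p) = indicator D p * (f (mesh_label n p, T p) :: real)"
proof (cases "p \<in> D")
  case True
  have "(\<Sum>i\<in>cells n T D. f i * indicator (cell n T D i) p) =
      (\<Sum>i\<in>{(mesh_label n p, T p)}. f i * indicator (cell n T D i) p)"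
    using True threshold_finite[OF admissible_simple[OF assms]]
    by (intro sum.mono_neutral_right) (auto simp: cells_def indicator_def cell_props(3))
  then show ?thesis using True by (simp add: cell_props(3))
qed (auto simp: indicator_def cell_props(3))

lemma space_intensity [simp]: "space \<Lambda> = UNIV"
  using sets_eq_imp_space_eq[OF sets_intensity] by simp

text \<open>Turns the Riemann sum into the integral of a step function, to which dominated
  convergence applies.\<close>

lemma cell_sum_eq:
  assumes adm: "admissible T D"
  shows "integrable \<Lambda> (\<lambda>p. indicator D p * exp (- measure \<Lambda> (inner_reg n T D (mesh_label n p, T p))))"
    "cell_sum n T D = (\<integral>p. indicator D p * exp (- measure \<Lambda> (inner_reg n T D (mesh_label n p, T p))) \<partial>\<Lambda>)"
proof -
  let ?f = "\<lambda>i. exp (- measure \<Lambda> (inner_reg n T D i))"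
  have int: "integrable \<Lambda> (\<lambda>p. ?f i * indicator (cell n T D i) p)" for i
    using cell_finite_borel[OF admissible_simple[OF adm], of n i]
    by (intro integrable_mult_right integrable_real_indicator) (auto simp: finite_borel_def less_top)
  show "integrable \<Lambda> (\<lambda>p. indicator D p * ?f (mesh_label n p, T p))"
    unfolding sum_indicator_cells[OF adm, where f = ?f, symmetric]
    by (intro Bochner_Integration.integrable_sum int)
  have "(\<integral>p. indicator D p * ?f (mesh_label n p, T p) \<partial>\<Lambda>) = (\<Sum>i\<in>cells n T D. \<integral>p. ?f i * indicator (cell n T D i) p \<partial>\<Lambda>)"
    unfolding sum_indicator_cells[OF adm, where f = ?f, symmetric]
    by (intro Bochner_Integration.integral_sum int)
  also have "\<dots> = cell_sum n T D"
    unfolding cell_sum_def by (intro sum.cong refl) (simp add: mult.commute)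
  finally show "cell_sum n T D = (\<integral>p. indicator D p * ?f (mesh_label n p, T p) \<partial>\<Lambda>)" by simp
qed

lemma inner_measure_tendsto:
  assumes adm: "admissible T D" and p: "p \<in> D"
  shows "(\<lambda>n. measure \<Lambda> (inner_reg n T D (mesh_label n p, T p))) \<longlonglongrightarrow> measure \<Lambda> (reg (T p) p)"
proof -
  have f: "finite_borel (reg (T p) p)" using adm p by (auto simp: admissible_def)
  have sub: "inner_reg n T D (mesh_label n p, T p) \<subseteq> reg (T p) p" for n
    using inner_subset[of p n T D "(mesh_label n p, T p)"] p by (simp add: cell_props(3))
  have "(\<lambda>n. \<integral>q. indicator (inner_reg n T D (mesh_label n p, T p)) q \<partial>\<Lambda>) \<longlonglongrightarrow> (\<integral>q. indicator (reg (T p) p) q \<partial>\<Lambda> :: real)"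
  proof (rule integral_dominated_convergence)
    show "integrable \<Lambda> (indicator (reg (T p) p) :: _ \<Rightarrow> real)"
      using f by (intro integrable_real_indicator) (auto simp: finite_borel_def less_top)
    show "AE q in \<Lambda>. (\<lambda>n. indicator (inner_reg n T D (mesh_label n p, T p)) q :: real) \<longlonglongrightarrow> indicator (reg (T p) p) q"
    proof (rule AE_I2)
      fix q
      show "(\<lambda>n. indicator (inner_reg n T D (mesh_label n p, T p)) q :: real) \<longlonglongrightarrow> indicator (reg (T p) p) q"
      proof (cases "q \<in> reg (T p) p")
        case True
        from eventually_inner[of p D q T, OF p True] show ?thesis
          by (intro tendsto_eventually) (auto elim!: eventually_mono simp: True)
      next
        case False
        then have "q \<notin> inner_reg n T D (mesh_label n p, T p)" for n using sub by auto
        then show ?thesis using False by simp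
      qed
    qed
    show "AE q in \<Lambda>. norm (indicator (inner_reg n T D (mesh_label n p, T p)) q :: real) \<le> indicator (reg (T p) p) q" for n
      using sub by (intro AE_I2) (auto simp: indicator_def)
  qed (use inner_open[OF admissible_simple[OF adm]] open_reg in \<open>auto intro!: borel_measurable_indicator\<close>)
  then show ?thesis by simp
qed

lemma cell_sum_tendsto:
  assumes adm: "admissible T D"
  shows "(\<lambda>n. cell_sum n T D) \<longlonglongrightarrow> intensity_exceed T D"
proof -
  have "(\<lambda>n. \<integral>p. indicator D p * exp (- measure \<Lambda> (inner_reg n T D (mesh_label n p, T p))) \<partial>\<Lambda>)
     \<longlonglongrightarrow> (\<integral>p. indicator D p * exp (- measure \<Lambda> (reg (T p) p)) \<partial>\<Lambda>)"
  proof (rule integral_dominated_convergence)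
    show "integrable \<Lambda> (indicator D :: _ \<Rightarrow> real)"
      using threshold_finite(2)[OF admissible_simple[OF adm]] by (intro integrable_real_indicator) (auto simp: finite_borel_def less_top)
    have lim: "(\<lambda>n. indicator D p * exp (- measure \<Lambda> (inner_reg n T D (mesh_label n p, T p))))
       \<longlonglongrightarrow> indicator D p * exp (- measure \<Lambda> (reg (T p) p))" for p
      by (cases "p \<in> D") (auto intro!: tendsto_intros inner_measure_tendsto adm)
    then show "AE p in \<Lambda>. (\<lambda>n. indicator D p * exp (- measure \<Lambda> (inner_reg n T D (mesh_label n p, T p))))
       \<longlonglongrightarrow> indicator D p * exp (- measure \<Lambda> (reg (T p) p))" by simp
    show m: "(\<lambda>p. indicator D p * exp (- measure \<Lambda> (inner_reg n T D (mesh_label n p, T p)))) \<in> borel_measurable \<Lambda>" for n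
      using cell_sum_eq(1)[OF adm] by (rule borel_measurable_integrable)
    show "(\<lambda>p. indicator D p * exp (- measure \<Lambda> (reg (T p) p))) \<in> borel_measurable \<Lambda>"
      by (rule borel_measurable_LIMSEQ_real[OF lim m])
    show "AE p in \<Lambda>. norm (indicator D p * exp (- measure \<Lambda> (inner_reg n T D (mesh_label n p, T p)))) \<le> indicator D p" for n
      by (intro AE_I2) (auto simp: indicator_def)
  qed
  then show ?thesis
    unfolding intensity_exceed_def set_lebesgue_integral_def cell_sum_eq(2)[OF adm] by simp
qed

lemma cell_sum_le: assumes "admissible T D" shows "cell_sum n T D \<le> measure \<Lambda> D"
proof -
  have "cell_sum n T D \<le> (\<integral>p. indicator D p \<partial>\<Lambda>)"
    unfolding cell_sum_eq(2)[OF assms]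
  proof (rule integral_mono[OF cell_sum_eq(1)[OF assms]])
    show "integrable \<Lambda> (indicator D :: _ \<Rightarrow> real)"
      using threshold_finite(2)[OF admissible_simple[OF assms]] by (intro integrable_real_indicator) (auto simp: finite_borel_def less_top)
  qed (auto simp: indicator_def)
  then show ?thesis by simp
qed

lemma eventually_cell_small:
  assumes adm: "admissible T D" and e: "e > 0"
  shows "eventually (\<lambda>n. \<forall>i. measure \<Lambda> (cell n T D i) \<le> e) sequentially"
proof -
  obtain \<delta> where \<delta>: "\<delta> > 0" "\<And>p. measure \<Lambda> (cball p \<delta>) \<le> e" using diffuse[OF e] by blast
  show ?thesis using eventually_mesh[OF \<delta>(1)]
  proof eventually_elim
    case (elim n)
    have "measure \<Lambda> (cell n T D i) \<le> e" for i
    proof (cases "cell n T D i = {}")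
      case False
      then obtain p where p: "p \<in> cell n T D i" by auto
      then have "cell n T D i \<subseteq> cball p \<delta>"
        using closure_cell_subset[OF p] closure_subset[of "cell n T D i"] elim by force
      then have "measure \<Lambda> (cell n T D i) \<le> measure \<Lambda> (cball p \<delta>)"
        using finite_intensity[of "cball p \<delta>"] by (intro measure_mono_fmeasurable cell_borel[OF admissible_simple[OF adm], folded sets_intensity] fmeasurableI)
          (auto simp: less_top cell_borel[OF admissible_simple[OF adm]])
      then show ?thesis using \<delta>(2)[of p] by linarith
    qed (use e in simp)
    then show ?case by blast
  qed
qed

lemma sum_prob_cells_le:
  assumes adm: "admissible T D"
  shows "(\<Sum>i\<in>cells n T D. prob (cell_event n T D i)) \<le> cell_sum n T D"
  unfolding cell_sum_def
proof (rule sum_mono)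
  fix i assume "i \<in> cells n T D"
  have "1 - exp (- measure \<Lambda> (cell n T D i)) \<le> measure \<Lambda> (cell n T D i)"
    using exp_ge_add_one_self[of "- measure \<Lambda> (cell n T D i)"] by linarith
  then show "prob (cell_event n T D i) \<le> measure \<Lambda> (cell n T D i) * exp (- measure \<Lambda> (inner_reg n T D i))"
    using \<open>i \<in> cells n T D\<close> by (simp add: prob_cell_event[OF adm] mult.commute)
qed

lemma sum_prob_cells_tendsto:
  assumes adm: "admissible T D"
  shows "(\<lambda>n. \<Sum>i\<in>cells n T D. prob (cell_event n T D i)) \<longlonglongrightarrow> intensity_exceed T D"
proof -
  have "(\<lambda>n. (\<Sum>i\<in>cells n T D. prob (cell_event n T D i)) - cell_sum n T D) \<longlonglongrightarrow> 0"
  proof (rule tendstoI)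
    fix e :: real assume e: "e > 0"
    \<comment> \<open>The error is relative: \<open>e'\<close> times a sum bounded by the intensity
      of \<open>D\<close>. Adding one in the denominator covers intensity zero.\<close>
    define e' where "e' = e / (measure \<Lambda> D + 1)"
    have e': "e' > 0" "e' * measure \<Lambda> D < e"
      using e by (auto simp: e'_def field_simps add_pos_nonneg add_nonneg_pos)
    show "eventually (\<lambda>n. dist ((\<Sum>i\<in>cells n T D. prob (cell_event n T D i)) - cell_sum n T D) 0 < e) sequentially"
      using eventually_cell_small[OF adm e'(1)]
    proof eventually_elim
      case (elim n)
      have "(1 - e') * cell_sum n T D \<le> (\<Sum>i\<in>cells n T D. prob (cell_event n T D i))"
        unfolding cell_sum_def sum_distrib_left
      proof (rule sum_mono)
        fix i assume i: "i \<in> cells n T D"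
        let ?m = "measure \<Lambda> (cell n T D i)"
        have "?m * (1 - e') \<le> ?m * (1 - ?m)"
          using elim[rule_format, of i] by (intro mult_left_mono) auto
        also have "\<dots> \<le> ?m * exp (- ?m)"
          using exp_ge_add_one_self[of "- ?m"] by (intro mult_left_mono) auto
        also have "\<dots> \<le> 1 - exp (- ?m)"
          using exp_ge_add_one_self[of ?m] by (simp add: exp_minus field_simps)
        finally show "(1 - e') * (?m * exp (- measure \<Lambda> (inner_reg n T D i))) \<le> prob (cell_event n T D i)"
          using mult_right_mono[of "?m * (1 - e')" "1 - exp (- ?m)" "exp (- measure \<Lambda> (inner_reg n T D i))"]
          by (simp add: prob_cell_event[OF adm i] mult_ac)
      qed
      moreover have "e' * cell_sum n T D \<le> e' * measure \<Lambda> D"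
        using cell_sum_le[OF adm] e' by (intro mult_left_mono) auto
      ultimately show ?case
        using sum_prob_cells_le[OF adm, of n] e'(2) by (simp add: dist_real_def algebra_simps abs_le_iff)
    qed
  qed
  from tendsto_add[OF this cell_sum_tendsto[OF adm]] show ?thesis by simp
qed

abbreviation number :: "('b \<Rightarrow> real) \<Rightarrow> 'b set \<Rightarrow> 'w \<Rightarrow> nat" where
  "number T D \<omega> \<equiv> card (exceed T (points (\<eta> \<omega>)) \<inter> D)"

lemma card_cells_eq:
  assumes adm: "simple_threshold T D"
  shows "real (card {i\<in>cells n T D. \<omega> \<in> cell_event n T D i}) = (\<Sum>i\<in>cells n T D. indicator (cell_event n T D i) \<omega>)"
  using threshold_finite(1)[OF adm] by (simp add: indicator_def sum.If_cases Int_def conj_commute)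

lemma measurable_number:
  assumes adm: "simple_threshold T D"
  shows "(\<lambda>\<omega>. real (number T D \<omega>)) \<in> borel_measurable P"
proof (rule borel_measurable_LIMSEQ_real)
  fix \<omega> assume "\<omega> \<in> space P"
  then show "(\<lambda>n. \<Sum>i\<in>cells n T D. indicator (cell_event n T D i) \<omega>) \<longlonglongrightarrow> real (number T D \<omega>)"
    using eventually_card_cells[of \<omega> D T] adm
    by (intro tendsto_eventually) (auto simp: simple_threshold_def card_cells_eq[OF adm, symmetric])
qed (use cell_event_events[OF adm] in auto)

text \<open>Dominated convergence along the mesh: all cell counts are bounded by the mass of
  \<open>D\<close>, multiplicities included, and this mass has finite mean.\<close>

lemma number_expectation:
  assumes adm: "admissible T D"
  shows "integrable P (\<lambda>\<omega>. real (number T D \<omega>))"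
    "expectation (\<lambda>\<omega>. real (number T D \<omega>)) = intensity_exceed T D"
proof -
  have D: "D \<in> sets borel" "bounded D" using admissible_simple[OF adm] by (auto simp: simple_threshold_def)
  have fin: "emeasure (\<eta> \<omega>) D < \<top>" if w: "\<omega> \<in> space P" for \<omega>
  proof -
    obtain n :: nat where "emeasure (\<eta> \<omega>) D = of_nat n"
      using counting[OF w] D unfolding counting_measure_on_def by blast
    then show ?thesis by (simp add: ennreal_of_nat_eq_real_of_nat)
  qed
  have dom: "integrable P (\<lambda>\<omega>. enn2real (emeasure (\<eta> \<omega>) D))"
  proof (rule integrableI_nonneg)
    show "(\<lambda>\<omega>. enn2real (emeasure (\<eta> \<omega>) D)) \<in> borel_measurable P"
      using emeasure_measurable[OF D(1)] by simp
    have "(\<integral>\<^sup>+\<omega>. ennreal (enn2real (emeasure (\<eta> \<omega>) D)) \<partial>P) = (\<integral>\<^sup>+\<omega>. emeasure (\<eta> \<omega>) D \<partial>P)"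
      using fin by (intro nn_integral_cong) simp
    then show "(\<integral>\<^sup>+\<omega>. ennreal (enn2real (emeasure (\<eta> \<omega>) D)) \<partial>P) < \<infinity>"
      using mean_finite[OF D(2,1)] by simp
  qed simp
  have lim: "(\<lambda>n. \<Sum>i\<in>cells n T D. indicator (cell_event n T D i) \<omega>) \<longlonglongrightarrow> real (number T D \<omega>)"
    if "\<omega> \<in> space P" for \<omega>
    using eventually_card_cells[OF that D, of T]
    by (intro tendsto_eventually) (auto simp: card_cells_eq[OF admissible_simple[OF adm], symmetric])
  have bound: "norm (\<Sum>i\<in>cells n T D. indicator (cell_event n T D i) \<omega> :: real) \<le> enn2real (emeasure (\<eta> \<omega>) D)"
    if "\<omega> \<in> space P" for \<omega> n
  proof -
    have "card {i\<in>cells n T D. \<omega> \<in> cell_event n T D i} \<le> card (points (\<eta> \<omega>) \<inter> D)"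
      unfolding cells_hit[OF that]
      by (rule order_trans[OF card_image_le card_mono]) (use points_Int[OF that D] in \<open>auto intro: finite_subset[rotated]\<close>)
    then have "of_nat (card {i\<in>cells n T D. \<omega> \<in> cell_event n T D i}) \<le> emeasure (\<eta> \<omega>) D"
      using points_Int(2)[OF that D] by (meson of_nat_mono order_trans)
    from enn2real_mono[OF this] show ?thesis
      using fin[OF that] by (simp add: card_cells_eq[OF admissible_simple[OF adm], symmetric] ennreal_of_nat_eq_real_of_nat)
  qed
  note * = cell_event_events[OF admissible_simple[OF adm]] measurable_number[OF admissible_simple[OF adm]]
  show "integrable P (\<lambda>\<omega>. real (number T D \<omega>))"
    by (rule integrable_dominated_convergence[OF _ _ dom, where s = "\<lambda>n \<omega>. \<Sum>i\<in>cells n T D. indicator (cell_event n T D i) \<omega>"])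
      (use * lim bound in auto)
  have "(\<lambda>n. expectation (\<lambda>\<omega>. \<Sum>i\<in>cells n T D. indicator (cell_event n T D i) \<omega>)) \<longlonglongrightarrow> expectation (\<lambda>\<omega>. real (number T D \<omega>))"
    by (rule integral_dominated_convergence[OF _ _ dom]) (use * lim bound in auto)
  moreover have "expectation (\<lambda>\<omega>. \<Sum>i\<in>cells n T D. indicator (cell_event n T D i) \<omega>)
     = (\<Sum>i\<in>cells n T D. prob (cell_event n T D i))" for n
    using cell_event_events[OF admissible_simple[OF adm]]
    by (subst Bochner_Integration.integral_sum) (auto intro!: integrable_real_indicator sum.cong simp: emeasure_eq_measure)
  ultimately show "expectation (\<lambda>\<omega>. real (number T D \<omega>)) = intensity_exceed T D"
    using sum_prob_cells_tendsto[OF adm] LIMSEQ_unique by auto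
qed

lemma prob_no_cell_event_tendsto:
  assumes adm: "admissible T D"
  shows "(\<lambda>n. prob (space P - (\<Union>i\<in>cells n T D. cell_event n T D i))) \<longlonglongrightarrow> prob {\<omega>\<in>space P. number T D \<omega> = 0}"
proof -
  have D: "D \<in> sets borel" "bounded D" using admissible_simple[OF adm] by (auto simp: simple_threshold_def)
  have [measurable]: "(\<lambda>\<omega>. real (number T D \<omega>)) \<in> borel_measurable P" by (rule measurable_number[OF admissible_simple[OF adm]])
  have "{\<omega>\<in>space P. number T D \<omega> = 0} = {\<omega>\<in>space P. real (number T D \<omega>) = 0}" by auto
  also have "\<dots> \<in> events" by measurable
  finally have m: "{\<omega>\<in>space P. number T D \<omega> = 0} \<in> events" .
  have m': "space P - (\<Union>i\<in>cells n T D. cell_event n T D i) \<in> events" for n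
    by (intro sets.Diff sets.top sets.finite_UN threshold_finite(1)[OF admissible_simple[OF adm]] cell_event_events[OF admissible_simple[OF adm]])
  have "(\<lambda>n. \<integral>\<omega>. indicator (space P - (\<Union>i\<in>cells n T D. cell_event n T D i)) \<omega> \<partial>P)
     \<longlonglongrightarrow> (\<integral>\<omega>. indicator {\<omega>\<in>space P. number T D \<omega> = 0} \<omega> \<partial>P :: real)"
  proof (rule integral_dominated_convergence[where w = "\<lambda>_. 1"])
    show "AE \<omega> in P. (\<lambda>n. indicator (space P - (\<Union>i\<in>cells n T D. cell_event n T D i)) \<omega> :: real)
      \<longlonglongrightarrow> indicator {\<omega>\<in>space P. number T D \<omega> = 0} \<omega>"
    proof (rule AE_I2)
      fix \<omega> assume \<omega>: "\<omega> \<in> space P"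
      have "eventually (\<lambda>n. indicator (space P - (\<Union>i\<in>cells n T D. cell_event n T D i)) \<omega>
          = (indicator {\<omega>\<in>space P. number T D \<omega> = 0} \<omega> :: real)) sequentially"
        using eventually_card_cells[OF \<omega> D, of T]
      proof eventually_elim
        case (elim n)
        have "finite {i\<in>cells n T D. \<omega> \<in> cell_event n T D i}"
          using threshold_finite(1)[OF admissible_simple[OF adm]] by auto
        then have "number T D \<omega> = 0 \<longleftrightarrow> (\<forall>i\<in>cells n T D. \<omega> \<notin> cell_event n T D i)"
          unfolding elim[symmetric] by auto
        then show ?case using \<omega> by (auto simp: indicator_def)
      qed
      then show "(\<lambda>n. indicator (space P - (\<Union>i\<in>cells n T D. cell_event n T D i)) \<omega> :: real)
        \<longlonglongrightarrow> indicator {\<omega>\<in>space P. number T D \<omega> = 0} \<omega>" by (rule tendsto_eventually)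
    qed
    show "AE \<omega> in P. norm (indicator (space P - (\<Union>i\<in>cells n T D. cell_event n T D i)) \<omega> :: real) \<le> 1" for n
      by (simp add: indicator_def)
  qed (use borel_measurable_indicator[OF m] borel_measurable_indicator[OF m'] in auto)
  then show ?thesis by (simp add: Int_absorb1 Int_absorb2 m)
qed

end

subsection \<open>The intensity of the marked Poisson process\<close>

text \<open>The exclusion region of \<open>p = (x, m)\<close> consists of the points \<open>q = (y, t)\<close> whose presence
  prevents the ball of radius \<open>\<tau>\<close> about \<open>x\<close> from lying in the cell of \<open>p\<close>; marks are restricted to \<open>K\<close>.\<close>
definition gap :: "real \<Rightarrow> 'a::euclidean_space \<times> real \<Rightarrow> 'a \<times> real \<Rightarrow> real" where
  "gap \<tau> p q = (norm (fst q - fst p))\<^sup>2 - 2 * \<tau> * norm (fst q - fst p) + (snd p)\<^sup>2 - (snd q)\<^sup>2"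

definition lag_region :: "real set \<Rightarrow> real \<Rightarrow> (('a::euclidean_space \<times> real) \<times> ('a \<times> real)) set" where
  "lag_region K \<tau> = {z. gap \<tau> (fst z) (snd z) < 0 \<and> snd (snd z) \<in> K}"

lemma open_lag_region: assumes "open K" shows "open (lag_region K \<tau>)"
proof -
  have "open ({z::('a \<times> real) \<times> ('a \<times> real). gap \<tau> (fst z) (snd z) < 0} \<inter> (\<lambda>z. snd (snd z)) -` K)"
    unfolding gap_def by (intro open_Int open_vimage assms open_Collect_less continuous_intros)
  also have "{z. gap \<tau> (fst z) (snd z) < 0} \<inter> (\<lambda>z. snd (snd z)) -` K = lag_region K \<tau>"
    unfolding lag_region_def by blast
  finally show ?thesis .
qed

locale laguerre_process =
  fixes P :: "'w measure" and \<eta> :: "'w \<Rightarrow> ('a::euclidean_space \<times> real) measure"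
    and Q :: "real measure" and \<gamma> A :: real
  assumes gamma: "\<gamma> > 0"
    and Q: "prob_space Q" "sets Q = sets borel"
    and A: "A > 0" "measure Q {0..A} = 1"
    and P: "prob_space P"
    and eta: "poisson_process P (UNIV \<times> {0..}) (scale_measure (ennreal \<gamma>) lborel \<Otimes>\<^sub>M Q) \<eta>"
begin

definition intensity :: "('a \<times> real) measure" where
  "intensity = scale_measure (ennreal \<gamma>) lborel \<Otimes>\<^sub>M Q"

sublocale Q: prob_space Q by (rule Q)

sublocale prob_space P by (rule P)

lemma sets_intensity': "sets intensity = sets borel"
proof -
  have "sets intensity = sets ((borel :: 'a measure) \<Otimes>\<^sub>M (borel :: real measure))"
    unfolding intensity_def using Q(2) by (intro sets_pair_measure_cong) simp_all
  then show ?thesis unfolding borel_prod .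
qed

lemma intensity_Times:
  assumes "B \<in> sets borel" "C \<in> sets borel"
  shows "emeasure intensity (B \<times> C) = ennreal \<gamma> * emeasure lborel B * emeasure Q C"
  unfolding intensity_def using assms Q(2) by (subst Q.emeasure_pair_measure_Times) auto

lemma intensity_ball:
  "r \<ge> 0 \<Longrightarrow> C \<in> sets borel \<Longrightarrow> emeasure intensity (ball x r \<times> C) = ennreal (\<gamma> * unit_ball_vol (real DIM('a)) * r ^ DIM('a) * measure Q C)"
  "r \<ge> 0 \<Longrightarrow> C \<in> sets borel \<Longrightarrow> emeasure intensity (cball x r \<times> C) = ennreal (\<gamma> * unit_ball_vol (real DIM('a)) * r ^ DIM('a) * measure Q C)"
  using gamma by (simp_all add: intensity_Times emeasure_ball emeasure_cball Q.emeasure_eq_measure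
      ennreal_mult mult.assoc)

lemma measure_intensity_ball:
  "r \<ge> 0 \<Longrightarrow> measure intensity (ball x r \<times> UNIV) = \<gamma> * unit_ball_vol (real DIM('a)) * r ^ DIM('a)"
  "r \<ge> 0 \<Longrightarrow> measure intensity (cball x r \<times> UNIV) = \<gamma> * unit_ball_vol (real DIM('a)) * r ^ DIM('a)"
  using gamma Q.prob_space sets_eq_imp_space_eq[OF Q(2)]
  by (simp_all add: measure_eq_emeasure_eq_ennreal[OF _ intensity_ball(1)] measure_eq_emeasure_eq_ennreal[OF _ intensity_ball(2)])

lemma bounded_intensity_finite:
  assumes "bounded (fst ` B)" "B \<in> sets borel"
  shows "emeasure intensity B \<noteq> \<infinity>"
proof -
  obtain r where r: "r > 0" "fst ` B \<subseteq> ball 0 r"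
    using bounded_subset_ballD[OF assms(1)] by blast
  then have "B \<subseteq> ball 0 r \<times> UNIV" by (auto simp: subset_iff)
  moreover have "ball (0 :: 'a) r \<times> (UNIV :: real set) \<in> sets borel" by (intro borel_open open_Times) auto
  ultimately have "emeasure intensity B \<le> emeasure intensity (ball 0 r \<times> UNIV)"
    by (intro emeasure_mono) (auto simp: sets_intensity')
  also have "\<dots> < \<infinity>" using r by (simp add: intensity_ball)
  finally show ?thesis by simp
qed

lemma poisson_void:
  assumes "B \<in> sets borel" "emeasure intensity B \<noteq> \<infinity>"
  shows "measure P {\<omega>\<in>space P. emeasure (\<eta> \<omega>) B = of_nat k} = measure intensity B ^ k / fact k * exp (- measure intensity B)"
  using eta assms unfolding poisson_process_def intensity_def by blast

lemma poisson_point_process: "point_process P (UNIV \<times> {0..}) \<eta>"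
  using eta unfolding poisson_process_def by blast

text \<open>Provides the dominating function of the mesh limit. Once \<open>k\<close> is cancelled
  against the factorial, the mean is an exponential series.\<close>

lemma poisson_mean_finite:
  assumes B: "bounded B" "B \<in> sets borel"
  shows "(\<integral>\<^sup>+\<omega>. emeasure (\<eta> \<omega>) B \<partial>P) < \<infinity>"
proof -
  have fin: "emeasure intensity B \<noteq> \<infinity>"
    using bounded_intensity_finite[OF bounded_fst[OF B(1)] B(2)] .
  define E where "E k = {\<omega>\<in>space P. emeasure (\<eta> \<omega>) B = of_nat k}" for k :: nat
  have [measurable]: "(\<lambda>\<omega>. emeasure (\<eta> \<omega>) B) \<in> borel_measurable P"
    using poisson_point_process B by (simp add: point_process_def)
  have E: "E k \<in> events" for k unfolding E_def by measurable
  let ?m = "measure intensity B"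
  have "(\<integral>\<^sup>+\<omega>. emeasure (\<eta> \<omega>) B \<partial>P) = (\<integral>\<^sup>+\<omega>. (\<Sum>k. of_nat k * indicator (E k) \<omega>) \<partial>P)"
  proof (intro nn_integral_cong)
    fix \<omega> assume \<omega>: "\<omega> \<in> space P"
    obtain n :: nat where n: "emeasure (\<eta> \<omega>) B = of_nat n"
      using poisson_point_process B \<omega> unfolding point_process_def counting_measure_on_def by blast
    have "(\<Sum>k. of_nat k * indicator (E k) \<omega> :: ennreal) = (\<Sum>k\<in>{n}. of_nat k * indicator (E k) \<omega>)"
      by (rule suminf_finite) (auto simp: E_def n indicator_def)
    then show "emeasure (\<eta> \<omega>) B = (\<Sum>k. of_nat k * indicator (E k) \<omega>)"
      using \<omega> n by (simp add: E_def)
  qed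
  also have "\<dots> = (\<Sum>k. of_nat k * emeasure P (E k))"
    using E by (subst nn_integral_suminf) (auto simp: nn_integral_cmult_indicator)
  also have "\<dots> = (\<Sum>k. ennreal (real k * (?m ^ k / fact k * exp (- ?m))))"
    using poisson_void[OF B(2) fin]
    by (intro suminf_cong) (simp add: E_def emeasure_eq_measure ennreal_of_nat_eq_real_of_nat flip: ennreal_mult')
  also have "\<dots> < \<infinity>"
  proof -
    have "summable (\<lambda>k. real (Suc k) * (?m ^ Suc k / fact (Suc k) * exp (- ?m)))"
    proof -
      have "(\<lambda>k. real (Suc k) * (?m ^ Suc k / fact (Suc k) * exp (- ?m))) = (\<lambda>k. (?m * exp (- ?m)) * (?m ^ k / fact k))"
        by (rule ext) (simp add: divide_simps)
      moreover have "summable (\<lambda>k. ?m ^ k / fact k)"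
        using summable_exp[of ?m] by (simp add: field_simps)
      ultimately show ?thesis by (simp only: summable_mult)
    qed
    then have "summable (\<lambda>k. real k * (?m ^ k / fact k * exp (- ?m)))"
      by (subst summable_Suc_iff[symmetric])
    then show ?thesis by (subst suminf_ennreal_eq) (auto intro!: summable_sums)
  qed
  finally show ?thesis .
qed

lemma exclusion_process_lag:
  assumes "open K"
  shows "exclusion_process P \<eta> intensity (UNIV \<times> {0..}) (lag_region K)"
proof
  show "sets intensity = sets borel" by (rule sets_intensity')
  show "\<omega> \<in> space P \<Longrightarrow> counting_measure_on (UNIV \<times> {0..}) (\<eta> \<omega>)" for \<omega>
    using poisson_point_process by (simp add: point_process_def)
  show "B \<in> sets borel \<Longrightarrow> (\<lambda>\<omega>. emeasure (\<eta> \<omega>) B) \<in> borel_measurable P" for B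
    using poisson_point_process by (simp add: point_process_def)
  show "B \<in> sets borel \<Longrightarrow> emeasure intensity B \<noteq> \<infinity> \<Longrightarrow>
      prob {\<omega>\<in>space P. emeasure (\<eta> \<omega>) B = 0} = exp (- measure intensity B)" for B
    using poisson_void[of B 0] by simp
  show "open (lag_region K \<tau> :: (('a \<times> real) \<times> ('a \<times> real)) set)" for \<tau> using open_lag_region[OF assms] .
  show "(p, p) \<notin> lag_region K \<tau>" for p :: "'a \<times> real" and \<tau> by (simp add: lag_region_def gap_def)
  show "bounded B \<Longrightarrow> B \<in> sets borel \<Longrightarrow> emeasure intensity B \<noteq> \<infinity>" for B
    using bounded_intensity_finite bounded_fst by blast
  show "bounded B \<Longrightarrow> B \<in> sets borel \<Longrightarrow> (\<integral>\<^sup>+\<omega>. emeasure (\<eta> \<omega>) B \<partial>P) < \<infinity>" for B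
    by (rule poisson_mean_finite)
  fix e :: real assume e: "e > 0"
  \<comment> \<open>Capping at one gives \<open>\<delta> ^ d \<le> \<delta>\<close>; by translation
    invariance the same radius serves all centres.\<close>
  define \<delta> where "\<delta> = min 1 (e / (\<gamma> * unit_ball_vol (real DIM('a))))"
  have \<delta>: "\<delta> > 0" "\<delta> \<le> 1" "\<gamma> * unit_ball_vol (real DIM('a)) * \<delta> \<le> e"
    using e gamma by (auto simp: \<delta>_def min_def field_simps)
  have "measure intensity (cball p \<delta>) \<le> e" for p
  proof -
    have "cball p \<delta> \<subseteq> cball (fst p) \<delta> \<times> UNIV"
    proof
      fix q assume "q \<in> cball p \<delta>"
      then have "dist (fst p) (fst q) \<le> \<delta>" using dist_fst_le[of p q] by simp
      then show "q \<in> cball (fst p) \<delta> \<times> UNIV" by (simp add: mem_Times_iff)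
    qed
    then have "measure intensity (cball p \<delta>) \<le> measure intensity (cball (fst p) \<delta> \<times> UNIV)"
      using \<delta> by (intro measure_mono_fmeasurable fmeasurableI)
        (auto simp: sets_intensity' intensity_ball intro!: borel_closed closed_Times)
    also have "\<dots> = \<gamma> * unit_ball_vol (real DIM('a)) * \<delta> ^ DIM('a)" using \<delta> by (simp add: measure_intensity_ball)
    also have "\<dots> \<le> \<gamma> * unit_ball_vol (real DIM('a)) * \<delta>"
      using \<delta> gamma power_decreasing[of 1 "DIM('a)" \<delta>] DIM_positive[where 'a='a] by (intro mult_left_mono) (auto simp: Suc_leI)
    finally show ?thesis using \<delta> by linarith
  qed
  then show "\<exists>\<delta>>0. \<forall>p. measure intensity (cball p \<delta>) \<le> e" using \<delta> by blast
qed

text \<open>Two instances. The open strip contains \<open>[0, A]\<close>, hence almost every mark,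
  and bounds the regions in space; all probabilities are computed with it. The instance
  \<open>full\<close> describes inradii of every realisation and serves measurability.\<close>

sublocale exclusion_process P \<eta> intensity "UNIV \<times> {0..}" "lag_region {-1<..<A+1}"
  by (rule exclusion_process_lag) simp

sublocale full: exclusion_process P \<eta> intensity "UNIV \<times> {0..}" "lag_region UNIV"
  by (rule exclusion_process_lag) simp

end

subsection \<open>Poisson approximation for exceedances\<close>

text \<open>A point outside an inner region is only known to have nonnegative gap from some centre
  \<open>p'\<close> in the closure of the cell. This transfers the inequality to the actual point
  \<open>p\<close>: at scale \<open>R\<close> the gap is Lipschitz in the centre with constant
  \<open>8 * R\<close>.\<close>

lemma gap_perturb:
  assumes g: "gap \<tau> p' q \<ge> 0" and pp: "dist p p' \<le> \<mu>" and D: "norm (fst q - fst p) \<le> 2 * R"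
    and m: "0 \<le> snd p" "snd p \<le> A" and \<tau>: "0 \<le> \<tau>" "\<tau> \<le> 9/8 * R" and R: "2 * (A + 1) \<le> R" and \<mu>: "\<mu> \<le> R / 16"
  shows "gap \<tau> p q \<ge> - (8 * R * \<mu>)"
proof -
  define u where "u = norm (fst q - fst p)"
  define u' where "u' = norm (fst q - fst p')"
  have \<mu>0: "0 \<le> \<mu>" using pp zero_le_dist order_trans by blast
  have "\<bar>u' - u\<bar> \<le> norm ((fst q - fst p') - (fst q - fst p))"
    unfolding u_def u'_def by (rule norm_triangle_ineq3)
  also have "\<dots> \<le> \<mu>" using dist_fst_le[of p p'] pp by (simp add: dist_norm norm_minus_commute)
  finally have uu: "\<bar>u' - u\<bar> \<le> \<mu>" .
  have mm: "\<bar>snd p' - snd p\<bar> \<le> \<mu>" using dist_snd_le[of p p'] pp by (simp add: dist_real_def abs_minus_commute)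
  have u0: "0 \<le> u" "u \<le> 2 * R" using D by (auto simp: u_def)
  have "u'\<^sup>2 - u\<^sup>2 = (u' - u) * (u' + u)" by (simp add: power2_eq_square algebra_simps)
  also have "\<dots> \<le> \<mu> * (2 * u + \<mu>)"
  proof -
    have "(u' - u) * (u' + u) \<le> \<bar>u' - u\<bar> * \<bar>u' + u\<bar>" by (metis abs_ge_self abs_mult)
    also have "\<dots> \<le> \<mu> * (2 * u + \<mu>)" using uu u0 \<mu>0 by (intro mult_mono) auto
    finally show ?thesis .
  qed
  also have "\<dots> \<le> \<mu> * (65/16 * R)" using u0 \<mu> \<mu>0 by (intro mult_left_mono) auto
  finally have 1: "u'\<^sup>2 - u\<^sup>2 \<le> \<mu> * (65/16 * R)" .
  have "2 * \<tau> * (u - u') \<le> 2 * \<tau> * \<mu>" using uu \<tau> by (intro mult_left_mono) auto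
  also have "\<dots> \<le> 9/4 * R * \<mu>" using \<tau> \<mu>0 by (intro mult_right_mono) auto
  finally have 2: "2 * \<tau> * (u - u') \<le> 9/4 * R * \<mu>" .
  have "(snd p')\<^sup>2 - (snd p)\<^sup>2 = (snd p' - snd p) * (snd p' + snd p)" by (simp add: power2_eq_square algebra_simps)
  also have "\<dots> \<le> \<bar>snd p' - snd p\<bar> * \<bar>snd p' + snd p\<bar>" by (metis abs_ge_self abs_mult)
  also have "\<dots> \<le> \<mu> * (2 * A + \<mu>)" using mm m \<mu>0 by (intro mult_mono) auto
  also have "\<dots> \<le> \<mu> * (17/16 * R)" using R \<mu> \<mu>0 by (intro mult_left_mono) auto
  finally have 3: "(snd p')\<^sup>2 - (snd p)\<^sup>2 \<le> \<mu> * (17/16 * R)" .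
  have "R * \<mu> \<ge> 0" using u0 \<mu>0 by simp
  \<comment> \<open>The coefficients 65/16, 36/16 and 17/16 of \<open>R * \<mu>\<close> add up to
    118/16, which is below 8.\<close>
  then show ?thesis using g 1 2 3 unfolding gap_def u_def[symmetric] u'_def[symmetric]
    by (simp add: algebra_simps)
qed

context laguerre_process
begin

lemma reg_iff: "q \<in> reg \<tau> p \<longleftrightarrow> gap \<tau> p q < 0 \<and> -1 < snd q \<and> snd q < A + 1"
  by (simp add: reg_def lag_region_def)

text \<open>At distance \<open>v \<ge> 5/2 * R\<close> the term \<open>v * (v - 2 * \<tau>)\<close>
  is at least \<open>5/8 * R\<^sup>2\<close>, whereas a mark in the strip contributes at most
  \<open>(A + 1)\<^sup>2 \<le> R\<^sup>2 / 4\<close>.\<close>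

lemma reg_near:
  assumes R: "2 * (A + 1) \<le> R" and \<tau>: "\<tau> \<le> 9/8 * R" and q: "q \<in> reg \<tau> p"
  shows "dist (fst p) (fst q) < 5/2 * R"
proof (rule ccontr)
  assume "\<not> dist (fst p) (fst q) < 5/2 * R"
  then have v: "norm (fst q - fst p) \<ge> 5/2 * R" by (simp add: dist_norm norm_minus_commute)
  let ?v = "norm (fst q - fst p)"
  have "5/2 * R * (R/4) \<le> ?v * (?v - 2 * \<tau>)"
    using v \<tau> R A by (intro mult_mono) auto
  moreover have "?v * (?v - 2 * \<tau>) < (snd q)\<^sup>2"
    using q unfolding reg_iff gap_def by (auto simp: power2_eq_square algebra_simps) (smt (verit) zero_le_square)
  moreover have "(snd q)\<^sup>2 \<le> (A + 1)\<^sup>2" using q A unfolding reg_iff by (intro power2_le_iff_abs_le[THEN iffD2]) auto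
  moreover have "(A + 1)\<^sup>2 \<le> (R / 2)\<^sup>2" using R A by (intro power_mono) auto
  moreover have "0 < R * R" using R A by simp
  ultimately show False by (simp add: power2_eq_square)
qed

lemma reg_finite_borel:
  assumes "2 * (A + 1) \<le> R" "\<tau> \<le> 9/8 * R"
  shows "finite_borel (reg \<tau> p)"
proof -
  have "fst ` reg \<tau> p \<subseteq> ball (fst p) (5/2 * R)" unfolding image_subset_iff mem_ball
    by (intro ballI reg_near[OF assms])
  then have "bounded (fst ` reg \<tau> p)" using bounded_ball bounded_subset by blast
  then show ?thesis using bounded_intensity_finite open_reg by (auto simp: finite_borel_def)
qed

lemma fst_bounded_finite_borel: "bounded (fst ` B) \<Longrightarrow> B \<in> sets borel \<Longrightarrow> finite_borel B"
  using bounded_intensity_finite by (simp add: finite_borel_def)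

lemma mark_interval_full: "measure Q {-1<..<A+1} = 1"
proof -
  have "measure Q {0..A} \<le> measure Q {-1<..<A+1}"
    using Q(2) by (intro Q.finite_measure_mono) auto
  then show ?thesis using A Q.prob_le_1[of "{-1<..<A+1}"] by simp
qed

context
  fixes T :: "'a \<times> real \<Rightarrow> real" and D :: "('a \<times> real) set" and R :: real
  assumes simple: "simple_threshold T D" and D: "D \<subseteq> UNIV \<times> {0..A}"
    and R: "2 * (A + 1) \<le> R" and T: "\<And>p. p \<in> D \<Longrightarrow> R \<le> T p \<and> T p \<le> 9/8 * R"
begin

lemma admissible_window: "admissible T D"
  using simple reg_finite_borel[OF R] T by (auto simp: admissible_def)

text \<open>Here \<open>\<epsilon>\<close> is the probability that a ball of radius
  \<open>R / 4\<close> is void. Cell events whose representatives are more than \<open>8 * R\<close>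
  apart are independent, and the cells of the remaining partners fit into a ball of radius
  \<open>9 * R\<close>. Almost coinciding pairs have no factor \<open>\<epsilon>\<close>, but are
  confined to a ball of radius \<open>67 * \<mu>\<close>, whose volume vanishes with the
  mesh.\<close>

lemma void_approximation_cells:
  fixes n :: nat
  defines "\<mu> \<equiv> 1 / real (Suc n)" and "\<epsilon> \<equiv> exp (- (\<gamma> * unit_ball_vol (real DIM('a)) * (R/4) ^ DIM('a)))"
  assumes \<mu>: "\<mu> \<le> R / 16"
  shows "\<bar>prob (space P - (\<Union>i\<in>cells n T D. cell_event n T D i)) - exp (- (\<Sum>i\<in>cells n T D. prob (cell_event n T D i)))\<bar>
    \<le> (\<Sum>i\<in>cells n T D. prob (cell_event n T D i)) *
      (2 * \<epsilon> * (\<gamma> * unit_ball_vol (real DIM('a)) * (9 * R) ^ DIM('a)) + \<gamma> * unit_ball_vol (real DIM('a)) * (67 * \<mu>) ^ DIM('a))"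
proof -
  let ?I = "cells n T D" and ?C = "cell n T D" and ?N = "inner_reg n T D" and ?E = "cell_event n T D"
  have adm: "admissible T D" by (rule admissible_window)
  have fin: "finite ?I" using threshold_finite[OF simple] by blast
  have R0: "R > 0" using R A by simp
  have \<mu>0: "\<mu> > 0" by (simp add: \<mu>_def)
  define p where "p i = (SOME p. p \<in> ?C i)" for i
  have p: "p i \<in> ?C i" if "i \<in> ?I" for i
    using that unfolding p_def cell_props(4) by (metis ex_in_conv someI_ex)
  have cellD: "0 \<le> snd q" "snd q \<le> A" "R \<le> snd i" "snd i \<le> 9/8 * R" "T q = snd i" if "q \<in> ?C i" for q i
  proof -
    have q: "q \<in> D" "T q = snd i" using that by (auto simp: cell_def)
    then show "0 \<le> snd q" "snd q \<le> A" "R \<le> snd i" "snd i \<le> 9/8 * R" "T q = snd i" using D T[of q] by (auto simp: mem_Times_iff)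
  qed
  have near: "dist (fst (p i)) (fst q) < \<mu>" if "q \<in> ?C i" "i \<in> ?I" for q i
    using cell_props(2)[OF p[OF that(2)] that(1)] dist_fst_le[of "p i" q] by (simp add: \<mu>_def)
  \<comment> \<open>The reach \<open>5/2 * R\<close> of a region, enlarged to \<open>4 * R\<close>;
    twice this radius is the range \<open>8 * R\<close> of dependence.\<close>
  have nbhd: "dist (fst (p i)) (fst q) < 4 * R" if "i \<in> ?I" "q \<in> ?C i \<union> ?N i" for q i
  proof (cases "q \<in> ?C i")
    case True then show ?thesis using near[OF True that(1)] \<mu> R0 by linarith
  next
    case False
    then have "q \<in> reg (snd i) (p i)"
      using that inner_subset[OF p[OF that(1)]] cellD(5)[OF p[OF that(1)]] by auto
    from reg_near[OF R cellD(4)[OF p[OF that(1)]] this] show ?thesis using R0 by linarith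
  qed
  define dst where "dst i j = dist (fst (p i)) (fst (p j))" for i j
  define B where "B i = {j. dst i j \<le> 8 * R}" for i
  define V where "V i = ball (fst (p i)) (4 * R) \<times> (UNIV :: real set)" for i
  have VE: "?E i \<in> local_events W" if i: "i \<in> ?I" and W: "V i \<subseteq> W" for i W
  proof -
    interpret s: sigma_algebra "space P" "local_events W" by (rule local_sigma_algebra)
    have "?C i \<union> ?N i \<subseteq> V i"
    proof
      fix q assume "q \<in> ?C i \<union> ?N i"
      from nbhd[OF i this] show "q \<in> V i" by (simp add: V_def mem_Times_iff)
    qed
    then have "?C i \<subseteq> W" "?N i \<subseteq> W" using W by blast+
    then show ?thesis unfolding cell_event_def
      by (intro s.Diff void_local inner_finite_borel[OF adm i] cell_finite_borel[OF simple])
  qed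
  have indep: "prob (?E i \<inter> (space P \<inter> (\<Inter>j\<in>S. ?E j))) = prob (?E i) * prob (space P \<inter> (\<Inter>j\<in>S. ?E j))"
    if i: "i \<in> ?I" and S: "S \<subseteq> ?I - B i" for i S
  proof (rule local_indep[of "V i" "- V i"])
    show "?E i \<in> local_events (V i)" by (rule VE[OF i order_refl])
    interpret s: sigma_algebra "space P" "local_events (- V i)" by (rule local_sigma_algebra)
    have j: "?E j \<in> local_events (- V i)" if "j \<in> S" for j
    proof (rule VE)
      have far: "8 * R < dst i j" using that S by (auto simp: B_def)
      show "V j \<subseteq> - V i"
      proof
        fix q assume "q \<in> V j"
        then have "dist (fst (p j)) (fst q) < 4 * R" by (auto simp: V_def)
        then have "\<not> dist (fst (p i)) (fst q) < 4 * R"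
          using far dist_triangle2[of "fst (p i)" "fst (p j)" "fst q"] unfolding dst_def by linarith
        then show "q \<in> - V i" by (simp add: V_def mem_Times_iff)
      qed
    qed (use that S in auto)
    have "finite S" using fin S finite_subset by blast
    then show "space P \<inter> (\<Inter>j\<in>S. ?E j) \<in> local_events (- V i)"
      using j
    proof (induction S rule: finite_induct)
      case (insert k F)
      have "space P \<inter> (\<Inter>j\<in>insert k F. ?E j) = ?E k \<inter> (space P \<inter> (\<Inter>j\<in>F. ?E j))" by auto
      also have "\<dots> \<in> local_events (- V i)" by (rule s.Int) (use insert in auto)
      finally show ?case .
    qed simp
  qed auto
  have sum_near: "(\<Sum>j\<in>J. measure intensity (?C j)) \<le> \<gamma> * unit_ball_vol (real DIM('a)) * (r + \<mu>) ^ DIM('a)"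
    if J: "J \<subseteq> ?I" "\<And>j. j \<in> J \<Longrightarrow> dst i j \<le> r" and r: "0 \<le> r" for J i r
  proof -
    have "finite J" using fin J finite_subset by blast
    have Z: "cball (fst (p i)) (r + \<mu>) \<times> (UNIV :: real set) \<in> sets borel" by (intro borel_closed closed_Times) auto
    have "(\<Sum>j\<in>J. measure intensity (?C j)) = measure intensity (\<Union>j\<in>J. ?C j)"
      using \<open>finite J\<close> cell_finite_borel[OF simple, of n]
      by (intro measure_finite_Union[symmetric])
        (auto simp: disjoint_family_on_def cell_def finite_borel_def prod_eq_iff)
    also have "\<dots> \<le> measure intensity (cball (fst (p i)) (r + \<mu>) \<times> UNIV)"
    proof (rule measure_mono_fmeasurable)
      show "(\<Union>j\<in>J. ?C j) \<subseteq> cball (fst (p i)) (r + \<mu>) \<times> UNIV"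
      proof
        fix q assume "q \<in> (\<Union>j\<in>J. ?C j)"
        then obtain j where j: "j \<in> J" "q \<in> ?C j" by auto
        then have "dist (fst (p i)) (fst q) \<le> r + \<mu>"
          using J(2)[OF j(1)] near[OF j(2)] J(1) dist_triangle[of "fst (p i)" "fst q" "fst (p j)"]
          unfolding dst_def by fastforce
        then show "q \<in> cball (fst (p i)) (r + \<mu>) \<times> UNIV" by (simp add: mem_Times_iff)
      qed
      show "(\<Union>j\<in>J. ?C j) \<in> sets intensity"
        using \<open>finite J\<close> cell_borel[OF simple] by auto
      show "cball (fst (p i)) (r + \<mu>) \<times> UNIV \<in> fmeasurable intensity"
        using Z r \<mu>0 by (intro fmeasurableI) (auto simp: intensity_ball)
    qed
    also have "\<dots> = \<gamma> * unit_ball_vol (real DIM('a)) * (r + \<mu>) ^ DIM('a)"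
      using r \<mu>0 by (simp add: measure_intensity_ball)
    finally show ?thesis .
  qed
  \<comment> \<open>A test ball centred at distance \<open>R\<close> from the representative, close
    to where the gap is smallest. The bound \<open>\<mu> \<le> R / 16\<close> keeps its points at
    distance between \<open>R / 2\<close> and \<open>3/2 * R\<close> from every centre in the closed
    cell.\<close>
  define H where "H j e = ball (fst (p j) + R *\<^sub>R e) (R/4) \<times> {-1<..<A+1}" for j and e :: 'a
  have H_far: "dist (fst (p j)) (fst q) > 3/4 * R" "dist (fst (p j)) (fst q) < 5/4 * R"
    if "q \<in> H j e" "norm e = 1" for j e q
  proof -
    have 1: "dist (fst (p j) + R *\<^sub>R e) (fst q) < R/4" using that by (auto simp: H_def)
    have 2: "dist (fst (p j)) (fst (p j) + R *\<^sub>R e) = R" using that(2) R0 by (simp add: dist_norm)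
    show "dist (fst (p j)) (fst q) > 3/4 * R" "dist (fst (p j)) (fst q) < 5/4 * R"
      using 1 2 dist_triangle[of "fst (p j)" "fst (p j) + R *\<^sub>R e" "fst q"]
        dist_triangle[of "fst (p j)" "fst q" "fst (p j) + R *\<^sub>R e"] by (auto simp: dist_commute)
  qed
  have H_sub: "H j e \<subseteq> ?N j" if j: "j \<in> ?I" and e: "norm e = 1" for j e
  proof
    fix q assume q: "q \<in> H j e"
    have "(p', q) \<in> lag_region {-1<..<A+1} (snd j)" if p': "p' \<in> closure (?C j)" for p'
    proof -
      have "closure (?C j) \<subseteq> {x. 0 \<le> snd x \<and> snd x \<le> A}"
      proof (rule closure_minimal)
        show "?C j \<subseteq> {x. 0 \<le> snd x \<and> snd x \<le> A}" using cellD(1,2) by blast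
      qed (intro closed_Collect_conj closed_Collect_le continuous_intros)
      then have m: "0 \<le> snd p'" "snd p' \<le> A" using p' by auto
      have "dist (p j) p' \<le> \<mu>" using closure_cell_subset[OF p[OF j]] p' by (auto simp: \<mu>_def)
      then have "dist (fst (p j)) (fst p') \<le> R/16" using dist_fst_le[of "p j" p'] \<mu> by linarith
      then have u: "dist (fst p') (fst q) \<ge> R/2" "dist (fst p') (fst q) \<le> 3/2 * R"
        using H_far[OF q e] dist_triangle[of "fst (p j)" "fst q" "fst p'"] dist_triangle3[of "fst p'" "fst q" "fst (p j)"] R0
        by (auto simp: dist_commute)
      let ?u = "norm (fst q - fst p')"
      have u': "R/2 \<le> ?u" "?u \<le> 3/2 * R" using u by (auto simp: dist_norm norm_minus_commute)
      \<comment> \<open>On this range \<open>u\<^sup>2 - 2 * R * u \<le> - 3/4 * R\<^sup>2\<close>,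
        while the mark of the centre adds at most \<open>A\<^sup>2 \<le> R\<^sup>2 / 4\<close>; so
        the gap is negative.\<close>
      have "0 \<le> (?u - R/2) * (3/2 * R - ?u)" using u' by (intro mult_nonneg_nonneg) auto
      then have "?u * ?u - 2 * R * ?u \<le> - (3/4 * (R * R))" by (simp add: algebra_simps)
      moreover have "2 * R * ?u \<le> 2 * snd j * ?u" using cellD(3)[OF p[OF j]] by (intro mult_right_mono) auto
      moreover have "snd p' * snd p' \<le> A * A" using m by (intro mult_mono) auto
      moreover have "A * A \<le> R/2 * (R/2)" using R A by (intro mult_mono) auto
      moreover have "0 \<le> snd q * snd q" "0 < R * R" using R0 by auto
      ultimately have "gap (snd j) p' q < 0" unfolding gap_def power2_eq_square by linarith
      then show ?thesis using q by (auto simp: lag_region_def H_def)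
    qed
    then show "q \<in> ?N j" by (simp add: inner_reg_def common_reg_def)
  qed
  have H_fb: "finite_borel (H j e)" for j e
  proof (rule fst_bounded_finite_borel)
    have "fst ` H j e \<subseteq> ball (fst (p j) + R *\<^sub>R e) (R/4)" by (auto simp: H_def)
    then show "bounded (fst ` H j e)" using bounded_ball bounded_subset by blast
    show "H j e \<in> sets borel" unfolding H_def by (intro borel_open open_Times) auto
  qed
  have H_meas: "exp (- measure intensity (H j e)) = \<epsilon>" for j e
    unfolding \<epsilon>_def H_def using R0 gamma
    by (subst measure_eq_emeasure_eq_ennreal[OF _ intensity_ball(1)]) (auto simp: mark_interval_full)
  have single: "prob (?E j) \<le> \<epsilon> * measure intensity (?C j)" if j: "j \<in> ?I" for j
  proof -
    obtain e :: 'a where e: "norm e = 1" using vector_choose_size[of 1] by auto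
    have "measure intensity (H j e) \<le> measure intensity (?N j)"
      using H_sub[OF j e] H_fb[of j e] inner_finite_borel[OF adm j]
      by (intro measure_mono_fmeasurable fmeasurableI) (auto simp: finite_borel_def less_top)
    then have "exp (- measure intensity (?N j)) \<le> \<epsilon>" using H_meas[of j e] by (metis exp_le_cancel_iff neg_le_iff_le)
    moreover have "1 - exp (- measure intensity (?C j)) \<le> measure intensity (?C j)"
      using exp_ge_add_one_self[of "- measure intensity (?C j)"] by linarith
    ultimately show ?thesis unfolding prob_cell_event[OF adm j]
      by (intro mult_mono) (auto simp: \<epsilon>_def)
  qed
  \<comment> \<open>If both events occur, the point in the second cell lies outside the void region
    of the first, so \<open>?C j - ?N i\<close> is hit. This set, \<open>?C i\<close> and
    \<open>?N i \<union> Z\<close> are disjoint, and the probability factorises.\<close>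
  have pair: "prob (?E i \<inter> ?E j) \<le> prob (?E i) * (measure intensity (?C j) * exp (- measure intensity Z))"
    if ij: "i \<in> ?I" "j \<in> ?I" "i \<noteq> j" and Z: "finite_borel Z" "Z \<subseteq> ?N j" "Z \<inter> ?N i = {}" "Z \<inter> ?C i = {}" "Z \<inter> ?C j = {}" for i j Z
  proof -
    let ?b = "?C j - ?N i"
    have "finite_borel ?b"
      by (rule finite_borel_subset[OF cell_finite_borel[OF simple]])
        (intro sets.Diff cell_borel[OF simple] borel_open inner_open[OF simple], blast)
    then have fb: "finite_borel (?C i)" "finite_borel ?b" "finite_borel (?N i)"
      using cell_finite_borel[OF simple] inner_finite_borel[OF adm ij(1)] by blast+
    have dis: "?C i \<inter> ?C j = {}" using ij(3) by (auto simp: cell_def prod_eq_iff)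
    have "prob (?E i \<inter> ?E j) \<le> prob (void (?N i \<union> Z) - void (?C i) - void ?b)"
    proof (rule finite_measure_mono)
      show "?E i \<inter> ?E j \<subseteq> void (?N i \<union> Z) - void (?C i) - void ?b"
        using Z(2) unfolding cell_event_def void_def by blast
      show "void (?N i \<union> Z) - void (?C i) - void ?b \<in> events"
        by (intro sets.Diff[OF sets.Diff] void_events) (use fb Z(1) finite_borel_Un[OF fb(3) Z(1)] in \<open>simp_all add: finite_borel_def\<close>)
    qed
    also have "\<dots> = exp (- measure intensity (?N i \<union> Z)) * (1 - exp (- measure intensity (?C i))) * (1 - exp (- measure intensity ?b))"
      using dis inner_disjoint[of n T D i] Z by (intro prob_hit2 fb finite_borel_Un) auto
    also have "\<dots> = prob (?E i) * ((1 - exp (- measure intensity ?b)) * exp (- measure intensity Z))"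
      using Z measure_intensity_Un[OF fb(3) Z(1)] by (simp add: prob_cell_event[OF adm ij(1)] Int_commute exp_diff exp_minus exp_add field_simps)
    also have "\<dots> \<le> prob (?E i) * (measure intensity (?C j) * exp (- measure intensity Z))"
    proof (intro mult_left_mono mult_right_mono)
      have "1 - exp (- measure intensity ?b) \<le> measure intensity ?b"
        using exp_ge_add_one_self[of "- measure intensity ?b"] by linarith
      also have "\<dots> \<le> measure intensity (?C j)"
        using fb cell_finite_borel[OF simple, of n j]
        by (intro measure_mono_fmeasurable fmeasurableI) (auto simp: finite_borel_def less_top)
      finally show "1 - exp (- measure intensity ?b) \<le> measure intensity (?C j)" .
    qed auto
    finally show ?thesis .
  qed
  \<comment> \<open>The test ball of \<open>j\<close> is placed on the side turned away from
    \<open>i\<close>. Its distance from \<open>i\<close> exceeds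
    \<open>7/4 * R + R - R / 4 = 5/2 * R\<close>, beyond the reach of the first region.\<close>
  have far: "prob (?E i \<inter> ?E j) \<le> prob (?E i) * (measure intensity (?C j) * \<epsilon>)"
    if ij: "i \<in> ?I" "j \<in> ?I" "i \<noteq> j" and d: "dst i j \<ge> 7/4 * R" for i j
  proof -
    define w where "w = fst (p j) - fst (p i)"
    have w: "norm w = dst i j" by (simp add: w_def dst_def dist_norm norm_minus_commute)
    then have "norm w > 0" using d R0 by simp
    define e where "e = w /\<^sub>R norm w"
    have e: "norm e = 1" using \<open>norm w > 0\<close> by (simp add: e_def)
    have away: "dist (fst (p i)) (fst q) > 5/2 * R" if q: "q \<in> H j e" for q
    proof -
      have "fst (p j) + R *\<^sub>R e - fst (p i) = (1 + R / norm w) *\<^sub>R w"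
        by (simp add: e_def w_def algebra_simps divide_inverse)
      then have "dist (fst (p i)) (fst (p j) + R *\<^sub>R e) = (1 + R / norm w) * norm w"
        using R0 by (simp add: dist_norm norm_minus_commute[of "fst (p i)"] del: norm_minus_commute)
      also have "\<dots> = dst i j + R" using \<open>norm w > 0\<close> by (simp add: w[symmetric] field_simps)
      finally have "dist (fst (p i)) (fst (p j) + R *\<^sub>R e) = dst i j + R" .
      moreover have "dist (fst (p j) + R *\<^sub>R e) (fst q) < R/4" using q by (auto simp: H_def)
      ultimately show ?thesis
        using d dist_triangle2[of "fst (p i)" "fst (p j) + R *\<^sub>R e" "fst q"] by linarith
    qed
    have "H j e \<inter> ?N i = {}"
    proof -
      have "q \<notin> ?N i" if "q \<in> H j e" for q
      proof
        assume "q \<in> ?N i"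
        then have "q \<in> reg (snd i) (p i)"
          using inner_subset[OF p[OF ij(1)]] cellD(5)[OF p[OF ij(1)]] by auto
        from reg_near[OF R cellD(4)[OF p[OF ij(1)]] this] show False using away[OF that] by linarith
      qed
      then show ?thesis by blast
    qed
    moreover have "H j e \<inter> ?C i = {}"
    proof -
      have "q \<notin> ?C i" if "q \<in> H j e" for q
      proof
        assume "q \<in> ?C i"
        then have "dist (fst (p i)) (fst q) < \<mu>" using near ij(1) by blast
        then show False using away[OF that] \<mu> R0 by linarith
      qed
      then show ?thesis by blast
    qed
    moreover have "H j e \<inter> ?C j = {}"
      using H_sub[OF ij(2) e] inner_disjoint[of n T D j] by blast
    ultimately show ?thesis using pair[OF ij H_fb H_sub[OF ij(2) e]] by (simp add: H_meas)
  qed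
  \<comment> \<open>Adding the two gap inequalities cancels the marks and gives
    \<open>u * (snd i + snd j - u) \<le> 8 * R * \<mu>\<close>. The thresholds are at least
    \<open>R\<close> and \<open>u \<le> 15/8 * R\<close>, so the second factor is at least
    \<open>R / 8\<close> and \<open>u \<le> 64 * \<mu>\<close>; passing to the representatives adds
    \<open>2 * \<mu>\<close>.\<close>
  have close: "dst i j \<le> 66 * \<mu>"
    if ij: "i \<in> ?I" "j \<in> ?I" and d: "dst i j < 7/4 * R" and \<omega>: "\<omega> \<in> ?E i \<inter> ?E j" for i j \<omega>
  proof -
    obtain q1 q2 where q: "q1 \<in> ?C i" "q2 \<in> ?C j" "q1 \<notin> ?N j" "q2 \<notin> ?N i"
      using \<omega> unfolding cell_event_def void_def by blast
    let ?u = "dist (fst q1) (fst q2)"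
    have nn: "dist (fst (p i)) (fst q1) < \<mu>" "dist (fst (p j)) (fst q2) < \<mu>" using near q ij by auto
    have u1: "?u \<le> dst i j + 2 * \<mu>" "dst i j \<le> ?u + 2 * \<mu>"
      using nn dist_triangle[of "fst q1" "fst q2" "fst (p i)"] dist_triangle[of "fst (p i)" "fst q2" "fst (p j)"]
        dist_triangle[of "fst (p i)" "fst (p j)" "fst q1"] dist_triangle[of "fst q1" "fst (p j)" "fst q2"]
      unfolding dst_def by (auto simp: dist_commute)
    have u2: "?u \<le> 15/8 * R" using u1 d \<mu> by linarith
    have g: "gap (snd k) q' q'' \<ge> - (8 * R * \<mu>)" if h: "q' \<in> ?C k" "q'' \<in> ?C l" "q'' \<notin> ?N k" "dist (fst q') (fst q'') \<le> 15/8 * R" for k l q' q''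
    proof -
      obtain p' where p': "p' \<in> closure (?C k)" "(p', q'') \<notin> lag_region {-1<..<A+1} (snd k)"
        using h(3) by (auto simp: inner_reg_def common_reg_def)
      then have "gap (snd k) p' q'' \<ge> 0" using cellD[OF h(2)] by (auto simp: lag_region_def)
      moreover have "dist q' p' \<le> \<mu>" using closure_cell_subset[OF h(1)] p'(1) by (auto simp: \<mu>_def)
      moreover have "norm (fst q'' - fst q') \<le> 2 * R" using h(4) R0 by (simp add: dist_norm norm_minus_commute)
      ultimately show ?thesis
        using cellD[OF h(1)] R R0 \<mu> by (intro gap_perturb[where p' = p' and A = A]) auto
    qed
    have g1: "gap (snd i) q1 q2 \<ge> - (8 * R * \<mu>)" using g[OF q(1,2,4) u2] .
    have g2: "gap (snd j) q2 q1 \<ge> - (8 * R * \<mu>)" using g[OF q(2,1,3)] u2 by (simp add: dist_commute)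
    have "norm (fst q2 - fst q1) = ?u" "norm (fst q1 - fst q2) = ?u" by (auto simp: dist_norm norm_minus_commute)
    then have "?u * (snd i + snd j - ?u) \<le> 8 * R * \<mu>"
      using g1 g2 unfolding gap_def by (simp add: power2_eq_square algebra_simps)
    moreover have "?u * (R/8) \<le> ?u * (snd i + snd j - ?u)"
      using u2 cellD(3)[OF q(1)] cellD(3)[OF q(2)] by (intro mult_left_mono) auto
    ultimately have "R * ?u \<le> R * (64 * \<mu>)" by (simp add: mult_ac)
    then have "?u \<le> 64 * \<mu>" using R0 by simp
    then show ?thesis using u1 by linarith
  qed
  have summand: "prob (?E i) * prob (?E j) + (if j = i then 0 else prob (?E i \<inter> ?E j))
     \<le> prob (?E i) * (2 * \<epsilon> * measure intensity (?C j) + (if dst i j \<le> 66 * \<mu> then measure intensity (?C j) else 0))"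
    if ij: "i \<in> ?I" "j \<in> ?I" for i j
  proof -
    have e0: "\<epsilon> > 0" by (simp add: \<epsilon>_def)
    have 1: "prob (?E i) * prob (?E j) \<le> prob (?E i) * (\<epsilon> * measure intensity (?C j))"
      using single[OF ij(2)] by (intro mult_left_mono) auto
    have 2: "prob (?E i \<inter> ?E j) \<le> prob (?E i) * (\<epsilon> * measure intensity (?C j) + (if dst i j \<le> 66 * \<mu> then measure intensity (?C j) else 0))"
      if "i \<noteq> j"
    proof (cases "dst i j \<ge> 7/4 * R")
      case True
      have "prob (?E i \<inter> ?E j) \<le> prob (?E i) * (measure intensity (?C j) * \<epsilon>)" by (rule far[OF ij that True])
      also have "\<dots> \<le> prob (?E i) * (\<epsilon> * measure intensity (?C j) + (if dst i j \<le> 66 * \<mu> then measure intensity (?C j) else 0))"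
        by (intro mult_left_mono) (auto simp: mult.commute)
      finally show ?thesis .
    next
      case False
      show ?thesis
      proof (cases "dst i j \<le> 66 * \<mu>")
        case True
        have "prob (?E i \<inter> ?E j) \<le> prob (?E i) * measure intensity (?C j)"
          using pair[OF ij that, of "{}"] by (simp add: finite_borel_def)
        also have "\<dots> \<le> prob (?E i) * (\<epsilon> * measure intensity (?C j) + measure intensity (?C j))"
          using e0 by (intro mult_left_mono) auto
        finally show ?thesis using True by simp
      next
        case False': False
        have "?E i \<inter> ?E j = {}" using close[OF ij] False False' by fastforce
        then show ?thesis using e0 by simp
      qed
    qed
    show ?thesis
    proof (cases "i = j")
      case True
      have "prob (?E i) * (\<epsilon> * measure intensity (?C j)) \<le>
         prob (?E i) * (2 * \<epsilon> * measure intensity (?C j) + (if dst i j \<le> 66 * \<mu> then measure intensity (?C j) else 0))"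
        using e0 by (intro mult_left_mono) auto
      then show ?thesis using 1 True by simp
    next
      case False
      then show ?thesis using 1 2 by (simp add: distrib_left mult_ac)
    qed
  qed
  have inner_sum: "(\<Sum>j\<in>?I \<inter> B i. prob (?E i) * prob (?E j) + (if j = i then 0 else prob (?E i \<inter> ?E j)))
    \<le> prob (?E i) * (2 * \<epsilon> * (\<gamma> * unit_ball_vol (real DIM('a)) * (9 * R) ^ DIM('a)) + \<gamma> * unit_ball_vol (real DIM('a)) * (67 * \<mu>) ^ DIM('a))"
    if i: "i \<in> ?I" for i
  proof -
    have "(\<Sum>j\<in>?I \<inter> B i. prob (?E i) * prob (?E j) + (if j = i then 0 else prob (?E i \<inter> ?E j)))
      \<le> (\<Sum>j\<in>?I \<inter> B i. prob (?E i) * (2 * \<epsilon> * measure intensity (?C j) + (if dst i j \<le> 66 * \<mu> then measure intensity (?C j) else 0)))"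
      using summand[OF i] by (intro sum_mono) auto
    also have "\<dots> = prob (?E i) * (2 * \<epsilon> * (\<Sum>j\<in>?I \<inter> B i. measure intensity (?C j)) +
        (\<Sum>j\<in>?I \<inter> B i \<inter> {j. dst i j \<le> 66 * \<mu>}. measure intensity (?C j)))"
      using fin by (simp add: sum_distrib_left[symmetric] sum.distrib sum.If_cases)
    also have "\<dots> \<le> prob (?E i) * (2 * \<epsilon> * (\<gamma> * unit_ball_vol (real DIM('a)) * (9 * R) ^ DIM('a)) + \<gamma> * unit_ball_vol (real DIM('a)) * (67 * \<mu>) ^ DIM('a))"
    proof (intro mult_left_mono add_mono)
      have "(\<Sum>j\<in>?I \<inter> B i. measure intensity (?C j)) \<le> \<gamma> * unit_ball_vol (real DIM('a)) * (8 * R + \<mu>) ^ DIM('a)"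
        using R0 by (intro sum_near[of _ i]) (auto simp: B_def)
      also have "\<dots> \<le> \<gamma> * unit_ball_vol (real DIM('a)) * (9 * R) ^ DIM('a)"
        using gamma \<mu> \<mu>0 R0 by (intro mult_left_mono power_mono) auto
      finally show "(\<Sum>j\<in>?I \<inter> B i. measure intensity (?C j)) \<le> \<gamma> * unit_ball_vol (real DIM('a)) * (9 * R) ^ DIM('a)" .
      have "(\<Sum>j\<in>?I \<inter> B i \<inter> {j. dst i j \<le> 66 * \<mu>}. measure intensity (?C j)) \<le> \<gamma> * unit_ball_vol (real DIM('a)) * (66 * \<mu> + \<mu>) ^ DIM('a)"
        using \<mu>0 by (intro sum_near[of _ i]) auto
      then show "(\<Sum>j\<in>?I \<inter> B i \<inter> {j. dst i j \<le> 66 * \<mu>}. measure intensity (?C j)) \<le> \<gamma> * unit_ball_vol (real DIM('a)) * (67 * \<mu>) ^ DIM('a)"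
        by simp
    qed (auto simp: \<epsilon>_def)
    finally show ?thesis .
  qed
  have self: "i \<in> B i" for i using R0 by (simp add: B_def dst_def)
  note poisson_approximation_void[of ?I ?E B, OF fin cell_event_events[OF simple] indep self]
  also have "(\<Sum>i\<in>?I. \<Sum>j\<in>?I \<inter> B i. prob (?E i) * prob (?E j) + (if j = i then 0 else prob (?E i \<inter> ?E j)))
    \<le> (\<Sum>i\<in>?I. prob (?E i) * (2 * \<epsilon> * (\<gamma> * unit_ball_vol (real DIM('a)) * (9 * R) ^ DIM('a)) + \<gamma> * unit_ball_vol (real DIM('a)) * (67 * \<mu>) ^ DIM('a)))"
    by (rule sum_mono[OF inner_sum])
  finally show ?thesis by (simp add: sum_distrib_right)
qed

text \<open>Both sides of the discrete bound converge as the mesh vanishes, and the contribution of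
  almost coinciding pairs drops out.\<close>

theorem void_approximation:
  "\<bar>prob {\<omega>\<in>space P. number T D \<omega> = 0} - exp (- intensity_exceed T D)\<bar>
    \<le> intensity_exceed T D * (2 * exp (- (\<gamma> * unit_ball_vol (real DIM('a)) * (R/4) ^ DIM('a))) * (\<gamma> * unit_ball_vol (real DIM('a)) * (9 * R) ^ DIM('a)))"
proof -
  have adm: "admissible T D" by (rule admissible_window)
  have R0: "R > 0" using R A by simp
  have s: "(\<lambda>n. \<Sum>i\<in>cells n T D. prob (cell_event n T D i)) \<longlonglongrightarrow> intensity_exceed T D"
    by (rule sum_prob_cells_tendsto[OF adm])
  have l: "(\<lambda>n. \<bar>prob (space P - (\<Union>i\<in>cells n T D. cell_event n T D i)) - exp (- (\<Sum>i\<in>cells n T D. prob (cell_event n T D i)))\<bar>)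
    \<longlonglongrightarrow> \<bar>prob {\<omega>\<in>space P. number T D \<omega> = 0} - exp (- intensity_exceed T D)\<bar>"
    by (intro tendsto_intros s prob_no_cell_event_tendsto[OF adm])
  have m: "(\<lambda>n. (67 * (1 / real (Suc n))) ^ DIM('a)) \<longlonglongrightarrow> (67 * 0) ^ DIM('a)"
    by (intro tendsto_intros LIMSEQ_inverse_real_of_nat[unfolded inverse_eq_divide])
  let ?b = "2 * exp (- (\<gamma> * unit_ball_vol (real DIM('a)) * (R/4) ^ DIM('a))) * (\<gamma> * unit_ball_vol (real DIM('a)) * (9 * R) ^ DIM('a))"
  have r: "(\<lambda>n. (\<Sum>i\<in>cells n T D. prob (cell_event n T D i)) * (?b + \<gamma> * unit_ball_vol (real DIM('a)) * (67 * (1 / real (Suc n))) ^ DIM('a)))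
    \<longlonglongrightarrow> intensity_exceed T D * (?b + \<gamma> * unit_ball_vol (real DIM('a)) * (67 * 0) ^ DIM('a))"
    by (intro tendsto_intros s m)
  have "\<bar>prob {\<omega>\<in>space P. number T D \<omega> = 0} - exp (- intensity_exceed T D)\<bar>
     \<le> intensity_exceed T D * (?b + \<gamma> * unit_ball_vol (real DIM('a)) * (67 * 0) ^ DIM('a))"
  proof (rule tendsto_le[OF sequentially_bot r l])
    have "R / 16 > 0" using R0 by simp
    from eventually_mesh[OF this] show "eventually (\<lambda>n. \<bar>prob (space P - (\<Union>i\<in>cells n T D. cell_event n T D i)) - exp (- (\<Sum>i\<in>cells n T D. prob (cell_event n T D i)))\<bar>
      \<le> (\<Sum>i\<in>cells n T D. prob (cell_event n T D i)) * (?b + \<gamma> * unit_ball_vol (real DIM('a)) * (67 * (1 / real (Suc n))) ^ DIM('a))) sequentially"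
      by eventually_elim (rule void_approximation_cells, simp)
  qed
  then show ?thesis by (simp add: zero_power)
qed

end

end

subsection \<open>Volumes of exclusion regions\<close>

text \<open>In units of the unit ball, the volume of the points whose distance \<open>v\<close> from
  a centre satisfies \<open>v\<^sup>2 - 2 * R * v < w\<close>. With
  \<open>w = t\<^sup>2 - m\<^sup>2\<close> this is the slice at mark \<open>t\<close> of the region
  of a nucleus with mark \<open>m\<close>. The maximum covers \<open>w > 0\<close>, where the shell
  is a full ball.\<close>

definition shell :: "nat \<Rightarrow> real \<Rightarrow> real \<Rightarrow> real" where
  "shell d R w = (R + sqrt (R\<^sup>2 + w)) ^ d - (max 0 (R - sqrt (R\<^sup>2 + w))) ^ d"

lemma shell_nonneg: "0 \<le> R \<Longrightarrow> 0 \<le> R\<^sup>2 + w \<Longrightarrow> 0 \<le> shell d R w"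
  unfolding shell_def by (auto intro!: power_mono)

lemma shell_mono: "0 \<le> R \<Longrightarrow> 0 \<le> R\<^sup>2 + w \<Longrightarrow> w \<le> w' \<Longrightarrow> shell d R w \<le> shell d R w'"
  unfolding shell_def by (intro diff_mono power_mono max.mono) auto

lemma shell_gap_sq:
  fixes v R w :: real
  assumes "0 < R" "0 < R\<^sup>2 + w"
  shows "v\<^sup>2 - 2 * R * v < w \<longleftrightarrow> R - sqrt (R\<^sup>2 + w) < v \<and> v < R + sqrt (R\<^sup>2 + w)"
proof -
  have "v\<^sup>2 - 2 * R * v < w \<longleftrightarrow> (v - R)\<^sup>2 < R\<^sup>2 + w" by (auto simp: power2_eq_square algebra_simps)
  also have "\<dots> \<longleftrightarrow> \<bar>v - R\<bar> < sqrt (R\<^sup>2 + w)"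
    by (metis real_sqrt_abs real_sqrt_less_iff)
  also have "\<dots> \<longleftrightarrow> R - sqrt (R\<^sup>2 + w) < v \<and> v < R + sqrt (R\<^sup>2 + w)" by auto
  finally show ?thesis .
qed

lemma emeasure_shell:
  fixes x :: "'a::euclidean_space"
  assumes "0 < R" "0 < R\<^sup>2 + w"
  shows "emeasure lborel {y. (norm (y - x))\<^sup>2 - 2 * R * norm (y - x) < w}
    = ennreal (unit_ball_vol (real DIM('a)) * shell DIM('a) R w)"
proof -
  define a where "a = sqrt (R\<^sup>2 + w)"
  have a: "a > 0" using assms by (simp add: a_def)
  have S: "{y. (norm (y - x))\<^sup>2 - 2 * R * norm (y - x) < w} = {y. R - a < dist x y \<and> dist x y < R + a}"
    unfolding shell_gap_sq[OF assms] a_def by (simp add: dist_norm norm_minus_commute)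
  show ?thesis
  proof (cases "a > R")
    case True
    then have "{y. R - a < dist x y \<and> dist x y < R + a} = ball x (R + a)"
      by (auto intro: less_le_trans[OF _ zero_le_dist])
    then show ?thesis unfolding S using True a assms by (simp add: emeasure_ball shell_def a_def[symmetric] max_def zero_power)
  next
    case False
    then have "{y. R - a < dist x y \<and> dist x y < R + a} = ball x (R + a) - cball x (R - a)" by auto
    also have "emeasure lborel \<dots> = emeasure lborel (ball x (R + a)) - emeasure lborel (cball x (R - a))"
      using a False by (intro emeasure_Diff) (auto simp: emeasure_cball)
    also have "\<dots> = ennreal (unit_ball_vol (real DIM('a)) * (R + a) ^ DIM('a)) - ennreal (unit_ball_vol (real DIM('a)) * (R - a) ^ DIM('a))"
      using a assms False by (simp add: emeasure_ball emeasure_cball)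
    also have "\<dots> = ennreal (unit_ball_vol (real DIM('a)) * shell DIM('a) R w)"
      using a False by (subst ennreal_minus) (auto simp: shell_def a_def[symmetric] max_def right_diff_distrib)
    finally show ?thesis unfolding S .
  qed
qed

text \<open>With \<open>a = sqrt (R\<^sup>2 + w)\<close> the error is exactly
  \<open>- 2 * (a - R)\<^sup>2\<close> for a genuine annulus and \<open>- (a - R)\<^sup>2\<close>
  for a full ball, and \<open>\<bar>a - R\<bar> = \<bar>w\<bar> / (a + R)\<close> is at most
  \<open>b / R\<close>.\<close>

lemma shell2:
  assumes R: "R > 0" and w: "\<bar>w\<bar> \<le> b" "b < R\<^sup>2"
  shows "\<bar>shell 2 R w - (4 * R\<^sup>2 + 2 * w)\<bar> \<le> 2 * b\<^sup>2 / R\<^sup>2"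
proof -
  define a where "a = sqrt (R\<^sup>2 + w)"
  have p: "R\<^sup>2 + w > 0" using w by linarith
  have a: "a > 0" "a\<^sup>2 = R\<^sup>2 + w" using p by (auto simp: a_def)
  have wa: "w = (a - R) * (a + R)" using a(2) by (simp add: power2_eq_square algebra_simps)
  have w2: "w\<^sup>2 \<le> b\<^sup>2" using w by (intro power2_le_iff_abs_le[THEN iffD2]) auto
  have sq: "(a - R)\<^sup>2 \<le> b\<^sup>2 / R\<^sup>2"
  proof -
    have "(a - R)\<^sup>2 * R\<^sup>2 \<le> (a - R)\<^sup>2 * (a + R)\<^sup>2" using a R by (intro mult_left_mono power_mono) auto
    also have "\<dots> = w\<^sup>2" unfolding wa by (simp add: power_mult_distrib)
    finally show ?thesis using w2 R by (simp add: field_simps)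
  qed
  have "\<bar>shell 2 R w - (4 * R\<^sup>2 + 2 * w)\<bar> \<le> 2 * (a - R)\<^sup>2"
  proof (cases "a > R")
    case True
    then have "shell 2 R w = (R + a)\<^sup>2" by (simp add: shell_def a_def[symmetric] max_def)
    then have "shell 2 R w - (4 * R\<^sup>2 + 2 * w) = - ((a - R)\<^sup>2)"
      unfolding wa by (simp add: power2_eq_square algebra_simps)
    then show ?thesis by simp
  next
    case False
    then have "shell 2 R w = 4 * R * a" unfolding shell_def a_def[symmetric] by (simp add: max_def power2_eq_square algebra_simps)
    then have "shell 2 R w - (4 * R\<^sup>2 + 2 * w) = - 2 * (a - R)\<^sup>2"
      unfolding wa by (simp add: power2_eq_square algebra_simps)
    then show ?thesis by simp
  qed
  also have "\<dots> \<le> 2 * b\<^sup>2 / R\<^sup>2" using sq by simp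
  finally show ?thesis .
qed

text \<open>The outer radius grows by
  \<open>a' - a = (w' - w) / (a' + a) \<ge> (w' - w) / (4 * R)\<close>, and its \<open>d\<close>-th
  power by at least \<open>(R + a) ^ (d - 1) \<ge> R\<^sup>2\<close> times that. The inner radius
  can only shrink. For \<open>d = 2\<close> the power would give just one factor \<open>R\<close>,
  and the growth in \<open>R\<close> would be lost.\<close>

lemma shell_increment:
  assumes d: "d \<ge> 3" and R: "R \<ge> 1" and w: "\<bar>w\<bar> \<le> b" "\<bar>w'\<bar> \<le> b" "w \<le> w'" "b \<le> R\<^sup>2"
  shows "(w' - w) * R / 4 \<le> shell d R w' - shell d R w"
proof -
  define a where "a = sqrt (R\<^sup>2 + w)"
  define a' where "a' = sqrt (R\<^sup>2 + w')"
  have aa: "0 \<le> a" "a \<le> a'" "a\<^sup>2 = R\<^sup>2 + w" "a'\<^sup>2 = R\<^sup>2 + w'" using w by (auto simp: a_def a'_def)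
  have "w' \<le> b" using w(2) by linarith
  then have "a'\<^sup>2 \<le> (2 * R)\<^sup>2" using w(4) zero_le_power2[of R] unfolding aa(4) power_mult_distrib by (simp, linarith)
  then have a2: "a' \<le> 2 * R" by (rule power2_le_imp_le) (use R in simp)
  have "w' - w = (a' - a) * (a' + a)" using aa by (simp add: power2_eq_square algebra_simps)
  also have "\<dots> \<le> (a' - a) * (4 * R)" using aa a2 by (intro mult_left_mono) auto
  finally have "(w' - w) * (R / 4) \<le> (a' - a) * (4 * R) * (R / 4)" using R by (intro mult_right_mono) auto
  then have "(w' - w) * R / 4 \<le> (a' - a) * R\<^sup>2" by (simp add: power2_eq_square)
  also have "\<dots> \<le> (a' - a) * (R + a) ^ (d - 1)"
  proof (intro mult_left_mono)
    have "R\<^sup>2 \<le> R ^ (d - 1)" using R d by (intro power_increasing) auto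
    also have "\<dots> \<le> (R + a) ^ (d - 1)" using R aa by (intro power_mono) auto
    finally show "R\<^sup>2 \<le> (R + a) ^ (d - 1)" .
  qed (use aa in auto)
  also have "\<dots> \<le> (R + a') ^ d - (R + a) ^ d"
  proof -
    have "(R + a) * (R + a) ^ (d - 1) = (R + a) ^ d" using d by (cases d) auto
    moreover have "(R + a') * (R + a) ^ (d - 1) \<le> (R + a') * (R + a') ^ (d - 1)"
      using aa R by (intro mult_left_mono power_mono) auto
    moreover have "(R + a') * (R + a') ^ (d - 1) = (R + a') ^ d" using d by (cases d) auto
    ultimately show ?thesis by (simp add: algebra_simps)
  qed
  also have "\<dots> \<le> shell d R w' - shell d R w"
  proof -
    have "(max 0 (R - a')) ^ d \<le> (max 0 (R - a)) ^ d" using aa by (intro power_mono) auto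
    then show ?thesis unfolding shell_def a_def a'_def by linarith
  qed
  finally show ?thesis .
qed

context laguerre_process
begin

lemma AE_marks: "AE t in Q. 0 \<le> t \<and> t \<le> A"
  using Q.prob_eq_1[of "{0..A}"] A Q(2) by auto

text \<open>The intensity of the exclusion region of a nucleus with mark \<open>m\<close>; see
  \<open>measure_reg\<close>.\<close>

definition rate :: "real \<Rightarrow> real \<Rightarrow> real" where
  "rate R m = \<gamma> * unit_ball_vol (real DIM('a)) * (\<integral>t. shell DIM('a) R (t\<^sup>2 - m\<^sup>2) \<partial>Q)"

lemma sigma_finite_scaled: "sigma_finite_measure (scale_measure (ennreal \<gamma>) (lborel :: 'a measure))"
proof
  obtain F :: "'a set set" where F: "countable F" "F \<subseteq> sets lborel" "\<Union>F = space lborel" "\<forall>a\<in>F. emeasure lborel a \<noteq> \<infinity>"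
    using lborel.sigma_finite_countable by blast
  then show "\<exists>F. countable F \<and> F \<subseteq> sets (scale_measure (ennreal \<gamma>) (lborel :: 'a measure)) \<and>
      \<Union>F = space (scale_measure (ennreal \<gamma>) (lborel :: 'a measure)) \<and>
      (\<forall>a\<in>F. emeasure (scale_measure (ennreal \<gamma>) lborel) a \<noteq> \<infinity>)"
    by (intro exI[of _ F]) (auto simp: ennreal_mult_eq_top_iff space_scale_measure)
qed

lemma radicand_bound:
  fixes t m :: real
  assumes "0 \<le> t" "t \<le> A" "0 \<le> m" "m \<le> A"
  shows "\<bar>t\<^sup>2 - m\<^sup>2\<bar> \<le> A\<^sup>2"
proof -
  have "t\<^sup>2 \<le> A\<^sup>2" "m\<^sup>2 \<le> A\<^sup>2" using assms by (auto intro: power_mono)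
  then show ?thesis by (auto simp: abs_le_iff) (smt (verit) zero_le_power2)+
qed

lemma radicand_pos: "A < R \<Longrightarrow> 0 \<le> m \<Longrightarrow> m \<le> A \<Longrightarrow> 0 < R\<^sup>2 + (t\<^sup>2 - m\<^sup>2)"
  using A power_strict_mono[of m R 2] zero_le_power2[of t] by linarith

lemma integrable_shell:
  assumes "A < R" "0 \<le> m" "m \<le> A"
  shows "integrable Q (\<lambda>t. shell DIM('a) R (t\<^sup>2 - m\<^sup>2))"
proof (rule Q.integrable_const_bound)
  have "continuous_on UNIV (\<lambda>t. shell DIM('a) R (t\<^sup>2 - m\<^sup>2))"
    unfolding shell_def by (intro continuous_intros)
  then show "(\<lambda>t. shell DIM('a) R (t\<^sup>2 - m\<^sup>2)) \<in> borel_measurable Q"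
    using borel_measurable_continuous_onI measurable_cong_sets[OF Q(2) refl] by blast
  show "AE t in Q. norm (shell DIM('a) R (t\<^sup>2 - m\<^sup>2)) \<le> shell DIM('a) R (A\<^sup>2)"
    using AE_marks
  proof eventually_elim
    case (elim t)
    have "t\<^sup>2 - m\<^sup>2 \<le> A\<^sup>2" using radicand_bound[of t m] elim assms by auto
    then show ?case using assms A radicand_pos[OF assms, of t] shell_nonneg[of R "t\<^sup>2 - m\<^sup>2" "DIM('a)"]
        shell_mono[of R "t\<^sup>2 - m\<^sup>2" "A\<^sup>2" "DIM('a)"] by simp
  qed
qed

text \<open>Fubini with the mark of the other point as outer variable; for almost every mark the
  strip condition holds and the slice is a shell.\<close>

lemma measure_reg:
  assumes R: "A < R" and m: "0 \<le> snd p" "snd p \<le> A"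
  shows "measure intensity (reg R p) = rate R (snd p)"
proof -
  interpret S: sigma_finite_measure "scale_measure (ennreal \<gamma>) (lborel :: 'a measure)" by (rule sigma_finite_scaled)
  interpret pair_sigma_finite "scale_measure (ennreal \<gamma>) (lborel :: 'a measure)" Q by unfold_locales
  let ?h = "\<lambda>t. shell DIM('a) R (t\<^sup>2 - (snd p)\<^sup>2)"
  have nn: "0 \<le> \<gamma> * unit_ball_vol (real DIM('a)) * ?h t" for t
    using gamma R A radicand_pos[OF R m, of t] by (intro mult_nonneg_nonneg shell_nonneg) auto
  have "emeasure intensity (reg R p) = (\<integral>\<^sup>+t. emeasure (scale_measure (ennreal \<gamma>) lborel) ((\<lambda>y. (y, t)) -` reg R p) \<partial>Q)"
    unfolding intensity_def
    by (rule emeasure_pair_measure_alt2)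
      (use open_reg[of R p] sets_intensity' in \<open>auto simp: intensity_def\<close>)
  also have "\<dots> = (\<integral>\<^sup>+t. ennreal (\<gamma> * unit_ball_vol (real DIM('a)) * ?h t) \<partial>Q)"
  proof (intro nn_integral_cong_AE, use AE_marks in eventually_elim)
    case (elim t)
    have "(\<lambda>y. (y, t)) -` reg R p = {y. (norm (y - fst p))\<^sup>2 - 2 * R * norm (y - fst p) < t\<^sup>2 - (snd p)\<^sup>2}"
      using elim by (auto simp: reg_iff gap_def)
    then have "emeasure lborel ((\<lambda>y. (y, t)) -` reg R p) = ennreal (unit_ball_vol (real DIM('a)) * ?h t)"
      using emeasure_shell[of R "t\<^sup>2 - (snd p)\<^sup>2" "fst p"] R A radicand_pos[OF R m, of t] by simp
    then show ?case using gamma by (simp add: ennreal_mult' mult.assoc)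
  qed
  also have "\<dots> = ennreal (\<integral>t. \<gamma> * unit_ball_vol (real DIM('a)) * ?h t \<partial>Q)"
    by (intro nn_integral_eq_integral integrable_mult_right integrable_shell[OF R m] AE_I2 nn)
  also have "\<dots> = ennreal (rate R (snd p))" by (simp add: rate_def)
  finally have *: "emeasure intensity (reg R p) = ennreal (rate R (snd p))" .
  have "0 \<le> (\<integral>t. ?h t \<partial>Q)"
    using R A radicand_pos[OF R m] by (intro Bochner_Integration.integral_nonneg shell_nonneg) (auto intro: less_imp_le)
  then have "0 \<le> rate R (snd p)" unfolding rate_def using gamma by (intro mult_nonneg_nonneg) auto
  then show ?thesis by (rule measure_eq_emeasure_eq_ennreal[OF _ *])
qed

text \<open>A larger mark of the nucleus shrinks every slice of its exclusion region, so large marks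
  favour large inradii.\<close>

lemma rate_antimono:
  assumes "A < R" "0 \<le> m" "m \<le> m'" "m' \<le> A"
  shows "rate R m' \<le> rate R m"
proof -
  have "(\<integral>t. shell DIM('a) R (t\<^sup>2 - m'\<^sup>2) \<partial>Q) \<le> (\<integral>t. shell DIM('a) R (t\<^sup>2 - m\<^sup>2) \<partial>Q)"
    using assms A power_mono[of m m' 2] radicand_pos[of R m']
    by (intro integral_mono integrable_shell shell_mono) (auto intro: less_imp_le)
  then show ?thesis unfolding rate_def using gamma by (intro mult_left_mono) auto
qed

lemma rate_nonneg: "A < R \<Longrightarrow> 0 \<le> m \<Longrightarrow> m \<le> A \<Longrightarrow> 0 \<le> rate R m"
  using measure_reg[of R "(0, m)"] by (metis measure_nonneg snd_conv)

text \<open>The mark factor of the Mecke integral over a product set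
  (\<open>intensity_exceed_Times\<close>). The cut to \<open>{0..A}\<close> keeps the radicands in
  \<open>rate\<close> positive for \<open>R > A\<close>.\<close>

definition marks_weight :: "real set \<Rightarrow> real \<Rightarrow> real" where
  "marks_weight C R = (\<integral>m. indicator (C \<inter> {0..A}) m * exp (- rate R m) \<partial>Q)"

lemma measurable_rate [measurable]: "rate R \<in> borel_measurable borel"
proof -
  have "continuous_on UNIV (\<lambda>z::real \<times> real. shell DIM('a) R ((snd z)\<^sup>2 - (fst z)\<^sup>2))"
    unfolding shell_def by (intro continuous_intros)
  then have "(\<lambda>z::real \<times> real. shell DIM('a) R ((snd z)\<^sup>2 - (fst z)\<^sup>2)) \<in> borel_measurable borel"
    by (rule borel_measurable_continuous_onI)
  then have "(\<lambda>(m, t). shell DIM('a) R (t\<^sup>2 - m\<^sup>2)) \<in> borel_measurable (borel \<Otimes>\<^sub>M Q)"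
    by (subst measurable_cong_sets[OF sets_pair_measure_cong[OF refl Q(2)] refl])
      (simp only: borel_prod case_prod_unfold)
  then show ?thesis unfolding rate_def
    by (intro borel_measurable_times Q.borel_measurable_lebesgue_integral) auto
qed

lemma measurable_intensity_product:
  assumes "f \<in> borel_measurable borel"
  shows "f \<in> borel_measurable intensity"
  by (subst measurable_cong_sets[OF sets_intensity' refl]) (rule assms)

lemma measurable_Q: "f \<in> borel_measurable borel \<Longrightarrow> f \<in> borel_measurable Q"
  by (subst measurable_cong_sets[OF Q(2) refl])

lemma weight_measurable:
  assumes "C \<in> sets borel"
  shows "(\<lambda>m. indicator (C \<inter> {0..A}) m * exp (- rate R m)) \<in> borel_measurable borel"
  using assms by measurable

lemma integrable_weight:
  assumes "A < R" "C \<in> sets borel"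
  shows "integrable Q (\<lambda>m. indicator (C \<inter> {0..A}) m * exp (- rate R m))"
proof (rule Q.integrable_const_bound)
  show "AE m in Q. norm (indicator (C \<inter> {0..A}) m * exp (- rate R m)) \<le> 1"
    using rate_nonneg[OF assms(1)] by (intro AE_I2) (auto simp: indicator_def)
qed (rule measurable_Q[OF weight_measurable[OF assms(2)]])

lemma intensity_exceed_Times:
  assumes R: "A < R" and B: "B \<in> sets borel" "emeasure lborel B < \<infinity>" and C: "C \<in> sets borel" "C \<subseteq> {0..A}"
  shows "intensity_exceed (\<lambda>_. R) (B \<times> C) = \<gamma> * measure lborel B * marks_weight C R"
proof -
  let ?f = "\<lambda>p::'a \<times> real. indicator B (fst p) * (indicator (C \<inter> {0..A}) (snd p) * exp (- rate R (snd p)))"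
  have CA: "C \<inter> {0..A} = C" using C(2) by auto
  have proj: "fst \<in> borel_measurable (borel :: ('a \<times> real) measure)" "snd \<in> borel_measurable (borel :: ('a \<times> real) measure)"
    by (intro borel_measurable_continuous_onI continuous_intros)+
  have fm: "?f \<in> borel_measurable borel"
  proof (intro borel_measurable_times)
    show "(\<lambda>p::'a \<times> real. indicator B (fst p) :: real) \<in> borel_measurable borel"
      using B by (intro measurable_compose[OF proj(1) borel_measurable_indicator]) auto
    show "(\<lambda>p::'a \<times> real. indicator (C \<inter> {0..A}) (snd p) :: real) \<in> borel_measurable borel"
      using C by (intro measurable_compose[OF proj(2) borel_measurable_indicator]) auto
    show "(\<lambda>p::'a \<times> real. exp (- rate R (snd p))) \<in> borel_measurable borel"
      by (rule measurable_compose[OF proj(2)]) measurable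
  qed
  have fm': "?f \<in> borel_measurable intensity" by (rule measurable_intensity_product[OF fm])
  have "intensity_exceed (\<lambda>_. R) (B \<times> C) = (\<integral>p. ?f p \<partial>intensity)"
    unfolding intensity_exceed_def set_lebesgue_integral_def
    using C(2) measure_reg[OF R]
    by (intro Bochner_Integration.integral_cong refl) (auto simp: indicator_def CA subset_iff)
  also have "\<dots> = enn2real (\<integral>\<^sup>+p. ennreal (?f p) \<partial>intensity)"
    by (rule integral_eq_nn_integral[OF fm']) (auto intro!: AE_I2 mult_nonneg_nonneg)
  also have "(\<integral>\<^sup>+p. ennreal (?f p) \<partial>intensity) =
    (\<integral>\<^sup>+x. (\<integral>\<^sup>+m. ennreal (?f (x, m)) \<partial>Q) \<partial>scale_measure (ennreal \<gamma>) lborel)"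
    unfolding intensity_def using fm'
    by (intro Q.nn_integral_fst[symmetric]) (simp add: intensity_def)
  also have "\<dots> = (\<integral>\<^sup>+x. ennreal (marks_weight C R) * indicator B x \<partial>scale_measure (ennreal \<gamma>) lborel)"
  proof (intro nn_integral_cong)
    fix x :: 'a
    have "(\<integral>\<^sup>+m. ennreal (?f (x, m)) \<partial>Q) = indicator B x * (\<integral>\<^sup>+m. ennreal (indicator (C \<inter> {0..A}) m * exp (- rate R m)) \<partial>Q)"
      by (cases "x \<in> B") auto
    also have "(\<integral>\<^sup>+m. ennreal (indicator (C \<inter> {0..A}) m * exp (- rate R m)) \<partial>Q) = ennreal (marks_weight C R)"
      unfolding marks_weight_def using integrable_weight[OF R C(1)]
      by (intro nn_integral_eq_integral) auto
    finally show "(\<integral>\<^sup>+m. ennreal (?f (x, m)) \<partial>Q) = ennreal (marks_weight C R) * indicator B x"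
      by (simp add: mult.commute)
  qed
  also have "\<dots> = ennreal (marks_weight C R) * (ennreal \<gamma> * emeasure lborel B)"
    using B by (subst nn_integral_cmult_indicator) auto
  also have "enn2real \<dots> = \<gamma> * measure lborel B * marks_weight C R"
  proof -
    have "0 \<le> marks_weight C R" unfolding marks_weight_def by (intro Bochner_Integration.integral_nonneg) auto
    then show ?thesis using gamma by (simp add: enn2real_mult measure_def)
  qed
  finally show ?thesis .
qed

text \<open>By \<open>rate_antimono\<close> the rate is largest at mark zero, which bounds the
  integrand from below almost everywhere.\<close>

lemma marks_weight_pos:
  assumes "A < R"
  shows "0 < marks_weight UNIV R"
proof -
  have "0 < exp (- rate R 0)" by simp
  also have "\<dots> = (\<integral>m. exp (- rate R 0) \<partial>Q)" using Q.prob_space by simp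
  also have "\<dots> \<le> (\<integral>m. indicator (UNIV \<inter> {0..A}) m * exp (- rate R m) \<partial>Q)"
  proof (rule integral_mono_AE)
    show "integrable Q (\<lambda>m. indicator (UNIV \<inter> {0..A}) m * exp (- rate R m))"
      by (rule integrable_weight[OF assms]) simp
    show "AE m in Q. exp (- rate R 0) \<le> indicator (UNIV \<inter> {0..A}) m * exp (- rate R m)"
      using AE_marks
    proof eventually_elim
      case (elim m) then show ?case using rate_antimono[OF assms, of 0 m] by simp
    qed
  qed simp
  finally show ?thesis by (simp add: marks_weight_def)
qed

lemma marks_weight_nonneg: "0 \<le> marks_weight C R"
  unfolding marks_weight_def by (intro Bochner_Integration.integral_nonneg) auto

lemma marks_weight_mono:
  assumes "A < R" "C \<in> sets borel" "C' \<in> sets borel" "C \<inter> {0..A} \<subseteq> C'"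
  shows "marks_weight C R \<le> marks_weight C' R"
  unfolding marks_weight_def using assms
  by (intro integral_mono integrable_weight) (auto simp: indicator_def)

lemma marks_weight_Un:
  assumes "A < R" "C \<in> sets borel" "C' \<in> sets borel" "C \<inter> C' = {}"
  shows "marks_weight (C \<union> C') R = marks_weight C R + marks_weight C' R"
  unfolding marks_weight_def Bochner_Integration.integral_add[OF integrable_weight[OF assms(1,2)] integrable_weight[OF assms(1,3)], symmetric]
  using assms(4) by (intro Bochner_Integration.integral_cong) (auto simp: indicator_def)

subsection \<open>The limiting mark distribution\<close>

lemma rate_dim2:
  assumes d: "DIM('a) = 2" and R: "A < R" and m: "0 \<le> m" "m \<le> A"
  shows "\<bar>rate R m - (4 * \<gamma> * unit_ball_vol 2 * R\<^sup>2 + 2 * unit_ball_vol 2 * \<gamma> * (\<integral>t. t\<^sup>2 \<partial>Q) - 2 * unit_ball_vol 2 * \<gamma> * m\<^sup>2)\<bar>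
    \<le> \<gamma> * unit_ball_vol 2 * (2 * A ^ 4 / R\<^sup>2)"
proof -
  have AR: "A\<^sup>2 < R\<^sup>2" using R A by (intro power_strict_mono) auto
  have int2: "integrable Q (\<lambda>t. t\<^sup>2)"
  proof (rule Q.integrable_const_bound)
    show "AE t in Q. norm (t\<^sup>2) \<le> A\<^sup>2" using AE_marks by eventually_elim (auto intro: power_mono)
    show "(\<lambda>t. t\<^sup>2) \<in> borel_measurable Q" by (rule measurable_Q) measurable
  qed
  have ints: "integrable Q (\<lambda>t. shell 2 R (t\<^sup>2 - m\<^sup>2))" using integrable_shell[OF R m] d by simp
  have "(\<integral>t. shell 2 R (t\<^sup>2 - m\<^sup>2) - (4 * R\<^sup>2 + 2 * (t\<^sup>2 - m\<^sup>2)) \<partial>Q)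
     = (\<integral>t. shell 2 R (t\<^sup>2 - m\<^sup>2) \<partial>Q) - (4 * R\<^sup>2 + 2 * ((\<integral>t. t\<^sup>2 \<partial>Q) - m\<^sup>2))"
    using int2 ints Q.prob_space by simp
  moreover have "\<bar>\<integral>t. shell 2 R (t\<^sup>2 - m\<^sup>2) - (4 * R\<^sup>2 + 2 * (t\<^sup>2 - m\<^sup>2)) \<partial>Q\<bar> \<le> 2 * A ^ 4 / R\<^sup>2"
  proof -
    have "\<bar>\<integral>t. shell 2 R (t\<^sup>2 - m\<^sup>2) - (4 * R\<^sup>2 + 2 * (t\<^sup>2 - m\<^sup>2)) \<partial>Q\<bar>
      \<le> (\<integral>t. \<bar>shell 2 R (t\<^sup>2 - m\<^sup>2) - (4 * R\<^sup>2 + 2 * (t\<^sup>2 - m\<^sup>2))\<bar> \<partial>Q)"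
      by (rule integral_abs_bound)
    also have "\<dots> \<le> (\<integral>t. 2 * A ^ 4 / R\<^sup>2 \<partial>Q)"
    proof (rule integral_mono_AE)
      show "integrable Q (\<lambda>t. \<bar>shell 2 R (t\<^sup>2 - m\<^sup>2) - (4 * R\<^sup>2 + 2 * (t\<^sup>2 - m\<^sup>2))\<bar>)"
        using int2 ints by (intro integrable_abs Bochner_Integration.integrable_diff) auto
      show "AE t in Q. \<bar>shell 2 R (t\<^sup>2 - m\<^sup>2) - (4 * R\<^sup>2 + 2 * (t\<^sup>2 - m\<^sup>2))\<bar> \<le> 2 * A ^ 4 / R\<^sup>2"
        using AE_marks
      proof eventually_elim
        case (elim t)
        then show ?case using shell2[of R "t\<^sup>2 - m\<^sup>2" "A\<^sup>2"] radicand_bound[of t m] m R A AR by simp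
      qed
    qed simp
    finally show ?thesis using Q.prob_space by simp
  qed
  ultimately have *: "\<bar>(\<integral>t. shell 2 R (t\<^sup>2 - m\<^sup>2) \<partial>Q) - (4 * R\<^sup>2 + 2 * ((\<integral>t. t\<^sup>2 \<partial>Q) - m\<^sup>2))\<bar> \<le> 2 * A ^ 4 / R\<^sup>2"
    by simp
  have "rate R m - (4 * \<gamma> * unit_ball_vol 2 * R\<^sup>2 + 2 * unit_ball_vol 2 * \<gamma> * (\<integral>t. t\<^sup>2 \<partial>Q) - 2 * unit_ball_vol 2 * \<gamma> * m\<^sup>2)
    = \<gamma> * unit_ball_vol 2 * ((\<integral>t. shell 2 R (t\<^sup>2 - m\<^sup>2) \<partial>Q) - (4 * R\<^sup>2 + 2 * ((\<integral>t. t\<^sup>2 \<partial>Q) - m\<^sup>2)))"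
    unfolding rate_def d by (simp add: algebra_simps)
  also have "\<bar>\<dots>\<bar> \<le> \<gamma> * unit_ball_vol 2 * (2 * A ^ 4 / R\<^sup>2)"
    unfolding abs_mult using * gamma by (intro mult_mono) auto
  finally show ?thesis .
qed

text \<open>By \<open>rate_dim2\<close>, \<open>exp (- rate R m)\<close> equals
  \<open>exp (- c R) * exp (k * m\<^sup>2)\<close> up to a factor between
  \<open>exp (- \<delta> R)\<close> and \<open>exp (\<delta> R)\<close>. The diverging term
  \<open>c R\<close> does not depend on the mark and cancels in the quotient, while
  \<open>\<delta> R\<close> tends to zero.\<close>

lemma marks_ratio_dim2:
  assumes d: "DIM('a) = 2" and C: "C \<in> sets borel"
  shows "((\<lambda>R. marks_weight C R / marks_weight UNIV R) \<longlongrightarrow> measure (limit_mark_distr DIM('a) \<gamma> Q A) C) at_top"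
proof -
  define k where "k = 2 * unit_ball_vol 2 * \<gamma>"
  have k: "k > 0" using gamma by (simp add: k_def)
  define I where "I C = (\<integral>m. indicator (C \<inter> {0..A}) m * exp (k * m\<^sup>2) \<partial>Q)" for C
  have intI: "integrable Q (\<lambda>m. indicator (C \<inter> {0..A}) m * exp (k * m\<^sup>2))" if "C \<in> sets borel" for C
  proof (rule Q.integrable_const_bound)
    show "AE m in Q. norm (indicator (C \<inter> {0..A}) m * exp (k * m\<^sup>2)) \<le> exp (k * A\<^sup>2)"
      using k by (intro AE_I2) (auto simp: indicator_def intro: power_mono)
    show "(\<lambda>m. indicator (C \<inter> {0..A}) m * exp (k * m\<^sup>2)) \<in> borel_measurable Q"
      using that by (intro measurable_Q borel_measurable_times borel_measurable_indicator) auto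
  qed
  have I0: "0 \<le> I C" for C unfolding I_def by (intro Bochner_Integration.integral_nonneg) auto
  have I1: "I UNIV > 0"
  proof -
    have "(1::real) = (\<integral>m. 1 \<partial>Q)" using Q.prob_space by simp
    also have "\<dots> \<le> I UNIV" unfolding I_def
    proof (rule integral_mono_AE)
      show "AE m in Q. 1 \<le> indicator (UNIV \<inter> {0..A}) m * exp (k * m\<^sup>2)"
        using AE_marks by eventually_elim (use k in auto)
    qed (use intI[of UNIV] in auto)
    finally show ?thesis by simp
  qed
  define c where "c R = 4 * \<gamma> * unit_ball_vol 2 * R\<^sup>2 + k * (\<integral>t. t\<^sup>2 \<partial>Q)" for R
  define \<delta> where "\<delta> R = \<gamma> * unit_ball_vol 2 * (2 * A ^ 4 / R\<^sup>2)" for R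
  have r: "\<bar>rate R m - (c R - k * m\<^sup>2)\<bar> \<le> \<delta> R" if "A < R" "m \<in> {0..A}" for R m
    using rate_dim2[OF d that(1), of m] that(2) unfolding c_def \<delta>_def k_def by (simp add: algebra_simps)
  have up: "marks_weight C R \<le> exp (\<delta> R - c R) * I C" and lo: "exp (- \<delta> R - c R) * I C \<le> marks_weight C R"
    if R: "A < R" and C: "C \<in> sets borel" for R C
  proof -
    have e: "exp (- \<delta> R - c R) * exp (k * m\<^sup>2) \<le> exp (- rate R m)" "exp (- rate R m) \<le> exp (\<delta> R - c R) * exp (k * m\<^sup>2)"
      if "m \<in> {0..A}" for m
      using r[OF R that] by (auto simp flip: exp_add)
    show "marks_weight C R \<le> exp (\<delta> R - c R) * I C"
      unfolding marks_weight_def I_def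
      by (subst Bochner_Integration.integral_mult_right_zero[symmetric], intro integral_mono integrable_weight R C integrable_mult_right intI)
        (auto simp: indicator_def e)
    show "exp (- \<delta> R - c R) * I C \<le> marks_weight C R"
      unfolding marks_weight_def I_def
      by (subst Bochner_Integration.integral_mult_right_zero[symmetric], intro integral_mono integrable_weight R C integrable_mult_right intI)
        (auto simp: indicator_def e)
  qed
  have \<delta>0: "(\<delta> \<longlongrightarrow> 0) at_top"
  proof -
    have "((\<lambda>R. \<gamma> * unit_ball_vol 2 * (2 * A ^ 4 / R\<^sup>2)) \<longlongrightarrow> \<gamma> * unit_ball_vol 2 * 0) at_top"
      by (intro tendsto_intros tendsto_divide_0[OF tendsto_const] filterlim_at_top_imp_at_infinity
          filterlim_pow_at_top filterlim_ident) auto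
    then show ?thesis by (simp add: \<delta>_def[abs_def])
  qed
  have Cl: "measure (limit_mark_distr DIM('a) \<gamma> Q A) C = I C / I UNIV"
  proof -
    have Z: "(\<integral>t. exp (2 * unit_ball_vol 2 * \<gamma> * t\<^sup>2) \<partial>Q) = I UNIV"
      unfolding I_def k_def
    proof (rule integral_cong_AE)
      show "AE t in Q. exp (2 * unit_ball_vol 2 * \<gamma> * t\<^sup>2) = indicator (UNIV \<inter> {0..A}) t * exp (2 * unit_ball_vol 2 * \<gamma> * t\<^sup>2)"
        using AE_marks by eventually_elim auto
    qed (rule measurable_Q, measurable)+
    have "emeasure (limit_mark_distr DIM('a) \<gamma> Q A) C = (\<integral>\<^sup>+m. ennreal (exp (k * m\<^sup>2) / I UNIV) * indicator C m \<partial>Q)"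
      unfolding limit_mark_distr_def using d C Q(2)
      by (subst emeasure_density[symmetric]) (auto simp: Z k_def intro!: measurable_Q)
    also have "\<dots> = (\<integral>\<^sup>+m. ennreal (indicator (C \<inter> {0..A}) m * exp (k * m\<^sup>2) / I UNIV) \<partial>Q)"
      by (intro nn_integral_cong_AE, use AE_marks in eventually_elim) (auto simp: indicator_def)
    also have "\<dots> = ennreal (\<integral>m. indicator (C \<inter> {0..A}) m * exp (k * m\<^sup>2) / I UNIV \<partial>Q)"
      using I1 by (intro nn_integral_eq_integral integrable_divide intI C AE_I2) auto
    also have "\<dots> = ennreal (I C / I UNIV)" by (simp add: I_def)
    finally show ?thesis using I0[of C] I1 by (simp add: measure_def)
  qed
  show ?thesis unfolding Cl
  proof (rule tendsto_sandwich)
    show "eventually (\<lambda>R. exp (- 2 * \<delta> R) * (I C / I UNIV) \<le> marks_weight C R / marks_weight UNIV R) at_top"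
      using eventually_gt_at_top[of A]
    proof eventually_elim
      case (elim R)
      have "exp (- 2 * \<delta> R) * (I C / I UNIV) = (exp (- \<delta> R - c R) * I C) / (exp (\<delta> R - c R) * I UNIV)"
        using I1 by (simp add: field_simps flip: exp_add)
      also have "\<dots> \<le> marks_weight C R / marks_weight UNIV R"
        using up[OF elim, of UNIV] lo[OF elim C] marks_weight_pos[OF elim] marks_weight_nonneg
        by (intro frac_le) auto
      finally show ?case .
    qed
    show "eventually (\<lambda>R. marks_weight C R / marks_weight UNIV R \<le> exp (2 * \<delta> R) * (I C / I UNIV)) at_top"
      using eventually_gt_at_top[of A]
    proof eventually_elim
      case (elim R)
      have "marks_weight C R / marks_weight UNIV R \<le> (exp (\<delta> R - c R) * I C) / (exp (- \<delta> R - c R) * I UNIV)"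
        using up[OF elim C] lo[OF elim, of UNIV] I0[of C] I1
        by (intro frac_le) auto
      also have "\<dots> = exp (2 * \<delta> R) * (I C / I UNIV)"
        using I1 by (simp add: field_simps flip: exp_add)
      finally show ?case .
    qed
    have "((\<lambda>R. exp (- 2 * \<delta> R) * (I C / I UNIV)) \<longlongrightarrow> exp (- 2 * 0) * (I C / I UNIV)) at_top"
      by (intro tendsto_intros \<delta>0)
    then show "((\<lambda>R. exp (- 2 * \<delta> R) * (I C / I UNIV)) \<longlongrightarrow> I C / I UNIV) at_top" by simp
    have "((\<lambda>R. exp (2 * \<delta> R) * (I C / I UNIV)) \<longlongrightarrow> exp (2 * 0) * (I C / I UNIV)) at_top"
      by (intro tendsto_intros \<delta>0)
    then show "((\<lambda>R. exp (2 * \<delta> R) * (I C / I UNIV)) \<longlongrightarrow> I C / I UNIV) at_top" by simp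
  qed
qed

text \<open>In dimension at least three the difference \<open>rate R c - rate R c'\<close> with \<open>c < c' < A\<close> grows at
  least linearly in \<open>R\<close>, so that only marks near \<open>A\<close> survive.\<close>
lemma marks_weight_low:
  assumes d: "DIM('a) \<ge> 3" and top: "\<And>\<epsilon>. 0 < \<epsilon> \<Longrightarrow> \<epsilon> < A \<Longrightarrow> measure Q {0..A - \<epsilon>} < 1" and c: "0 < c" "c < A"
  shows "((\<lambda>R. marks_weight {..c} R / marks_weight UNIV R) \<longlongrightarrow> 0) at_top"
proof -
  \<comment> \<open>A second level between \<open>c\<close> and \<open>A\<close>: marks in
    \<open>{c'<..A}\<close> have positive probability by \<open>top\<close>, and they outweigh those
    up to \<open>c\<close> by a factor of order \<open>exp (K * R)\<close>.\<close>
  define c' where "c' = (c + A) / 2"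
  have c': "c < c'" "c' < A" using c by (auto simp: c'_def)
  define q where "q = measure Q {c'<..A}"
  have q: "q > 0"
  proof -
    have "measure Q {0..A} = measure Q ({0..c'} \<union> {c'<..A})"
      using c c' by (intro arg_cong[of _ _ "measure Q"]) auto
    also have "\<dots> = measure Q {0..c'} + q" unfolding q_def
      using Q(2) by (intro Q.finite_measure_Union) auto
    finally have "measure Q {0..c'} + q = 1" using A by simp
    moreover have "measure Q {0..A - (A - c')} < 1" using c c' by (intro top) auto
    ultimately show ?thesis by simp
  qed
  define K where "K = \<gamma> * unit_ball_vol (real DIM('a)) * ((c'\<^sup>2 - c\<^sup>2) / 4)"
  have cc: "c\<^sup>2 < c'\<^sup>2" using c c' by (intro power_strict_mono) auto
  have K: "K > 0" unfolding K_def using gamma cc by (intro mult_pos_pos) auto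
  have b: "marks_weight {..c} R / marks_weight UNIV R \<le> exp (- (K * R)) / q" if R: "A < R" "1 \<le> R" for R
  proof -
    have 1: "marks_weight {..c} R \<le> exp (- rate R c)"
    proof -
      have "marks_weight {..c} R \<le> (\<integral>m. exp (- rate R c) \<partial>Q)"
        unfolding marks_weight_def
        using rate_antimono[OF R(1), of _ c] c by (intro integral_mono integrable_weight R) (auto simp: indicator_def)
      then show ?thesis using Q.prob_space by simp
    qed
    have 2: "q * exp (- rate R c') \<le> marks_weight UNIV R"
    proof -
      have "q * exp (- rate R c') = (\<integral>m. exp (- rate R c') * indicator {c'<..A} m \<partial>Q)"
        using Q(2) sets_eq_imp_space_eq[OF Q(2)] by (simp add: q_def)
      also have "\<dots> \<le> marks_weight UNIV R"
        unfolding marks_weight_def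
        using rate_antimono[OF R(1), of c'] c c' Q(2)
        by (intro integral_mono integrable_weight R integrable_mult_right integrable_real_indicator)
          (auto simp: indicator_def Q.emeasure_eq_measure)
      finally show ?thesis .
    qed
    have 3: "K * R \<le> rate R c - rate R c'"
    proof -
      have AR: "A\<^sup>2 \<le> R\<^sup>2" using R A by (intro power_mono) auto
      have "(c'\<^sup>2 - c\<^sup>2) / 4 * R = (\<integral>t. (c'\<^sup>2 - c\<^sup>2) * R / 4 \<partial>Q)" using Q.prob_space by simp
      also have "\<dots> \<le> (\<integral>t. shell DIM('a) R (t\<^sup>2 - c\<^sup>2) - shell DIM('a) R (t\<^sup>2 - c'\<^sup>2) \<partial>Q)"
      proof (rule integral_mono_AE)
        show "integrable Q (\<lambda>t. shell DIM('a) R (t\<^sup>2 - c\<^sup>2) - shell DIM('a) R (t\<^sup>2 - c'\<^sup>2))"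
          using c c' R by (intro Bochner_Integration.integrable_diff integrable_shell) auto
        show "AE t in Q. (c'\<^sup>2 - c\<^sup>2) * R / 4 \<le> shell DIM('a) R (t\<^sup>2 - c\<^sup>2) - shell DIM('a) R (t\<^sup>2 - c'\<^sup>2)"
          using AE_marks
        proof eventually_elim
          case (elim t)
          then show ?case
            using shell_increment[OF d R(2), of "t\<^sup>2 - c'\<^sup>2" "A\<^sup>2" "t\<^sup>2 - c\<^sup>2"] radicand_bound[of t c] radicand_bound[of t c'] c c' cc AR
            by simp
        qed
      qed simp
      also have "\<dots> = (\<integral>t. shell DIM('a) R (t\<^sup>2 - c\<^sup>2) \<partial>Q) - (\<integral>t. shell DIM('a) R (t\<^sup>2 - c'\<^sup>2) \<partial>Q)"
        using c c' R by (intro Bochner_Integration.integral_diff integrable_shell) auto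
      finally have "\<gamma> * unit_ball_vol (real DIM('a)) * ((c'\<^sup>2 - c\<^sup>2) / 4 * R)
        \<le> \<gamma> * unit_ball_vol (real DIM('a)) * ((\<integral>t. shell DIM('a) R (t\<^sup>2 - c\<^sup>2) \<partial>Q) - (\<integral>t. shell DIM('a) R (t\<^sup>2 - c'\<^sup>2) \<partial>Q))"
        using gamma by (intro mult_left_mono) auto
      then show ?thesis unfolding K_def rate_def by (simp add: algebra_simps)
    qed
    have "marks_weight {..c} R / marks_weight UNIV R \<le> exp (- rate R c) / (q * exp (- rate R c'))"
      using 1 2 q marks_weight_nonneg by (intro frac_le) auto
    also have "\<dots> = exp (- (rate R c - rate R c')) / q" by (simp add: exp_diff exp_minus field_simps)
    also have "\<dots> \<le> exp (- (K * R)) / q" using 3 q by (intro divide_right_mono) auto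
    finally show ?thesis .
  qed
  show ?thesis
  proof (rule tendsto_sandwich)
    show "eventually (\<lambda>R. 0 \<le> marks_weight {..c} R / marks_weight UNIV R) at_top"
      by (simp add: marks_weight_nonneg)
    show "eventually (\<lambda>R. marks_weight {..c} R / marks_weight UNIV R \<le> exp (- (K * R)) / q) at_top"
      using eventually_gt_at_top[of A] eventually_ge_at_top[of 1] by eventually_elim (rule b)
    have "((\<lambda>R. exp (- (K * R))) \<longlongrightarrow> 0) at_top"
      using K by (intro filterlim_compose[OF exp_at_bot] filterlim_compose[OF filterlim_uminus_at_bot_at_top]
          filterlim_tendsto_pos_mult_at_top[OF tendsto_const] filterlim_ident) auto
    from tendsto_divide[OF this tendsto_const[of q]] show "((\<lambda>R. exp (- (K * R)) / q) \<longlongrightarrow> 0) at_top"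
      using q by simp
  qed simp
qed

text \<open>Closing the intervals on the right matters in dimension at least three: the weight
  concentrates at \<open>A\<close>, possibly only from below, so an interval that ends at
  \<open>A\<close> must contain it to agree with the point mass in the limit.\<close>

lemma marks_ratio:
  assumes d: "DIM('a) \<ge> 2" and top: "\<And>\<epsilon>. 0 < \<epsilon> \<Longrightarrow> \<epsilon> < A \<Longrightarrow> measure Q {0..A - \<epsilon>} < 1"
  shows "((\<lambda>R. marks_weight {c1<..c2} R / marks_weight UNIV R) \<longlongrightarrow> measure (limit_mark_distr DIM('a) \<gamma> Q A) {c1<..c2}) at_top"
proof (cases "DIM('a) = 2")
  case True then show ?thesis by (intro marks_ratio_dim2) auto
next
  case False
  then have d3: "DIM('a) \<ge> 3" using d by simp
  have lim: "measure (limit_mark_distr DIM('a) \<gamma> Q A) {c1<..c2} = indicator {c1<..c2} A"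
    using False by (simp add: limit_mark_distr_def measure_return)
  have low: "((\<lambda>R. marks_weight {c1<..c2} R / marks_weight UNIV R) \<longlongrightarrow> 0) at_top" if "c2 < A"
  proof -
    \<comment> \<open>The maximum makes the level positive, as \<open>marks_weight_low\<close>
      requires; \<open>c2\<close> itself may be negative.\<close>
    define c where "c = max c2 (A / 2)"
    have c: "0 < c" "c < A" "c2 \<le> c" using that A by (auto simp: c_def)
    show ?thesis
    proof (rule tendsto_sandwich[OF _ _ tendsto_const marks_weight_low[OF d3 top c(1,2)]])
      show "eventually (\<lambda>R. marks_weight {c1<..c2} R / marks_weight UNIV R \<le> marks_weight {..c} R / marks_weight UNIV R) at_top"
        using eventually_gt_at_top[of A]
        by eventually_elim (use c in \<open>auto intro!: divide_right_mono marks_weight_mono marks_weight_nonneg\<close>)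
    qed (auto simp: marks_weight_nonneg)
  qed
  show ?thesis
  proof (cases "A \<in> {c1<..c2}")
    case A': True
    define c where "c = max c1 (A / 2)"
    have c: "0 < c" "c < A" "c1 \<le> c" using A' A by (auto simp: c_def)
    have "((\<lambda>R. marks_weight {c1<..c2} R / marks_weight UNIV R) \<longlongrightarrow> 1) at_top"
    proof (rule tendsto_sandwich)
      have "((\<lambda>R. 1 - marks_weight {..c} R / marks_weight UNIV R) \<longlongrightarrow> 1 - 0) at_top"
        by (intro tendsto_intros marks_weight_low[OF d3 top c(1,2)])
      then show "((\<lambda>R. 1 - marks_weight {..c} R / marks_weight UNIV R) \<longlongrightarrow> 1) at_top" by simp
      show "eventually (\<lambda>R. 1 - marks_weight {..c} R / marks_weight UNIV R \<le> marks_weight {c1<..c2} R / marks_weight UNIV R) at_top"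
        using eventually_gt_at_top[of A]
      proof eventually_elim
        case (elim R)
        have "marks_weight UNIV R = marks_weight ({..c} \<union> {c<..}) R" by (rule arg_cong[of _ _ "\<lambda>C. marks_weight C R"]) auto
        also have "\<dots> = marks_weight {..c} R + marks_weight {c<..} R" by (rule marks_weight_Un[OF elim]) auto
        also have "marks_weight {c<..} R \<le> marks_weight {c1<..c2} R" by (rule marks_weight_mono[OF elim]) (use c A' in auto)
        finally have "(marks_weight UNIV R - marks_weight {..c} R) / marks_weight UNIV R \<le> marks_weight {c1<..c2} R / marks_weight UNIV R"
          using marks_weight_pos[OF elim] by (intro divide_right_mono) auto
        then show ?case using marks_weight_pos[OF elim] by (simp add: diff_divide_distrib)
      qed
      show "eventually (\<lambda>R. marks_weight {c1<..c2} R / marks_weight UNIV R \<le> 1) at_top"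
        using eventually_gt_at_top[of A]
        by eventually_elim (use marks_weight_pos marks_weight_mono[of _ "{c1<..c2}" UNIV] in \<open>auto simp: divide_le_eq_1\<close>)
    qed simp
    then show ?thesis unfolding lim using A' by simp
  next
    case A': False
    show ?thesis
    proof (cases "c2 < A")
      case True then show ?thesis unfolding lim using low A' by simp
    next
      case False
      \<comment> \<open>In this case \<open>A \<le> c1\<close>, and the weight is zero for every
        \<open>R\<close>.\<close>
      then have "{c1<..c2} \<inter> {0..A} = {}" using A' by auto
      then have "marks_weight {c1<..c2} R = 0" for R by (simp add: marks_weight_def)
      then show ?thesis unfolding lim using A' by simp
    qed
  qed
qed

end

subsection \<open>Inradius and exclusion regions\<close>

lemma norm_diff_sq:
  fixes u v :: "'a::real_inner"
  shows "(norm (u - v))\<^sup>2 = (norm u)\<^sup>2 - 2 * (u \<bullet> v) + (norm v)\<^sup>2"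
  by (simp add: power2_norm_eq_inner inner_diff inner_commute)

text \<open>Each \<open>q\<close> cuts the cell by a condition that is affine in \<open>z\<close>,
  so only the point of the ball furthest in the direction of \<open>q\<close> matters;
  Cauchy-Schwarz gives the converse.\<close>

lemma cball_subset_laguerre_iff:
  fixes p :: "'a::euclidean_space \<times> real"
  assumes r: "0 \<le> r"
  shows "cball (fst p) r \<subseteq> laguerre_cell p \<phi> \<longleftrightarrow> (\<forall>q\<in>\<phi>. 0 \<le> gap r p q)"
proof
  assume sub: "cball (fst p) r \<subseteq> laguerre_cell p \<phi>"
  show "\<forall>q\<in>\<phi>. 0 \<le> gap r p q"
  proof
    fix q assume q: "q \<in> \<phi>"
    define v where "v = fst q - fst p"
    \<comment> \<open>For \<open>v = 0\<close> division by zero gives \<open>z = fst p\<close>, and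
      the claim reduces to a comparison of the two marks.\<close>
    define z where "z = fst p + (r / norm v) *\<^sub>R v"
    have zp: "z - fst p = (r / norm v) *\<^sub>R v" by (simp add: z_def)
    have nz: "norm (z - fst p) \<le> r" using r by (cases "v = 0") (auto simp: zp)
    then have "z \<in> laguerre_cell p \<phi>" using sub by (auto simp: dist_norm norm_minus_commute)
    then have "(norm (z - fst p))\<^sup>2 - (snd p)\<^sup>2 \<le> (norm (z - fst q))\<^sup>2 - (snd q)\<^sup>2"
      using q by (simp add: laguerre_cell_def)
    moreover have "(norm (z - fst q))\<^sup>2 = (norm (z - fst p))\<^sup>2 - 2 * ((z - fst p) \<bullet> v) + (norm v)\<^sup>2"
      unfolding norm_diff_sq[symmetric] by (simp add: v_def)
    moreover have "(z - fst p) \<bullet> v = r * norm v"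
      by (cases "v = 0") (auto simp: zp dot_square_norm power2_eq_square)
    ultimately show "0 \<le> gap r p q" by (simp add: gap_def v_def)
  qed
next
  assume g: "\<forall>q\<in>\<phi>. 0 \<le> gap r p q"
  show "cball (fst p) r \<subseteq> laguerre_cell p \<phi>"
  proof
    fix z assume "z \<in> cball (fst p) r"
    then have z: "norm (z - fst p) \<le> r" by (simp add: dist_norm norm_minus_commute)
    show "z \<in> laguerre_cell p \<phi>" unfolding laguerre_cell_def
    proof (intro CollectI ballI)
      fix q assume q: "q \<in> \<phi>"
      define v where "v = fst q - fst p"
      have 1: "(norm (z - fst q))\<^sup>2 = (norm (z - fst p))\<^sup>2 - 2 * ((z - fst p) \<bullet> v) + (norm v)\<^sup>2"
        unfolding norm_diff_sq[symmetric] by (simp add: v_def)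
      have "(z - fst p) \<bullet> v \<le> norm (z - fst p) * norm v" by (rule norm_cauchy_schwarz)
      also have "\<dots> \<le> r * norm v" using z by (intro mult_right_mono) auto
      finally show "(norm (z - fst p))\<^sup>2 - (snd p)\<^sup>2 \<le> (norm (z - fst q))\<^sup>2 - (snd q)\<^sup>2"
        using g q 1 by (auto simp: gap_def v_def)
    qed
  qed
qed

lemma inradius_nonneg: "0 \<le> inradius p \<phi>"
proof (cases "fst p \<in> laguerre_cell p \<phi>")
  case True
  then show ?thesis unfolding inradius_def zero_ereal_def by (auto intro!: SUP_upper)
qed (simp add: inradius_def)

text \<open>The supremum may be used like a maximum: the gap is continuous and decreasing in the
  radius, so a negative gap at \<open>R\<close> is already negative at some smaller positive radius
  and at all radii above it.\<close>

lemma inradius_ge_iff: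
  fixes p :: "'a::euclidean_space \<times> real"
  assumes R: "0 < R"
  shows "ereal R \<le> inradius p \<phi> \<longleftrightarrow> (\<forall>q\<in>\<phi>. 0 \<le> gap R p q)"
proof
  assume "\<forall>q\<in>\<phi>. 0 \<le> gap R p q"
  then have sub: "cball (fst p) R \<subseteq> laguerre_cell p \<phi>" using cball_subset_laguerre_iff[of R p \<phi>] R by simp
  then have "fst p \<in> laguerre_cell p \<phi>" using R by auto
  then show "ereal R \<le> inradius p \<phi>" unfolding inradius_def using sub R by (auto intro!: SUP_upper)
next
  assume ge: "ereal R \<le> inradius p \<phi>"
  show "\<forall>q\<in>\<phi>. 0 \<le> gap R p q"
  proof (rule ballI, rule ccontr)
    fix q assume q: "q \<in> \<phi>" and "\<not> 0 \<le> gap R p q"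
    then have neg: "gap R p q < 0" by simp
    have cont: "isCont (\<lambda>r. gap r p q) R" unfolding gap_def by (intro continuous_intros)
    then have "eventually (\<lambda>r. gap r p q < 0) (at R)"
      using neg unfolding isCont_def by (rule order_tendstoD(2))
    then obtain e where e: "e > 0" "\<And>r. r \<noteq> R \<Longrightarrow> dist r R < e \<Longrightarrow> gap r p q < 0"
      unfolding eventually_at by blast
    \<comment> \<open>The second entry keeps the radius positive, which is needed when the inradius
      is zero by convention.\<close>
    define R' where "R' = max (R - e/2) (R/2)"
    have R': "0 < R'" "R' < R" "gap R' p q < 0"
      using e R by (auto simp: R'_def dist_real_def max_def)
    have "inradius p \<phi> \<le> ereal R'"
    proof (cases "fst p \<in> laguerre_cell p \<phi>")
      case True
      have "r \<le> R'" if "0 \<le> r" "cball (fst p) r \<subseteq> laguerre_cell p \<phi>" for r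
      proof (rule ccontr)
        assume "\<not> r \<le> R'"
        then have "2 * R' * norm (fst q - fst p) \<le> 2 * r * norm (fst q - fst p)" by (intro mult_right_mono) auto
        then have "gap r p q < 0" using R'(3) unfolding gap_def by linarith
        then show False using that q by (auto simp: cball_subset_laguerre_iff)
      qed
      then show ?thesis unfolding inradius_def using True by (auto intro!: SUP_least)
    next
      case False
      then show ?thesis using R' by (simp add: inradius_def)
    qed
    then have "ereal R \<le> ereal R'" using ge order_trans by blast
    then show False using R' by simp
  qed
qed

lemma inradius_eq_0: "fst p \<notin> laguerre_cell p \<phi> \<Longrightarrow> inradius p \<phi> = 0"
  by (simp add: inradius_def)

subsection \<open>Measurability of the maximal cell\<close>

context laguerre_process
begin

abbreviation pts :: "'w \<Rightarrow> ('a \<times> real) set" where "pts \<omega> \<equiv> points (\<eta> \<omega>)"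

lemma pts_subset:
  assumes "\<omega> \<in> space P"
  shows "pts \<omega> \<subseteq> UNIV \<times> {0..}"
proof -
  have "- (UNIV \<times> {0..} :: ('a \<times> real) set) \<in> sets borel"
    by (intro borel_open open_Compl closed_Times) auto
  moreover have "emeasure (\<eta> \<omega>) (- (UNIV \<times> {0..})) = 0"
    using counting[OF assms] by (simp add: counting_measure_on_def)
  ultimately have "pts \<omega> \<inter> - (UNIV \<times> {0..}) = {}"
    using counting_measure_eq_0_iff[OF counting[OF assms]] by blast
  then show ?thesis by blast
qed

lemma full_exceed_iff:
  assumes "0 < R"
  shows "p \<in> full.exceed (\<lambda>_. R) \<phi> \<longleftrightarrow> p \<in> \<phi> \<and> ereal R \<le> inradius p \<phi>"
proof -
  have r: "q \<in> full.reg R p \<longleftrightarrow> gap R p q < 0" for q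
    unfolding full.reg_def lag_region_def by (subst mem_Collect_eq)+ simp
  have e: "p \<in> full.exceed (\<lambda>_. R) \<phi> \<longleftrightarrow> p \<in> \<phi> \<and> \<phi> \<inter> full.reg R p = {}"
    unfolding full.exceed_def by (rule mem_Collect_eq)
  have "\<phi> \<inter> full.reg R p = {} \<longleftrightarrow> (\<forall>q\<in>\<phi>. 0 \<le> gap R p q)"
    using r not_less by blast
  then show ?thesis using e inradius_ge_iff[OF assms, of p \<phi>] by blast
qed

text \<open>Realisations with marks above \<open>A\<close> must be covered, hence the unrestricted
  regions. Counts are measurable on bounded sets, and these exhaust \<open>D\<close> along
  balls.\<close>

lemma exceed_event:
  assumes D: "D \<in> sets borel"
  shows "{\<omega>\<in>space P. \<exists>p\<in>pts \<omega> \<inter> D. ereal a \<le> inradius p (pts \<omega>)} \<in> events"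
proof (cases "a > 0")
  case False
  have "{\<omega>\<in>space P. \<exists>p\<in>pts \<omega> \<inter> D. ereal a \<le> inradius p (pts \<omega>)} = space P - void D"
  proof -
    have "ereal a \<le> inradius p (pts \<omega>)" for p \<omega>
      by (rule order_trans[OF _ inradius_nonneg]) (use False in simp)
    then show ?thesis by (auto simp: void_def)
  qed
  then show ?thesis using D by auto
next
  case True
  define E where "E n = {\<omega>\<in>space P. full.number (\<lambda>_. a) (D \<inter> cball 0 (real n)) \<omega> \<noteq> 0}" for n
  have E: "E n \<in> events" for n
  proof -
    have "full.simple_threshold (\<lambda>_. a) (D \<inter> cball 0 (real n))"
      using D by (auto simp: full.simple_threshold_def intro: finite_subset[of _ "{a}"])
    from full.measurable_number[OF this]
    have [measurable]: "(\<lambda>\<omega>. real (full.number (\<lambda>_. a) (D \<inter> cball 0 (real n)) \<omega>)) \<in> borel_measurable P" .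
    have "E n = {\<omega>\<in>space P. real (full.number (\<lambda>_. a) (D \<inter> cball 0 (real n)) \<omega>) \<noteq> 0}" by (simp add: E_def)
    also have "\<dots> \<in> events" by measurable
    finally show ?thesis .
  qed
  have "{\<omega>\<in>space P. \<exists>p\<in>pts \<omega> \<inter> D. ereal a \<le> inradius p (pts \<omega>)} = (\<Union>n. E n)"
  proof (intro set_eqI iffI)
    fix \<omega> assume "\<omega> \<in> {\<omega>\<in>space P. \<exists>p\<in>pts \<omega> \<inter> D. ereal a \<le> inradius p (pts \<omega>)}"
    then obtain p where p: "\<omega> \<in> space P" "p \<in> pts \<omega>" "p \<in> D" "ereal a \<le> inradius p (pts \<omega>)" by auto
    obtain n where n: "norm p \<le> real n" using real_arch_simple by blast
    have "finite (full.exceed (\<lambda>_. a) (pts \<omega>) \<inter> (D \<inter> cball 0 (real n)))"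
      by (rule finite_subset[OF _ points_Int(1)[OF p(1), of "D \<inter> cball 0 (real n)"]])
        (use D in \<open>auto simp: full.exceed_def\<close>)
    moreover have "p \<in> full.exceed (\<lambda>_. a) (pts \<omega>) \<inter> (D \<inter> cball 0 (real n))"
      using p n by (simp add: full_exceed_iff[OF True])
    ultimately have "full.number (\<lambda>_. a) (D \<inter> cball 0 (real n)) \<omega> \<noteq> 0"
      unfolding card_eq_0_iff by blast
    then have "\<omega> \<in> E n" using p(1) by (simp add: E_def)
    then show "\<omega> \<in> (\<Union>n. E n)" by blast
  next
    fix \<omega> assume "\<omega> \<in> (\<Union>n. E n)"
    then obtain n where n: "\<omega> \<in> space P" "full.number (\<lambda>_. a) (D \<inter> cball 0 (real n)) \<omega> \<noteq> 0" by (auto simp: E_def)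
    then have "full.exceed (\<lambda>_. a) (pts \<omega>) \<inter> (D \<inter> cball 0 (real n)) \<noteq> {}" using card.empty by metis
    then show "\<omega> \<in> {\<omega>\<in>space P. \<exists>p\<in>pts \<omega> \<inter> D. ereal a \<le> inradius p (pts \<omega>)}"
      using n(1) full_exceed_iff[OF True] by blast
  qed
  then show ?thesis using E by auto
qed

definition sup_inradius :: "('a \<times> real) set \<Rightarrow> 'w \<Rightarrow> ereal" where
  "sup_inradius D \<omega> = (SUP p\<in>pts \<omega> \<inter> D. inradius p (pts \<omega>))"

lemma measurable_sup_inradius:
  assumes "D \<in> sets borel"
  shows "sup_inradius D \<in> borel_measurable P"
proof (rule borel_measurableI_greater)
  fix y :: ereal
  have "{\<omega>\<in>space P. y < sup_inradius D \<omega>} =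
    (\<Union>r\<in>{r::rat. y < ereal (of_rat r)}. {\<omega>\<in>space P. \<exists>p\<in>pts \<omega> \<inter> D. ereal (of_rat r) \<le> inradius p (pts \<omega>)})"
  proof (intro set_eqI iffI)
    fix \<omega> assume "\<omega> \<in> {\<omega>\<in>space P. y < sup_inradius D \<omega>}"
    then obtain p where p: "\<omega> \<in> space P" "p \<in> pts \<omega> \<inter> D" "y < inradius p (pts \<omega>)"
      unfolding sup_inradius_def less_SUP_iff by blast
    obtain r :: rat where "y < ereal (of_rat r)" "ereal (of_rat r) < inradius p (pts \<omega>)"
      using ereal_dense3[OF p(3)] by blast
    then show "\<omega> \<in> (\<Union>r\<in>{r::rat. y < ereal (of_rat r)}. {\<omega>\<in>space P. \<exists>p\<in>pts \<omega> \<inter> D. ereal (of_rat r) \<le> inradius p (pts \<omega>)})"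
      using p by (auto intro: less_imp_le)
  next
    fix \<omega> assume "\<omega> \<in> (\<Union>r\<in>{r::rat. y < ereal (of_rat r)}. {\<omega>\<in>space P. \<exists>p\<in>pts \<omega> \<inter> D. ereal (of_rat r) \<le> inradius p (pts \<omega>)})"
    then obtain r p where "y < ereal (of_rat r)" "\<omega> \<in> space P" "p \<in> pts \<omega> \<inter> D" "ereal (of_rat r) \<le> inradius p (pts \<omega>)"
      by blast
    then show "\<omega> \<in> {\<omega>\<in>space P. y < sup_inradius D \<omega>}"
      unfolding sup_inradius_def less_SUP_iff by (auto intro: less_le_trans)
  qed
  also have "\<dots> \<in> events"
    by (rule sets.countable_UN') (use exceed_event[OF assms] in auto)
  finally show "{\<omega>\<in>space P. y < sup_inradius D \<omega>} \<in> events" .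
qed

section \<open>Existence, uniqueness and measurability of the maximal nucleus\<close>

context
  fixes W :: "'a set" and \<rho> :: real
  assumes W: "compact W" and \<rho>: "\<rho> > 0"
begin

abbreviation nuclei :: "('a \<times> real) set" where "nuclei \<equiv> window \<rho> W \<times> {0..}"

lemma compact_window: "compact (window \<rho> W)"
  unfolding window_def by (rule compact_scaling[OF W])

lemma nuclei_borel: "nuclei \<in> sets borel"
  by (intro borel_closed closed_Times compact_imp_closed[OF compact_window] closed_atLeast)

text \<open>Bounded marks over the compact window leave finitely many nuclei, and at least one
  nucleus ensures that a maximum exists. On the complement no unique maximum exists
  (\<open>not_regular_config\<close>), so the default value of the triple applies.\<close>

definition regular_config :: "'w set" where
  "regular_config = (\<Union>k::nat. void (nuclei \<inter> UNIV \<times> {real k<..})) - void nuclei"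

lemma regular_config_finite:
  assumes "\<omega> \<in> regular_config"
  shows "\<omega> \<in> space P" "finite (pts \<omega> \<inter> nuclei)" "pts \<omega> \<inter> nuclei \<noteq> {}"
proof -
  obtain k :: nat where k: "\<omega> \<in> space P" "pts \<omega> \<inter> (nuclei \<inter> UNIV \<times> {real k<..}) = {}"
    using assms by (auto simp: regular_config_def void_def)
  have "pts \<omega> \<inter> nuclei \<subseteq> pts \<omega> \<inter> (window \<rho> W \<times> {0..real k})"
    using k(2) by (auto simp: disjoint_iff not_less)
  moreover have "finite (pts \<omega> \<inter> (window \<rho> W \<times> {0..real k}))"
    using compact_window by (intro points_Int k(1) borel_closed closed_Times bounded_Times compact_imp_closed compact_imp_bounded) auto
  ultimately show "finite (pts \<omega> \<inter> nuclei)" by (rule finite_subset)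
  show "\<omega> \<in> space P" by (rule k(1))
  show "pts \<omega> \<inter> nuclei \<noteq> {}" using assms k(1) by (auto simp: regular_config_def void_def)
qed

text \<open>If the marks in the window are unbounded then all cells are empty, so that every nucleus is
  a maximal one.\<close>
lemma not_regular_config:
  assumes \<omega>: "\<omega> \<in> space P" and nr: "\<omega> \<notin> regular_config"
  shows "\<not> (\<exists>!p. max_nucleus \<rho> W (pts \<omega>) p)"
proof (cases "pts \<omega> \<inter> nuclei = {}")
  case True
  then have "\<not> max_nucleus \<rho> W (pts \<omega>) p" for p unfolding max_nucleus_def by blast
  then show ?thesis by blast
next
  case False
  have large: "\<exists>q\<in>pts \<omega> \<inter> nuclei. real k < snd q" for k :: nat
  proof -
    have "\<omega> \<notin> void (nuclei \<inter> UNIV \<times> {real k<..})" "\<omega> \<notin> void nuclei"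
      using nr False unfolding regular_config_def void_def by blast+
    then obtain q where "q \<in> pts \<omega>" "q \<in> nuclei" "q \<in> UNIV \<times> {real k<..}" using \<omega> unfolding void_def by blast
    then show ?thesis by (intro bexI[of _ q]) (simp_all add: mem_Times_iff)
  qed
  obtain b where b: "\<And>y. y \<in> window \<rho> W \<Longrightarrow> norm y \<le> b"
    using compact_imp_bounded[OF compact_window] by (auto simp: bounded_iff)
  have 0: "inradius p (pts \<omega>) = 0" for p
  proof (rule inradius_eq_0)
    \<comment> \<open>The summand 1 forces \<open>k \<ge> 1\<close> and hence
      \<open>k \<le> (snd q)\<^sup>2\<close>, so that one large mark in the window already removes
      \<open>fst p\<close> from its own cell.\<close>
    obtain k :: nat where k: "(norm (fst p) + b)\<^sup>2 + (snd p)\<^sup>2 + 1 < real k" using reals_Archimedean2 by blast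
    obtain q where q: "q \<in> pts \<omega>" "fst q \<in> window \<rho> W" "real k < snd q" using large[of k] by (auto simp: mem_Times_iff)
    have "norm (fst p - fst q) \<le> norm (fst p) + b" using b[OF q(2)] norm_triangle_ineq4[of "fst p" "fst q"] by linarith
    then have "(norm (fst p - fst q))\<^sup>2 \<le> (norm (fst p) + b)\<^sup>2" by (intro power_mono) auto
    moreover have "1 \<le> real k" using k by (smt (verit) zero_le_power2)
    then have "real k \<le> (snd q)\<^sup>2" using q(3) by (smt (verit) power2_eq_square mult_le_cancel_left1)
    ultimately have "\<not> (norm (fst p - fst p))\<^sup>2 - (snd p)\<^sup>2 \<le> (norm (fst p - fst q))\<^sup>2 - (snd q)\<^sup>2"
      using k by simp
    then show "fst p \<notin> laguerre_cell p (pts \<omega>)" using q(1) by (auto simp: laguerre_cell_def)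
  qed
  have all: "max_nucleus \<rho> W (pts \<omega>) q" if "q \<in> pts \<omega> \<inter> nuclei" for q
    using that unfolding max_nucleus_def 0 by blast
  obtain q where q: "q \<in> pts \<omega> \<inter> nuclei" using False by blast
  obtain k :: nat where "snd q < real k" using reals_Archimedean2 by blast
  moreover obtain q' where q': "q' \<in> pts \<omega> \<inter> nuclei" "real k < snd q'" using large[of k] by blast
  ultimately have "q \<noteq> q'" by auto
  then show ?thesis using all[OF q] all[OF q'(1)] by blast
qed

text \<open>Translates the location of a maximal nucleus into an equation between measurable
  suprema; finiteness of the nuclei makes the supremum over \<open>D\<close> a maximum.\<close>

lemma sup_inradius_eq_iff:
  assumes \<omega>: "\<omega> \<in> regular_config"
  shows "sup_inradius (nuclei \<inter> D) \<omega> = sup_inradius nuclei \<omega> \<longleftrightarrow> (\<exists>p\<in>D. max_nucleus \<rho> W (pts \<omega>) p)"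
proof
  let ?\<phi> = "pts \<omega>"
  note fin = regular_config_finite[OF \<omega>]
  assume eq: "sup_inradius (nuclei \<inter> D) \<omega> = sup_inradius nuclei \<omega>"
  have up: "inradius q ?\<phi> \<le> sup_inradius nuclei \<omega>" if "q \<in> ?\<phi> \<inter> nuclei" for q
    unfolding sup_inradius_def using that by (rule SUP_upper)
  have "?\<phi> \<inter> (nuclei \<inter> D) \<noteq> {}"
  proof
    assume "?\<phi> \<inter> (nuclei \<inter> D) = {}"
    then have "sup_inradius nuclei \<omega> = bot" unfolding eq[symmetric] by (simp add: sup_inradius_def)
    moreover obtain q where "q \<in> ?\<phi> \<inter> nuclei" using fin(3) by blast
    ultimately have "inradius q ?\<phi> \<le> bot" using up by metis
    then show False using inradius_nonneg[of q ?\<phi>] by (auto simp: bot_ereal_def)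
  qed
  moreover have "finite (?\<phi> \<inter> (nuclei \<inter> D))" using fin(2) by (rule finite_subset[rotated]) auto
  ultimately have "Sup ((\<lambda>p. inradius p ?\<phi>) ` (?\<phi> \<inter> (nuclei \<inter> D))) \<in> (\<lambda>p. inradius p ?\<phi>) ` (?\<phi> \<inter> (nuclei \<inter> D))"
    by (subst Max_Sup[symmetric]) (auto intro!: Max_in)
  then obtain p where p: "p \<in> ?\<phi> \<inter> (nuclei \<inter> D)" "sup_inradius (nuclei \<inter> D) \<omega> = inradius p ?\<phi>"
    unfolding sup_inradius_def by auto
  then have "max_nucleus \<rho> W ?\<phi> p" using up eq by (auto simp: max_nucleus_def)
  then show "\<exists>p\<in>D. max_nucleus \<rho> W (pts \<omega>) p" using p by auto
next
  let ?\<phi> = "pts \<omega>"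
  assume "\<exists>p\<in>D. max_nucleus \<rho> W (pts \<omega>) p"
  then obtain p where p: "p \<in> D" "p \<in> ?\<phi> \<inter> nuclei" "\<And>q. q \<in> ?\<phi> \<inter> nuclei \<Longrightarrow> inradius q ?\<phi> \<le> inradius p ?\<phi>"
    by (auto simp: max_nucleus_def)
  show "sup_inradius (nuclei \<inter> D) \<omega> = sup_inradius nuclei \<omega>"
  proof (rule antisym)
    show "sup_inradius (nuclei \<inter> D) \<omega> \<le> sup_inradius nuclei \<omega>"
      unfolding sup_inradius_def by (intro SUP_subset_mono) auto
    have "sup_inradius nuclei \<omega> \<le> inradius p ?\<phi>" unfolding sup_inradius_def by (intro SUP_least p(3))
    also have "\<dots> \<le> sup_inradius (nuclei \<inter> D) \<omega>" unfolding sup_inradius_def using p by (intro SUP_upper) auto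
    finally show "sup_inradius nuclei \<omega> \<le> sup_inradius (nuclei \<inter> D) \<omega>" .
  qed
qed

definition unique_max :: "'w set" where
  "unique_max = {\<omega>\<in>space P. \<exists>!p. max_nucleus \<rho> W (pts \<omega>) p}"

lemma regular_config_events: "regular_config \<in> events"
proof -
  have "nuclei \<inter> UNIV \<times> {real k<..} \<in> sets borel" for k :: nat
    by (intro sets.Int nuclei_borel borel_open open_Times open_UNIV open_greaterThan)
  then have "(\<Union>k::nat. void (nuclei \<inter> UNIV \<times> {real k<..})) \<in> events"
    by (intro sets.countable_UN' image_subsetI void_events) simp_all
  then show ?thesis unfolding regular_config_def by (intro sets.Diff void_events nuclei_borel)
qed

lemma sup_eq_event:
  assumes "D \<in> sets borel" "D' \<in> sets borel"
  shows "{\<omega>\<in>space P. sup_inradius D \<omega> = sup_inradius D' \<omega>} \<in> events"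
  using measurable_sup_inradius[OF assms(1)] measurable_sup_inradius[OF assms(2)] by measurable

text \<open>Distinct maximal nuclei get different labels at some mesh. Uniqueness therefore means
  that at no mesh two different cells both attain the supremum, which is a countable
  condition.\<close>

lemma unique_max_events: "unique_max \<in> events"
proof -
  let ?L = "\<lambda>n k. nuclei \<inter> {p. mesh_label n p = k}"
  let ?E = "\<lambda>n k. {\<omega>\<in>space P. sup_inradius (?L n k) \<omega> = sup_inradius nuclei \<omega>}"
  have "unique_max = regular_config - (\<Union>n. \<Union>k. \<Union>k'\<in>- {k}. ?E n k \<inter> ?E n k')"
  proof (intro set_eqI iffI)
    fix \<omega> assume u: "\<omega> \<in> unique_max"
    then have \<omega>: "\<omega> \<in> space P" "\<omega> \<in> regular_config" using not_regular_config by (auto simp: unique_max_def)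
    have "\<omega> \<notin> ?E n k \<inter> ?E n k'" if "k' \<noteq> k" for n k k'
      using u that unfolding unique_max_def by (auto simp: sup_inradius_eq_iff[OF \<omega>(2)])
    then show "\<omega> \<in> regular_config - (\<Union>n. \<Union>k. \<Union>k'\<in>- {k}. ?E n k \<inter> ?E n k')" using \<omega>(2) by blast
  next
    fix \<omega> assume a: "\<omega> \<in> regular_config - (\<Union>n. \<Union>k. \<Union>k'\<in>- {k}. ?E n k \<inter> ?E n k')"
    then have \<omega>: "\<omega> \<in> regular_config" "\<omega> \<in> space P" using regular_config_finite(1) by auto
    have "\<exists>p. max_nucleus \<rho> W (pts \<omega>) p" using sup_inradius_eq_iff[OF \<omega>(1), of UNIV] by simp
    moreover have "p = q" if pq: "max_nucleus \<rho> W (pts \<omega>) p" "max_nucleus \<rho> W (pts \<omega>) q" for p q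
    proof (rule ccontr)
      assume "p \<noteq> q"
      then have "dist p q > 0" by simp
      from eventually_happens'[OF sequentially_bot eventually_mesh[OF this]] obtain n where "1 / real (Suc n) < dist p q" by blast
      then have "mesh_label n q \<noteq> mesh_label n p" using dist_mesh_label[of n p q] by auto
      moreover have "\<omega> \<in> ?E n (mesh_label n z)" if "max_nucleus \<rho> W (pts \<omega>) z" for z
        using that \<omega>(2) sup_inradius_eq_iff[OF \<omega>(1), of "{p. mesh_label n p = mesh_label n z}"] by blast
      then have "\<omega> \<in> ?E n (mesh_label n p) \<inter> ?E n (mesh_label n q)" using pq by blast
      ultimately show False using a by blast
    qed
    ultimately show "\<omega> \<in> unique_max" using \<omega>(2) by (auto simp: unique_max_def)
  qed
  also have "\<dots> \<in> events"
    by (intro sets.Diff regular_config_events sets.countable_UN' image_subsetI sets.Int sup_eq_event nuclei_borel sets_mesh_label)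
      simp_all
  finally show ?thesis .
qed

text \<open>That the maximal nucleus lies in a Borel set \<open>D\<close> is an equation of suprema,
  so the nucleus is measurable on \<open>unique_max\<close>; the height is read off from
  \<open>sup_inradius nuclei\<close>.\<close>

lemma measurable_max_triple: "(\<lambda>\<omega>. max_triple \<gamma> s W \<rho> (pts \<omega>)) \<in> borel_measurable P"
proof -
  define pm where "pm \<omega> = (if \<omega> \<in> unique_max then THE p. max_nucleus \<rho> W (pts \<omega>) p else 0)" for \<omega>
  have the: "max_nucleus \<rho> W (pts \<omega>) (pm \<omega>)" "\<omega> \<in> regular_config" if "\<omega> \<in> unique_max" for \<omega>
    using that not_regular_config theI'[of "max_nucleus \<rho> W (pts \<omega>)"] unfolding pm_def unique_max_def by auto
  have uniq: "p = pm \<omega>" if "\<omega> \<in> unique_max" "max_nucleus \<rho> W (pts \<omega>) p" for \<omega> p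
    using that the(1)[OF that(1)] unfolding unique_max_def by auto
  have pm: "pm \<in> borel_measurable P"
  proof (rule measurableI)
    fix D :: "('a \<times> real) set" assume D: "D \<in> sets borel"
    have "pm -` D \<inter> space P = (unique_max \<inter> {\<omega>\<in>space P. sup_inradius (nuclei \<inter> D) \<omega> = sup_inradius nuclei \<omega>}) \<union>
       (if 0 \<in> D then space P - unique_max else {})"
    proof (rule set_eqI)
      fix \<omega>
      show "\<omega> \<in> pm -` D \<inter> space P \<longleftrightarrow> \<omega> \<in> (unique_max \<inter> {\<omega>\<in>space P. sup_inradius (nuclei \<inter> D) \<omega> = sup_inradius nuclei \<omega>}) \<union>
       (if 0 \<in> D then space P - unique_max else {})"
      proof (cases "\<omega> \<in> unique_max")
        case True
        then have "(\<exists>p\<in>D. max_nucleus \<rho> W (pts \<omega>) p) \<longleftrightarrow> pm \<omega> \<in> D" using the(1) uniq by blast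
        then show ?thesis using True sup_inradius_eq_iff[OF the(2)[OF True], of D] by (auto simp: unique_max_def)
      next
        case False
        then show ?thesis by (auto simp: pm_def)
      qed
    qed
    also have "\<dots> \<in> events" using unique_max_events sup_eq_event[of "nuclei \<inter> D" nuclei] nuclei_borel D by auto
    finally show "pm -` D \<inter> space P \<in> events" .
  qed auto
  have eq: "max_triple \<gamma> s W \<rho> (pts \<omega>) = (if \<omega> \<in> unique_max then ((1 / \<rho>) *\<^sub>R fst (pm \<omega>), snd (pm \<omega>),
      ball_const DIM('a) * \<gamma> * real_of_ereal (sup_inradius nuclei \<omega>) ^ DIM('a) - s \<rho>) else 0)" if "\<omega> \<in> space P" for \<omega>
  proof (cases "\<omega> \<in> unique_max")
    case True
    have m: "max_nucleus \<rho> W (pts \<omega>) (pm \<omega>)" by (rule the(1)[OF True])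
    then have "sup_inradius nuclei \<omega> = inradius (pm \<omega>) (pts \<omega>)"
      unfolding sup_inradius_def by (intro antisym SUP_least SUP_upper) (auto simp: max_nucleus_def)
    then show ?thesis using True by (auto simp: max_triple_def unique_max_def pm_def Let_def)
  next
    case False
    then show ?thesis using that by (simp add: max_triple_def unique_max_def)
  qed
  have proj: "fst \<in> borel_measurable (borel :: ('a \<times> real) measure)" "snd \<in> borel_measurable (borel :: ('a \<times> real) measure)"
    by (intro borel_measurable_continuous_onI continuous_intros)+
  note [measurable] = measurable_compose[OF pm proj(1)] measurable_compose[OF pm proj(2)]
    measurable_sup_inradius[OF nuclei_borel] unique_max_events
  have "(\<lambda>\<omega>. if \<omega> \<in> unique_max then ((1 / \<rho>) *\<^sub>R fst (pm \<omega>), snd (pm \<omega>),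
      ball_const DIM('a) * \<gamma> * real_of_ereal (sup_inradius nuclei \<omega>) ^ DIM('a) - s \<rho>) else 0) \<in> borel_measurable P"
    by (intro measurable_If_set borel_measurable_Pair) (auto simp: unique_max_events Int_absorb1)
  then show ?thesis by (subst measurable_cong[OF eq])
qed

end

end

subsection \<open>Exceedances over the shifted thresholds\<close>

lemma window_subset_borel:
  fixes B :: "'a::euclidean_space set"
  assumes B: "B \<in> sets borel" and \<rho>: "\<rho> > 0"
  shows "window \<rho> B \<in> sets borel" "measure lborel (window \<rho> B) = \<rho> ^ DIM('a) * measure lborel B"
proof -
  have "window \<rho> B = (\<lambda>x. (1 / \<rho>) *\<^sub>R x) -` B \<inter> space borel"
  proof (intro set_eqI iffI)
    fix x assume "x \<in> (\<lambda>x. (1 / \<rho>) *\<^sub>R x) -` B \<inter> space borel"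
    then have "(1 / \<rho>) *\<^sub>R x \<in> B" by simp
    moreover have "x = \<rho> *\<^sub>R ((1 / \<rho>) *\<^sub>R x)" using \<rho> by simp
    ultimately show "x \<in> window \<rho> B" unfolding window_def by blast
  qed (use \<rho> in \<open>auto simp: window_def\<close>)
  also have "\<dots> \<in> sets borel" by (rule measurable_sets[OF _ B]) measurable
  finally show b: "window \<rho> B \<in> sets borel" .
  have "window \<rho> B = (\<lambda>x. \<rho> *\<^sub>R x + 0) ` B" by (simp add: window_def)
  then have "measure lebesgue (window \<rho> B) = \<rho> ^ DIM('a) * measure lebesgue B"
    using measure_lebesgue_affine[of \<rho> 0 B] \<rho> by simp
  then show "measure lborel (window \<rho> B) = \<rho> ^ DIM('a) * measure lborel B"
    using b B by (simp add: measure_completion)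
qed

lemma inradius_power_iff:
  assumes "0 < d" "0 < \<tau>"
  shows "ereal \<tau> \<le> inradius p \<phi> ^ d \<longleftrightarrow> ereal (root d \<tau>) \<le> inradius p \<phi>"
proof (cases "inradius p \<phi>")
  case (real r)
  then have r: "r \<ge> 0" using inradius_nonneg[of p \<phi>] by simp
  have "\<tau> \<le> r ^ d \<longleftrightarrow> root d \<tau> \<le> root d (r ^ d)" using assms by simp
  then show ?thesis using real r assms by (simp add: real_root_power_cancel)
next
  case PInf
  then show ?thesis using assms by simp
next
  case MInf
  then show ?thesis using inradius_nonneg[of p \<phi>] by simp
qed

locale laguerre_shift = laguerre_process P \<eta> Q \<gamma> A
  for P :: "'w measure" and \<eta> :: "'w \<Rightarrow> ('a::euclidean_space \<times> real) measure" and Q \<gamma> A +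
  fixes W :: "'a set" and s :: "real \<Rightarrow> real"
  assumes dim: "DIM('a) \<ge> 2" and W: "compact W" "emeasure lborel W = 1"
    and top_mark: "\<And>\<epsilon>. 0 < \<epsilon> \<Longrightarrow> \<epsilon> < A \<Longrightarrow> measure Q {0..A - \<epsilon>} < 1"
    and shift: "correct_shift P \<eta> \<gamma> W A s"
begin

definition scale :: real where "scale = ball_const DIM('a) * \<gamma>"

lemma scale_pos: "scale > 0" using gamma by (simp add: scale_def ball_const_def)

definition thr :: "real \<Rightarrow> real \<Rightarrow> real" where "thr u \<rho> = (u + s \<rho>) / scale"

definition rad :: "real \<Rightarrow> real \<Rightarrow> real" where "rad u \<rho> = root DIM('a) (thr u \<rho>)"

definition \<pi> :: "real set \<Rightarrow> real" where "\<pi> C = measure (limit_mark_distr DIM('a) \<gamma> Q A) C"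

definition box :: "'a set \<Rightarrow> real set \<Rightarrow> real \<Rightarrow> ('a \<times> real) set" where
  "box B C \<rho> = window \<rho> B \<times> (C \<inter> {0..A})"

text \<open>For large \<open>R\<close> and \<open>B \<subseteq> W\<close>, the expected number of
  exceedances of radius \<open>R\<close> in \<open>box B C \<rho>\<close>
  (\<open>expectation_box\<close>), kept in factorised form so that quotients simplify.\<close>

definition mass :: "'a set \<Rightarrow> real set \<Rightarrow> real \<Rightarrow> real \<Rightarrow> real" where
  "mass B C R \<rho> = \<gamma> * \<rho> ^ DIM('a) * measure lborel B * marks_weight C R"

text \<open>An almost sure event. On it the points cannot distinguish restricted from unrestricted
  regions, nor \<open>window \<rho> W \<times> {0..}\<close> from
  \<open>box W UNIV \<rho>\<close>.\<close>

definition good :: "'w set" where "good = void (UNIV \<times> {A<..})"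

lemma W_borel: "W \<in> sets borel" using W by (simp add: borel_compact)

lemma W_measure: "measure lborel W = 1" using W by (simp add: measure_def)

lemma good_prob: "good \<in> events" "prob good = 1"
proof -
  have b: "UNIV \<times> {A<..} \<in> sets (borel :: ('a \<times> real) measure)" by (intro borel_open open_Times) auto
  have "Q.prob {A<..} = 0"
  proof -
    have "AE x in Q. x \<notin> {A<..}" using AE_marks by eventually_elim auto
    then show ?thesis using Q(2) Q.prob_eq_0[of "{A<..}"] by simp
  qed
  then have "emeasure intensity (UNIV \<times> {A<..}) = 0"
    by (simp add: intensity_Times Q.emeasure_eq_measure)
  then show "prob good = 1" unfolding good_def using prob_void[OF b] by (simp add: measure_def)
  show "good \<in> events" unfolding good_def using b by (rule void_events)
qed

lemma good_pts:
  assumes "\<omega> \<in> good"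
  shows "\<omega> \<in> space P" "pts \<omega> \<subseteq> UNIV \<times> {0..A}"
proof -
  show \<omega>: "\<omega> \<in> space P" using assms by (simp add: good_def void_def)
  have "pts \<omega> \<inter> UNIV \<times> {A<..} = {}" using assms by (simp add: good_def void_def)
  then show "pts \<omega> \<subseteq> UNIV \<times> {0..A}" using pts_subset[OF \<omega>] by (force simp: disjoint_iff)
qed

lemma exceed_good:
  assumes \<omega>: "\<omega> \<in> good" and p: "0 < T p"
  shows "p \<in> exceed T (pts \<omega>) \<longleftrightarrow> p \<in> pts \<omega> \<and> ereal (T p) \<le> inradius p (pts \<omega>)"
proof -
  have "\<And>q. q \<in> pts \<omega> \<Longrightarrow> -1 < snd q \<and> snd q < A + 1" using good_pts(2)[OF \<omega>] by fastforce
  then have "pts \<omega> \<inter> reg (T p) p = {} \<longleftrightarrow> (\<forall>q\<in>pts \<omega>. 0 \<le> gap (T p) p q)"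
    using reg_iff[of _ "T p" p] not_less by blast
  moreover have "p \<in> exceed T (pts \<omega>) \<longleftrightarrow> p \<in> pts \<omega> \<and> pts \<omega> \<inter> reg (T p) p = {}"
    unfolding exceed_def by (rule mem_Collect_eq)
  ultimately show ?thesis using inradius_ge_iff[OF p, of p "pts \<omega>"] by blast
qed

lemma box_borel: "B \<in> sets borel \<Longrightarrow> C \<in> sets borel \<Longrightarrow> \<rho> > 0 \<Longrightarrow> box B C \<rho> \<in> sets borel"
  unfolding box_def
  by (intro borel_Times window_subset_borel) auto

lemma box_mono: "B \<subseteq> B' \<Longrightarrow> C \<subseteq> C' \<Longrightarrow> box B C \<rho> \<subseteq> box B' C' \<rho>"
  unfolding box_def window_def by blast

lemma bounded_window: "B \<subseteq> W \<Longrightarrow> bounded (window \<rho> B)"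
  unfolding window_def using compact_imp_bounded[OF W(1)] bounded_subset by (intro bounded_scaling) blast

lemma box_bounded: "B \<subseteq> W \<Longrightarrow> bounded (box B C \<rho>)"
  unfolding box_def by (rule bounded_subset[OF bounded_Times[OF bounded_window bounded_closed_interval[of 0 A]]])
    auto

lemma simple_box:
  assumes "D \<in> sets borel" "D \<subseteq> box W UNIV \<rho>" "T \<in> borel_measurable borel" "finite (range T)"
  shows "simple_threshold T D"
  unfolding simple_threshold_def
  using assms bounded_subset[OF box_bounded[OF order_refl] assms(2)] finite_subset[of "T ` D" "range T"] by blast

lemma box_marks: "D \<subseteq> box W UNIV \<rho> \<Longrightarrow> D \<subseteq> UNIV \<times> {0..A}"
  unfolding box_def by auto

lemma mean_box:
  assumes B: "B \<in> sets borel" "B \<subseteq> W" and C: "C \<in> sets borel" and R: "2 * (A + 1) \<le> R" and \<rho>: "\<rho> > 0"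
  shows "intensity_exceed (\<lambda>_. R) (box B C \<rho>) = mass B C R \<rho>"
proof -
  have "bounded (window \<rho> B)" by (rule bounded_window[OF B(2)])
  then have f: "emeasure lborel (window \<rho> B) < \<infinity>" by (rule emeasure_bounded_finite)
  have "marks_weight (C \<inter> {0..A}) R = marks_weight C R" by (simp add: marks_weight_def Int_assoc)
  then show ?thesis
    unfolding box_def mass_def using R A C
    by (subst intensity_exceed_Times[OF _ window_subset_borel(1)[OF B(1) \<rho>] f])
      (auto simp: window_subset_borel(2)[OF B(1) \<rho>])
qed

lemma const_admissible:
  assumes "D \<in> sets borel" "D \<subseteq> box W UNIV \<rho>" "2 * (A + 1) \<le> R"
  shows "admissible (\<lambda>_. R) D"
  using A assms(3)
  by (intro admissible_window[of _ _ R] simple_box[OF assms(1,2)] box_marks[OF assms(2)] assms(3)) auto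

lemma expectation_box:
  assumes B: "B \<in> sets borel" "B \<subseteq> W" and C: "C \<in> sets borel" and R: "2 * (A + 1) \<le> R" and \<rho>: "\<rho> > 0"
  shows "integrable P (\<lambda>\<omega>. real (number (\<lambda>_. R) (box B C \<rho>) \<omega>))"
    "expectation (\<lambda>\<omega>. real (number (\<lambda>_. R) (box B C \<rho>) \<omega>)) = mass B C R \<rho>"
proof -
  have "admissible (\<lambda>_. R) (box B C \<rho>)"
    by (rule const_admissible[OF box_borel[OF B(1) C \<rho>] box_mono[OF B(2)] R]) auto
  from number_expectation[OF this] show "integrable P (\<lambda>\<omega>. real (number (\<lambda>_. R) (box B C \<rho>) \<omega>))"
    "expectation (\<lambda>\<omega>. real (number (\<lambda>_. R) (box B C \<rho>) \<omega>)) = mass B C R \<rho>"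
    using mean_box[OF B C R \<rho>] by simp_all
qed

section \<open>Consequences of the correct shift\<close>

definition shift_integral :: "real \<Rightarrow> real \<Rightarrow> ennreal" where
  "shift_integral u \<rho> = (\<integral>\<^sup>+\<omega>. (\<integral>\<^sup>+p. indicator {q. inradius q (pts \<omega>) ^ DIM('a) \<ge> ereal ((u + s \<rho>) / (ball_const DIM('a) * \<gamma>))} p
    \<partial>count_space (pts \<omega> \<inter> window \<rho> W \<times> {0..A})) \<partial>P)"

lemma shift_integral_tendsto: "(shift_integral u \<longlongrightarrow> ennreal (exp (- u))) at_top"
  using shift unfolding correct_shift_def shift_integral_def[abs_def] by blast

lemma AE_good: "AE \<omega> in P. \<omega> \<in> good"
  using prob_eq_1[OF good_prob(1)] good_prob(2) by simp

lemma finite_pts_box: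
  assumes "\<omega> \<in> space P" "\<rho> > 0"
  shows "finite (pts \<omega> \<inter> box W UNIV \<rho>)"
  by (intro points_Int(1) assms box_borel W_borel box_bounded) auto

lemma inner_integral:
  assumes \<omega>: "\<omega> \<in> space P" and \<rho>: "\<rho> > 0"
  shows "(\<integral>\<^sup>+p. indicator S p \<partial>count_space (pts \<omega> \<inter> window \<rho> W \<times> {0..A})) = of_nat (card (pts \<omega> \<inter> box W UNIV \<rho> \<inter> S))"
proof -
  let ?X = "pts \<omega> \<inter> window \<rho> W \<times> {0..A}"
  have X: "?X = pts \<omega> \<inter> box W UNIV \<rho>" by (simp add: box_def)
  have "(\<integral>\<^sup>+p. indicator S p \<partial>count_space ?X) = (\<integral>\<^sup>+p. indicator (?X \<inter> S) p \<partial>count_space ?X)"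
    by (intro nn_integral_cong) (auto simp: indicator_def)
  also have "\<dots> = emeasure (count_space ?X) (?X \<inter> S)" by (intro nn_integral_indicator) auto
  also have "\<dots> = of_nat (card (?X \<inter> S))"
    using finite_pts_box[OF \<omega> \<rho>] unfolding X by (intro emeasure_count_space_finite) auto
  finally show ?thesis unfolding X .
qed

lemma nn_number_box:
  assumes R: "2 * (A + 1) \<le> R" and \<rho>: "\<rho> > 0"
  shows "(\<integral>\<^sup>+\<omega>. of_nat (number (\<lambda>_. R) (box W UNIV \<rho>) \<omega>) \<partial>P) = ennreal (mass W UNIV R \<rho>)"
proof -
  have "(\<integral>\<^sup>+\<omega>. of_nat (number (\<lambda>_. R) (box W UNIV \<rho>) \<omega>) \<partial>P) = (\<integral>\<^sup>+\<omega>. ennreal (real (number (\<lambda>_. R) (box W UNIV \<rho>) \<omega>)) \<partial>P)"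
    by (simp add: ennreal_of_nat_eq_real_of_nat)
  also have "\<dots> = ennreal (mass W UNIV R \<rho>)"
    using expectation_box[OF W_borel order_refl _ R \<rho>, of UNIV]
    by (subst nn_integral_eq_integral) auto
  finally show ?thesis .
qed

text \<open>Works with an arbitrary radius above the threshold and any sign of
  \<open>thr u \<rho>\<close>, because it is applied when nothing is yet known about the size of the
  shift.\<close>

lemma shift_integral_ge:
  assumes R: "2 * (A + 1) \<le> R" and \<rho>: "\<rho> > 0" and thr: "thr u \<rho> \<le> R ^ DIM('a)"
  shows "ennreal (mass W UNIV R \<rho>) \<le> shift_integral u \<rho>"
  unfolding nn_number_box[OF R \<rho>, symmetric] shift_integral_def
proof (intro nn_integral_mono_AE, use AE_good in eventually_elim)
  case (elim \<omega>)
  have R0: "R > 0" using R A by simp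
  let ?S = "{q. inradius q (pts \<omega>) ^ DIM('a) \<ge> ereal ((u + s \<rho>) / (ball_const DIM('a) * \<gamma>))}"
  have "exceed (\<lambda>_. R) (pts \<omega>) \<inter> box W UNIV \<rho> \<subseteq> pts \<omega> \<inter> box W UNIV \<rho> \<inter> ?S"
  proof
    fix p assume p: "p \<in> exceed (\<lambda>_. R) (pts \<omega>) \<inter> box W UNIV \<rho>"
    then have "p \<in> pts \<omega>" "ereal R \<le> inradius p (pts \<omega>)" using exceed_good[OF elim, of "\<lambda>_. R" p] R0 by auto
    moreover have "root DIM('a) (R ^ DIM('a)) = R" using R0 by (simp add: real_root_power_cancel)
    ultimately have "ereal (R ^ DIM('a)) \<le> inradius p (pts \<omega>) ^ DIM('a)"
      using R0 by (subst inradius_power_iff) auto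
    moreover have "ereal ((u + s \<rho>) / (ball_const DIM('a) * \<gamma>)) \<le> ereal (R ^ DIM('a))"
      using thr by (simp add: thr_def scale_def)
    ultimately have "ereal ((u + s \<rho>) / (ball_const DIM('a) * \<gamma>)) \<le> inradius p (pts \<omega>) ^ DIM('a)" by (rule order_trans[rotated])
    then show "p \<in> pts \<omega> \<inter> box W UNIV \<rho> \<inter> ?S" using p \<open>p \<in> pts \<omega>\<close> by blast
  qed
  then have "number (\<lambda>_. R) (box W UNIV \<rho>) \<omega> \<le> card (pts \<omega> \<inter> box W UNIV \<rho> \<inter> ?S)"
    using finite_pts_box[OF good_pts(1)[OF elim] \<rho>] by (intro card_mono) auto
  then show ?case unfolding inner_integral[OF good_pts(1)[OF elim] \<rho>] by (intro of_nat_mono)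
qed

lemma shift_integral_eq:
  assumes R: "2 * (A + 1) \<le> rad u \<rho>" and \<rho>: "\<rho> > 0" and thr: "0 < thr u \<rho>"
  shows "shift_integral u \<rho> = ennreal (mass W UNIV (rad u \<rho>) \<rho>)"
  unfolding nn_number_box[OF R \<rho>, symmetric] shift_integral_def
proof (intro nn_integral_cong_AE, use AE_good in eventually_elim)
  case (elim \<omega>)
  let ?S = "{q. inradius q (pts \<omega>) ^ DIM('a) \<ge> ereal ((u + s \<rho>) / (ball_const DIM('a) * \<gamma>))}"
  have R0: "rad u \<rho> > 0" using R A by simp
  have "exceed (\<lambda>_. rad u \<rho>) (pts \<omega>) \<inter> box W UNIV \<rho> = pts \<omega> \<inter> box W UNIV \<rho> \<inter> ?S"
  proof (rule set_eqI)
    fix p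
    have "p \<in> ?S \<longleftrightarrow> ereal (rad u \<rho>) \<le> inradius p (pts \<omega>)"
      using inradius_power_iff[OF _ thr, of "DIM('a)" p "pts \<omega>"] by (simp add: rad_def thr_def scale_def)
    then show "p \<in> exceed (\<lambda>_. rad u \<rho>) (pts \<omega>) \<inter> box W UNIV \<rho> \<longleftrightarrow> p \<in> pts \<omega> \<inter> box W UNIV \<rho> \<inter> ?S"
      using exceed_good[OF elim, of "\<lambda>_. rad u \<rho>" p, OF R0] by blast
  qed
  then show ?case unfolding inner_integral[OF good_pts(1)[OF elim] \<rho>] by simp
qed

text \<open>If the threshold were at most \<open>R ^ d\<close> for arbitrarily large
  \<open>\<rho>\<close>, the mean would be at least \<open>mass W UNIV R \<rho>\<close> there, which
  grows like \<open>\<rho> ^ d\<close>, against its limit \<open>exp (- u)\<close>.\<close>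

lemma thr_at_top: "filterlim (thr u) at_top at_top"
  unfolding filterlim_at_top
proof
  fix Z
  \<comment> \<open>At least one, so that \<open>Z \<le> R \<le> R ^ d\<close>.\<close>
  define R where "R = max (2 * (A + 1)) (max 1 Z)"
  have R: "2 * (A + 1) \<le> R" "1 \<le> R" "Z \<le> R" by (auto simp: R_def)
  have w: "marks_weight UNIV R > 0" using R A by (intro marks_weight_pos) auto
  have "filterlim (\<lambda>\<rho>. (\<gamma> * marks_weight UNIV R) * \<rho> ^ DIM('a)) at_top at_top"
    using w gamma DIM_positive[where 'a='a]
    by (intro filterlim_tendsto_pos_mult_at_top[OF tendsto_const] filterlim_pow_at_top filterlim_ident) auto
  then have 1: "eventually (\<lambda>\<rho>. exp (- u) + 1 \<le> (\<gamma> * marks_weight UNIV R) * \<rho> ^ DIM('a)) at_top"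
    by (simp add: filterlim_at_top)
  have 2: "eventually (\<lambda>\<rho>. shift_integral u \<rho> < ennreal (exp (- u) + 1)) at_top"
    by (intro order_tendstoD(2)[OF shift_integral_tendsto]) (simp add: ennreal_less_iff)
  show "eventually (\<lambda>\<rho>. Z \<le> thr u \<rho>) at_top"
    using 1 2 eventually_gt_at_top[of 0]
  proof eventually_elim
    case (elim \<rho>)
    have "\<not> thr u \<rho> \<le> R ^ DIM('a)"
    proof
      assume "thr u \<rho> \<le> R ^ DIM('a)"
      then have "ennreal (mass W UNIV R \<rho>) \<le> shift_integral u \<rho>" by (rule shift_integral_ge[OF R(1) elim(3)])
      moreover have "ennreal (exp (- u) + 1) \<le> ennreal (mass W UNIV R \<rho>)"
        using elim(1) by (intro ennreal_leI) (simp add: mass_def W_measure mult_ac)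
      ultimately show False using elim(2) by (meson leD order_trans)
    qed
    moreover have "R \<le> R ^ DIM('a)" using R(2) DIM_positive[where 'a='a] by (intro self_le_power) auto
    ultimately show ?case using R(3) by linarith
  qed
qed

lemma rad_power: "0 < thr u \<rho> \<Longrightarrow> rad u \<rho> ^ DIM('a) = thr u \<rho>"
  unfolding rad_def by (simp add: real_root_pow_pos2)

lemma rad_at_top: "filterlim (rad u) at_top at_top"
  unfolding filterlim_at_top
proof
  fix Z :: real
  have "eventually (\<lambda>\<rho>. (max 1 Z) ^ DIM('a) \<le> thr u \<rho>) at_top"
    using thr_at_top[of u] by (simp add: filterlim_at_top)
  then show "eventually (\<lambda>\<rho>. Z \<le> rad u \<rho>) at_top"
  proof eventually_elim
    case (elim \<rho>)
    have "max 1 Z = root DIM('a) ((max 1 Z) ^ DIM('a))" by (simp add: real_root_power_cancel)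
    also have "\<dots> \<le> rad u \<rho>" unfolding rad_def using elim by (intro real_root_le_mono) auto
    finally show ?case by simp
  qed
qed

lemma mass_total: "((\<lambda>\<rho>. mass W UNIV (rad u \<rho>) \<rho>) \<longlongrightarrow> exp (- u)) at_top"
proof -
  have "eventually (\<lambda>\<rho>. shift_integral u \<rho> = ennreal (mass W UNIV (rad u \<rho>) \<rho>)) at_top"
    using eventually_gt_at_top[of 0] filterlim_at_top[THEN iffD1, OF rad_at_top[of u], rule_format, of "2 * (A + 1)"]
      filterlim_at_top_dense[THEN iffD1, OF thr_at_top[of u], rule_format, of 0]
    by eventually_elim (rule shift_integral_eq)
  then have "((\<lambda>\<rho>. ennreal (mass W UNIV (rad u \<rho>) \<rho>)) \<longlongrightarrow> ennreal (exp (- u))) at_top"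
    using shift_integral_tendsto[of u] by (rule Lim_transform_eventually[rotated])
  moreover have "eventually (\<lambda>\<rho>. 0 \<le> mass W UNIV (rad u \<rho>) \<rho>) at_top"
    using eventually_gt_at_top[of 0] by eventually_elim (use gamma in \<open>simp add: mass_def marks_weight_nonneg\<close>)
  ultimately show ?thesis by (simp add: tendsto_ennreal_iff)
qed

text \<open>The mean of a box is its volume times a ratio of mark weights times the mean of the
  whole window. The ratio is evaluated at diverging radii, and the limit of the last factor is the
  one prescribed by the shift.\<close>

lemma mass_tendsto:
  assumes B: "B \<subseteq> W" and C: "((\<lambda>R. marks_weight C R / marks_weight UNIV R) \<longlongrightarrow> \<pi> C) at_top"
  shows "((\<lambda>\<rho>. mass B C (rad u \<rho>) \<rho>) \<longlongrightarrow> measure lborel B * \<pi> C * exp (- u)) at_top"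
proof -
  have "((\<lambda>\<rho>. measure lborel B * (marks_weight C (rad u \<rho>) / marks_weight UNIV (rad u \<rho>)) * mass W UNIV (rad u \<rho>) \<rho>)
     \<longlongrightarrow> measure lborel B * \<pi> C * exp (- u)) at_top"
    by (intro tendsto_intros mass_total filterlim_compose[OF C rad_at_top])
  moreover have "eventually (\<lambda>\<rho>. measure lborel B * (marks_weight C (rad u \<rho>) / marks_weight UNIV (rad u \<rho>)) * mass W UNIV (rad u \<rho>) \<rho>
     = mass B C (rad u \<rho>) \<rho>) at_top"
    using filterlim_at_top_dense[THEN iffD1, OF rad_at_top[of u], rule_format, of A]
  proof eventually_elim
    case (elim \<rho>)
    then show ?case using marks_weight_pos[OF elim] by (simp add: mass_def W_measure)
  qed
  ultimately show ?thesis by (rule Lim_transform_eventually)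
qed

text \<open>With \<open>x = k * thr a \<rho>\<close>, which is the exponent in the error, the factor
  after \<open>I \<rho>\<close> is \<open>2 * 36 ^ d * x * exp (- x)\<close>. The number 36 is the
  ratio of the radii \<open>9 * R\<close> and \<open>R / 4\<close>.\<close>

lemma void_error_tendsto:
  assumes I: "(I \<longlongrightarrow> (l::real)) at_top"
  shows "((\<lambda>\<rho>. I \<rho> * (2 * exp (- (\<gamma> * unit_ball_vol (real DIM('a)) * (rad a \<rho> / 4) ^ DIM('a))) * (\<gamma> * unit_ball_vol (real DIM('a)) * (9 * rad a \<rho>) ^ DIM('a)))) \<longlongrightarrow> 0) at_top"
proof -
  define k where "k = \<gamma> * unit_ball_vol (real DIM('a)) / 4 ^ DIM('a)"
  have k: "k > 0" using gamma by (simp add: k_def)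
  have x: "filterlim (\<lambda>\<rho>. k * thr a \<rho>) at_top at_top"
    by (rule filterlim_tendsto_pos_mult_at_top[OF tendsto_const k thr_at_top])
  have "((\<lambda>x::real. x ^ 1 / exp x) \<longlongrightarrow> 0) at_top" by (rule tendsto_power_div_exp_0)
  then have "((\<lambda>\<rho>. (k * thr a \<rho>) ^ 1 / exp (k * thr a \<rho>)) \<longlongrightarrow> 0) at_top" by (rule filterlim_compose[OF _ x])
  then have "((\<lambda>\<rho>. I \<rho> * (2 * 36 ^ DIM('a) * ((k * thr a \<rho>) ^ 1 / exp (k * thr a \<rho>)))) \<longlongrightarrow> l * (2 * 36 ^ DIM('a) * 0)) at_top"
    by (intro tendsto_intros I)
  then have "((\<lambda>\<rho>. I \<rho> * (2 * 36 ^ DIM('a) * ((k * thr a \<rho>) ^ 1 / exp (k * thr a \<rho>)))) \<longlongrightarrow> 0) at_top" by simp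
  moreover have "eventually (\<lambda>\<rho>. I \<rho> * (2 * 36 ^ DIM('a) * ((k * thr a \<rho>) ^ 1 / exp (k * thr a \<rho>))) =
    I \<rho> * (2 * exp (- (\<gamma> * unit_ball_vol (real DIM('a)) * (rad a \<rho> / 4) ^ DIM('a))) * (\<gamma> * unit_ball_vol (real DIM('a)) * (9 * rad a \<rho>) ^ DIM('a)))) at_top"
    using filterlim_at_top_dense[THEN iffD1, OF thr_at_top[of a], rule_format, of 0]
  proof eventually_elim
    case (elim \<rho>)
    have "(36::real) ^ DIM('a) = 9 ^ DIM('a) * 4 ^ DIM('a)" by (simp flip: power_mult_distrib)
    then show ?case
      unfolding power_divide power_mult_distrib rad_power[OF elim] k_def exp_minus by (simp add: field_simps)
  qed
  ultimately show ?thesis by (rule Lim_transform_eventually)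
qed

lemma void_tendsto:
  assumes T: "eventually (\<lambda>\<rho>. simple_threshold (T \<rho>) (D \<rho>) \<and> D \<rho> \<subseteq> UNIV \<times> {0..A} \<and>
      (\<forall>p\<in>D \<rho>. rad a \<rho> \<le> T \<rho> p \<and> T \<rho> p \<le> 9/8 * rad a \<rho>)) at_top"
    and I: "((\<lambda>\<rho>. intensity_exceed (T \<rho>) (D \<rho>)) \<longlongrightarrow> l) at_top"
  shows "((\<lambda>\<rho>. prob {\<omega>\<in>space P. number (T \<rho>) (D \<rho>) \<omega> = 0}) \<longlongrightarrow> exp (- l)) at_top"
proof -
  have "((\<lambda>\<rho>. prob {\<omega>\<in>space P. number (T \<rho>) (D \<rho>) \<omega> = 0} - exp (- intensity_exceed (T \<rho>) (D \<rho>))) \<longlongrightarrow> 0) at_top"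
  proof (rule Lim_null_comparison[OF _ void_error_tendsto[OF I, of a]])
    show "eventually (\<lambda>\<rho>. norm (prob {\<omega>\<in>space P. number (T \<rho>) (D \<rho>) \<omega> = 0} - exp (- intensity_exceed (T \<rho>) (D \<rho>))) \<le>
      intensity_exceed (T \<rho>) (D \<rho>) * (2 * exp (- (\<gamma> * unit_ball_vol (real DIM('a)) * (rad a \<rho> / 4) ^ DIM('a))) * (\<gamma> * unit_ball_vol (real DIM('a)) * (9 * rad a \<rho>) ^ DIM('a)))) at_top"
      using T filterlim_at_top[THEN iffD1, OF rad_at_top[of a], rule_format, of "2 * (A + 1)"]
      by eventually_elim (unfold real_norm_def, rule void_approximation, auto)
  qed
  moreover have "((\<lambda>\<rho>. exp (- intensity_exceed (T \<rho>) (D \<rho>))) \<longlongrightarrow> exp (- l)) at_top"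
    by (intro tendsto_intros I)
  ultimately have "((\<lambda>\<rho>. (prob {\<omega>\<in>space P. number (T \<rho>) (D \<rho>) \<omega> = 0} - exp (- intensity_exceed (T \<rho>) (D \<rho>)))
      + exp (- intensity_exceed (T \<rho>) (D \<rho>))) \<longlongrightarrow> 0 + exp (- l)) at_top"
    by (rule tendsto_add)
  then show ?thesis by simp
qed

subsection \<open>The maximum falls into a given box\<close>

text \<open>Joins the requirements inside and outside the box into one threshold function, so that
  the void approximation applies directly to their joint probability.\<close>

definition two_level :: "'a set \<Rightarrow> real set \<Rightarrow> real \<Rightarrow> real \<Rightarrow> real \<Rightarrow> 'a \<times> real \<Rightarrow> real" where
  "two_level B C a b \<rho> p = (if p \<in> box B C \<rho> then rad b \<rho> else rad a \<rho>)"

lemma exceed_iff: "p \<in> exceed T \<phi> \<longleftrightarrow> p \<in> \<phi> \<and> \<phi> \<inter> reg (T p) p = {}"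
  unfolding exceed_def by (rule mem_Collect_eq)

lemma exceed_cong: "T p = T' p \<Longrightarrow> p \<in> exceed T \<phi> \<longleftrightarrow> p \<in> exceed T' \<phi>"
  by (simp only: exceed_iff)

lemma finite_exceed_box:
  assumes "\<omega> \<in> space P" "\<rho> > 0" "D \<subseteq> box W UNIV \<rho>"
  shows "finite (exceed T (pts \<omega>) \<inter> D)"
  by (rule finite_subset[OF _ finite_pts_box[OF assms(1,2)]]) (use assms(3) exceed_iff in blast)

lemma number_split:
  assumes \<omega>: "\<omega> \<in> space P" and \<rho>: "\<rho> > 0" and D: "D \<subseteq> box W UNIV \<rho>" "D' \<subseteq> D"
  shows "number T D \<omega> = number T D' \<omega> + number T (D - D') \<omega>"
proof -
  have "exceed T (pts \<omega>) \<inter> D = (exceed T (pts \<omega>) \<inter> D') \<union> (exceed T (pts \<omega>) \<inter> (D - D'))" using D(2) by blast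
  then show ?thesis
    using D by (simp only:) (intro card_Un_disjoint finite_exceed_box[OF \<omega> \<rho>], auto)
qed

lemma number_cong:
  assumes "\<And>p. p \<in> D \<Longrightarrow> T p = T' p"
  shows "number T D \<omega> = number T' D \<omega>"
proof -
  have "exceed T (pts \<omega>) \<inter> D = exceed T' (pts \<omega>) \<inter> D" using exceed_cong assms by blast
  then show ?thesis by simp
qed

text \<open>The thresholds \<open>thr a\<close> and \<open>thr b\<close> differ by a constant while
  both diverge, so their roots eventually fit into the band of ratio 9/8 allowed by the void
  approximation.\<close>

lemma eventually_radii:
  assumes ab: "a < b"
  shows "eventually (\<lambda>\<rho>. \<rho> > 0 \<and> 2 * (A + 1) \<le> rad a \<rho> \<and> 0 < thr a \<rho> \<and> rad a \<rho> \<le> rad b \<rho> \<and> rad b \<rho> \<le> 9/8 * rad a \<rho>) at_top"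
  using eventually_gt_at_top[of 0] filterlim_at_top[THEN iffD1, OF rad_at_top[of a], rule_format, of "2 * (A + 1)"]
    filterlim_at_top[THEN iffD1, OF thr_at_top[of a], rule_format, of "max 1 (8 * ((b - a) / scale))"]
proof eventually_elim
  case (elim \<rho>)
  have t: "thr b \<rho> = thr a \<rho> + (b - a) / scale" by (simp add: thr_def diff_divide_distrib add_divide_distrib)
  have t1: "1 \<le> thr a \<rho>" "8 * ((b - a) / scale) \<le> thr a \<rho>" using elim(3) by (simp_all only: max.bounded_iff)
  have "0 < (b - a) / scale" using ab scale_pos by simp
  then have t0: "0 < thr a \<rho>" "thr a \<rho> \<le> thr b \<rho>" using t t1 by linarith+
  have "thr b \<rho> \<le> 9/8 * thr a \<rho>" using t1(2) t by linarith
  also have "\<dots> \<le> (9/8) ^ DIM('a) * thr a \<rho>"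
    using t0 self_le_power[of "9/8 :: real" "DIM('a)"] DIM_positive[where 'a='a] by (intro mult_right_mono) auto
  finally have "rad b \<rho> \<le> root DIM('a) ((9/8) ^ DIM('a) * thr a \<rho>)" unfolding rad_def by (intro real_root_le_mono) auto
  also have "\<dots> = 9/8 * rad a \<rho>" unfolding rad_def by (simp add: real_root_mult real_root_power_cancel)
  finally have "rad b \<rho> \<le> 9/8 * rad a \<rho>" .
  moreover have "rad a \<rho> \<le> rad b \<rho>" unfolding rad_def using t0 by (intro real_root_le_mono) auto
  ultimately show ?case using elim t0 by auto
qed

lemma range_two_level: "finite (range (two_level B C a b \<rho>))"
  by (rule finite_subset[of _ "{rad a \<rho>, rad b \<rho>}"]) (auto simp: two_level_def)

lemma measurable_two_level:
  assumes "B \<in> sets borel" "C \<in> sets borel" "\<rho> > 0"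
  shows "two_level B C a b \<rho> \<in> borel_measurable borel"
  unfolding two_level_def[abs_def] using box_borel[OF assms] by (intro measurable_If_set) auto

text \<open>Computed through expectations: the count splits over the box and its complement, and on
  each part the threshold is constant, so that all terms come from
  \<open>expectation_box\<close>.\<close>

lemma intensity_two_level:
  assumes B: "B \<in> sets borel" "B \<subseteq> W" and C: "C \<in> sets borel"
    and R: "\<rho> > 0" "2 * (A + 1) \<le> rad a \<rho>" "rad a \<rho> \<le> rad b \<rho>" "rad b \<rho> \<le> 9/8 * rad a \<rho>"
  shows "intensity_exceed (two_level B C a b \<rho>) (box W UNIV \<rho>) = mass B C (rad b \<rho>) \<rho> + (mass W UNIV (rad a \<rho>) \<rho> - mass B C (rad a \<rho>) \<rho>)"
proof -
  let ?T = "two_level B C a b \<rho>" and ?D0 = "box W UNIV \<rho>" and ?D1 = "box B C \<rho>"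
  have R0: "0 < rad a \<rho>" using R(2) A by simp
  have sub: "?D1 \<subseteq> ?D0" by (rule box_mono[OF B(2)]) simp
  have D0: "?D0 \<in> sets borel" by (rule box_borel[OF W_borel _ R(1)]) simp
  have adm: "admissible ?T ?D0"
  proof (rule admissible_window[of _ _ "rad a \<rho>"])
    show "simple_threshold ?T ?D0"
      by (rule simple_box[OF D0 order_refl measurable_two_level[OF B(1) C R(1)] range_two_level])
    show "?D0 \<subseteq> UNIV \<times> {0..A}" by (rule box_marks[OF order_refl])
    show "rad a \<rho> \<le> ?T p \<and> ?T p \<le> 9/8 * rad a \<rho>" for p using R R0 by (simp add: two_level_def)
  qed (rule R(2))
  have eq: "real (number ?T ?D0 \<omega>) = real (number (\<lambda>_. rad b \<rho>) ?D1 \<omega>) +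
      (real (number (\<lambda>_. rad a \<rho>) ?D0 \<omega>) - real (number (\<lambda>_. rad a \<rho>) ?D1 \<omega>))" if \<omega>: "\<omega> \<in> space P" for \<omega>
  proof -
    have "number ?T ?D1 \<omega> = number (\<lambda>_. rad b \<rho>) ?D1 \<omega>" by (rule number_cong) (simp add: two_level_def)
    moreover have "number ?T (?D0 - ?D1) \<omega> = number (\<lambda>_. rad a \<rho>) (?D0 - ?D1) \<omega>" by (rule number_cong) (simp add: two_level_def)
    ultimately show ?thesis
      using number_split[OF \<omega> R(1) order_refl sub, of ?T] number_split[OF \<omega> R(1) order_refl sub, of "\<lambda>_. rad a \<rho>"] by simp
  qed
  have Rb: "2 * (A + 1) \<le> rad b \<rho>" using R by simp
  note e0 = expectation_box[OF W_borel order_refl _ R(2,1), of UNIV] and ea = expectation_box[OF B C R(2,1)]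
    and eb = expectation_box[OF B C Rb R(1)]
  have "intensity_exceed ?T ?D0 = expectation (\<lambda>\<omega>. real (number ?T ?D0 \<omega>))"
    by (rule number_expectation(2)[OF adm, symmetric])
  also have "\<dots> = expectation (\<lambda>\<omega>. real (number (\<lambda>_. rad b \<rho>) ?D1 \<omega>) +
      (real (number (\<lambda>_. rad a \<rho>) ?D0 \<omega>) - real (number (\<lambda>_. rad a \<rho>) ?D1 \<omega>)))"
    by (intro Bochner_Integration.integral_cong refl eq)
  also have "\<dots> = mass B C (rad b \<rho>) \<rho> + (mass W UNIV (rad a \<rho>) \<rho> - mass B C (rad a \<rho>) \<rho>)"
    using e0 ea eb by (subst Bochner_Integration.integral_add) auto
  finally show ?thesis .
qed

text \<open>The assumptions leave exactly one exceedance of level \<open>a\<close> in the window.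
  All other inradii are below \<open>rad a \<rho>\<close>, so the maximum is unique, and the
  two-level condition places it in the box with height below \<open>b\<close>.\<close>

lemma box_event:
  assumes \<omega>: "\<omega> \<in> good" and B: "B \<subseteq> W" and R: "\<rho> > 0" "0 < rad a \<rho>" "rad a \<rho> \<le> rad b \<rho>" "0 < thr a \<rho>" "a < b"
    and none: "number (two_level B C a b \<rho>) (box W UNIV \<rho>) \<omega> = 0"
    and some: "number (\<lambda>_. rad a \<rho>) (box W UNIV \<rho>) \<omega> \<noteq> 0"
    and one: "number (\<lambda>_. rad a \<rho>) (box B C \<rho>) \<omega> < 2"
  shows "max_triple \<gamma> s W \<rho> (pts \<omega>) \<in> B \<times> C \<times> {a..<b}"
proof -
  let ?\<phi> = "pts \<omega>"
  have sp: "\<omega> \<in> space P" by (rule good_pts(1)[OF \<omega>])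
  note fin = finite_exceed_box[OF sp R(1)]
  have ex: "p \<in> exceed (\<lambda>_. rad u \<rho>) ?\<phi> \<longleftrightarrow> p \<in> ?\<phi> \<and> ereal (rad u \<rho>) \<le> inradius p ?\<phi>" if "rad u \<rho> > 0" for p u
    using exceed_good[OF \<omega>, of "\<lambda>_. rad u \<rho>" p, OF that] by blast
  have sub: "box B C \<rho> \<subseteq> box W UNIV \<rho>" by (rule box_mono[OF B]) simp
  have no: "p \<notin> exceed (two_level B C a b \<rho>) ?\<phi>" if "p \<in> box W UNIV \<rho>" for p
    using none fin[OF order_refl] that unfolding card_eq_0_iff by blast
  obtain p where p: "p \<in> box W UNIV \<rho>" "p \<in> exceed (\<lambda>_. rad a \<rho>) ?\<phi>"
    using some card.empty by (metis Int_emptyI)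
  have in1: "q \<in> box B C \<rho>" if "q \<in> box W UNIV \<rho>" "q \<in> exceed (\<lambda>_. rad a \<rho>) ?\<phi>" for q
  proof (rule ccontr)
    assume "q \<notin> box B C \<rho>"
    then have "q \<in> exceed (two_level B C a b \<rho>) ?\<phi>"
      using that(2) exceed_cong[of "two_level B C a b \<rho>" q "\<lambda>_. rad a \<rho>" ?\<phi>] by (simp add: two_level_def)
    then show False using no that by blast
  qed
  have p1: "p \<in> box B C \<rho>" by (rule in1[OF p])
  have uniq: "q = p" if "q \<in> box W UNIV \<rho>" "q \<in> exceed (\<lambda>_. rad a \<rho>) ?\<phi>" for q
  proof (rule ccontr)
    assume "q \<noteq> p"
    then have "card {q, p} = 2" by simp
    moreover have "{q, p} \<subseteq> exceed (\<lambda>_. rad a \<rho>) ?\<phi> \<inter> box B C \<rho>" using in1[OF that] that p p1 by blast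
    ultimately have "2 \<le> number (\<lambda>_. rad a \<rho>) (box B C \<rho>) \<omega>"
      using card_mono[OF fin[OF sub]] by metis
    then show False using one by simp
  qed
  have nuc: "?\<phi> \<inter> window \<rho> W \<times> {0..} = ?\<phi> \<inter> box W UNIV \<rho>"
    using good_pts(2)[OF \<omega>] unfolding box_def by auto
  have pin: "p \<in> ?\<phi>" "ereal (rad a \<rho>) \<le> inradius p ?\<phi>" using p(2) ex[OF R(2)] by blast+
  have pm: "max_nucleus \<rho> W ?\<phi> p"
    unfolding max_nucleus_def nuc
  proof (intro conjI ballI)
    show "p \<in> ?\<phi> \<inter> box W UNIV \<rho>" using pin p by blast
    fix q assume q: "q \<in> ?\<phi> \<inter> box W UNIV \<rho>"
    show "inradius q ?\<phi> \<le> inradius p ?\<phi>"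
    proof (cases "q \<in> exceed (\<lambda>_. rad a \<rho>) ?\<phi>")
      case True then show ?thesis using uniq q by blast
    next
      case False
      then have "\<not> ereal (rad a \<rho>) \<le> inradius q ?\<phi>" using q ex[OF R(2)] by blast
      then show ?thesis using pin(2) by (meson le_cases order_trans)
    qed
  qed
  have pu: "q = p" if "max_nucleus \<rho> W ?\<phi> q" for q
  proof -
    have q: "q \<in> ?\<phi> \<inter> box W UNIV \<rho>" "inradius p ?\<phi> \<le> inradius q ?\<phi>"
      using that pin p unfolding max_nucleus_def nuc by blast+
    then show ?thesis using uniq pin(2) ex[OF R(2)] order_trans by blast
  qed
  have the: "(THE p. max_nucleus \<rho> W ?\<phi> p) = p" using pm pu by blast
  have ex1: "\<exists>!p. max_nucleus \<rho> W ?\<phi> p" using pm pu by blast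
  have "\<not> ereal (rad b \<rho>) \<le> inradius p ?\<phi>"
  proof
    assume "ereal (rad b \<rho>) \<le> inradius p ?\<phi>"
    then have "p \<in> exceed (\<lambda>_. rad b \<rho>) ?\<phi>" using ex[of b] pin R by simp
    then have "p \<in> exceed (two_level B C a b \<rho>) ?\<phi>"
      using exceed_cong[of "two_level B C a b \<rho>" p "\<lambda>_. rad b \<rho>" ?\<phi>] p1 by (simp add: two_level_def)
    then show False using no p by blast
  qed
  then obtain r where r: "inradius p ?\<phi> = ereal r" "rad a \<rho> \<le> r" "r < rad b \<rho>"
    using pin(2) by (cases "inradius p ?\<phi>") auto
  have tb: "thr b \<rho> > 0" using R scale_pos by (auto simp: thr_def divide_less_0_iff zero_less_divide_iff)
  have "thr a \<rho> \<le> r ^ DIM('a)" using r R power_mono[of "rad a \<rho>" r "DIM('a)"] by (simp add: rad_power)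
  then have h1: "a \<le> scale * r ^ DIM('a) - s \<rho>" using scale_pos by (simp add: thr_def field_simps)
  have "r ^ DIM('a) < thr b \<rho>"
    using r R power_strict_mono[of r "rad b \<rho>" "DIM('a)"] rad_power[OF tb] by simp
  then have h2: "scale * r ^ DIM('a) - s \<rho> < b" using scale_pos by (simp add: thr_def field_simps)
  obtain x where x: "x \<in> B" "fst p = \<rho> *\<^sub>R x" using p1 by (auto simp: box_def window_def)
  have "snd p \<in> C" using p1 by (auto simp: box_def)
  then show ?thesis
    unfolding max_triple_def using ex1 x h1 h2 r(1) R(1) by (simp add: the Let_def scale_def)
qed

lemma number_zero_event:
  assumes "admissible T D"
  shows "{\<omega>\<in>space P. number T D \<omega> = 0} \<in> events" "{\<omega>\<in>space P. 2 \<le> number T D \<omega>} \<in> events"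
proof -
  note [measurable] = measurable_number[OF admissible_simple[OF assms]]
  have "{\<omega>\<in>space P. number T D \<omega> = 0} = {\<omega>\<in>space P. real (number T D \<omega>) = 0}" by simp
  also have "\<dots> \<in> events" by measurable
  finally show "{\<omega>\<in>space P. number T D \<omega> = 0} \<in> events" .
  have "{\<omega>\<in>space P. 2 \<le> number T D \<omega>} = {\<omega>\<in>space P. 2 \<le> real (number T D \<omega>)}" by auto
  also have "\<dots> \<in> events" by measurable
  finally show "{\<omega>\<in>space P. 2 \<le> number T D \<omega>} \<in> events" .
qed

text \<open>With \<open>N\<close> the number of exceedances, the indicator of
  \<open>N \<ge> 2\<close> minus that of \<open>N = 0\<close> is at most \<open>N - 1\<close>;
  taking expectations leaves only the mean and a void probability.\<close>

lemma prob_number_ge_2: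
  assumes adm: "admissible T D"
  shows "prob {\<omega>\<in>space P. 2 \<le> number T D \<omega>} \<le> intensity_exceed T D - 1 + prob {\<omega>\<in>space P. number T D \<omega> = 0}"
proof -
  note ev = number_zero_event[OF adm]
  have "prob {\<omega>\<in>space P. 2 \<le> number T D \<omega>} - prob {\<omega>\<in>space P. number T D \<omega> = 0} =
     (\<integral>\<omega>. indicator {\<omega>\<in>space P. 2 \<le> number T D \<omega>} \<omega> - indicator {\<omega>\<in>space P. number T D \<omega> = 0} \<omega> \<partial>P)"
    using ev by (subst Bochner_Integration.integral_diff) (auto simp: emeasure_eq_measure Int_absorb1 Int_absorb2)
  also have "\<dots> \<le> (\<integral>\<omega>. real (number T D \<omega>) - 1 \<partial>P)"
  proof (rule integral_mono)
    show "integrable P (\<lambda>\<omega>. indicator {\<omega>\<in>space P. 2 \<le> number T D \<omega>} \<omega> - indicator {\<omega>\<in>space P. number T D \<omega> = 0} \<omega> :: real)"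
      using ev by (intro Bochner_Integration.integrable_diff integrable_real_indicator) (auto simp: emeasure_eq_measure)
    show "integrable P (\<lambda>\<omega>. real (number T D \<omega>) - 1)"
      using number_expectation(1)[OF adm] by (intro Bochner_Integration.integrable_diff) auto
    show "indicator {\<omega>\<in>space P. 2 \<le> number T D \<omega>} \<omega> - indicator {\<omega>\<in>space P. number T D \<omega> = 0} \<omega> \<le> real (number T D \<omega>) - 1"
      if "\<omega> \<in> space P" for \<omega>
      using that by (cases "number T D \<omega> = 0"; cases "number T D \<omega> = 1") (auto simp: indicator_def)
  qed
  also have "\<dots> = intensity_exceed T D - 1"
    using number_expectation[OF adm] prob_space by (subst Bochner_Integration.integral_diff) auto
  finally show ?thesis by simp
qed

text \<open>By \<open>box_event\<close>, the probability is at least that of no two-level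
  exceedance, minus that of no exceedance of level \<open>a\<close>, minus that of two in the box.
  With \<open>d = p * (exp (- a) - exp (- b))\<close> the first difference tends to
  \<open>exp (- exp (- a)) * (exp d - 1)\<close>, whose linear part is kept; the last term is of
  second order in \<open>p\<close>.\<close>

lemma box_lower:
  assumes B: "B \<in> sets borel" "B \<subseteq> W" and C: "C = {c1<..c2}" and ab: "a < b" and e: "e > 0"
  defines "p \<equiv> measure lborel B * \<pi> C"
  shows "eventually (\<lambda>\<rho>. exp (- exp (- a)) * (p * (exp (- a) - exp (- b))) - (p * exp (- a))\<^sup>2 / 2 - e
      \<le> prob {\<omega>\<in>space P. max_triple \<gamma> s W \<rho> (pts \<omega>) \<in> B \<times> C \<times> {a..<b}}) at_top"
proof -
  have Cb: "C \<in> sets borel" by (simp add: C)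
  have ratio: "((\<lambda>R. marks_weight C R / marks_weight UNIV R) \<longlongrightarrow> \<pi> C) at_top"
    unfolding C \<pi>_def by (rule marks_ratio[OF dim top_mark])
  let ?D0 = "box W UNIV" and ?D1 = "box B C" and ?T = "two_level B C a b"
  have mB: "((\<lambda>\<rho>. mass B C (rad u \<rho>) \<rho>) \<longlongrightarrow> p * exp (- u)) at_top" for u
    unfolding p_def by (rule mass_tendsto[OF B(2) ratio])
  note rr = eventually_radii[OF ab]
  have D0b: "?D0 \<rho> \<in> sets borel" if "\<rho> > 0" for \<rho> by (rule box_borel[OF W_borel _ that]) simp
  have D1b: "?D1 \<rho> \<in> sets borel" if "\<rho> > 0" for \<rho> by (rule box_borel[OF B(1) Cb that])
  have sub: "?D1 \<rho> \<subseteq> ?D0 \<rho>" for \<rho> by (rule box_mono[OF B(2)]) simp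
  have IT: "((\<lambda>\<rho>. intensity_exceed (?T \<rho>) (?D0 \<rho>)) \<longlongrightarrow> p * exp (- b) + (exp (- a) - p * exp (- a))) at_top"
  proof -
    have "((\<lambda>\<rho>. mass B C (rad b \<rho>) \<rho> + (mass W UNIV (rad a \<rho>) \<rho> - mass B C (rad a \<rho>) \<rho>))
      \<longlongrightarrow> p * exp (- b) + (exp (- a) - p * exp (- a))) at_top"
      by (intro tendsto_intros mB mass_total)
    moreover have "eventually (\<lambda>\<rho>. mass B C (rad b \<rho>) \<rho> + (mass W UNIV (rad a \<rho>) \<rho> - mass B C (rad a \<rho>) \<rho>) =
      intensity_exceed (?T \<rho>) (?D0 \<rho>)) at_top"
      using rr by eventually_elim (rule intensity_two_level[OF B Cb, symmetric], auto)
    ultimately show ?thesis by (rule Lim_transform_eventually)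
  qed
  have I0: "((\<lambda>\<rho>. intensity_exceed (\<lambda>_. rad a \<rho>) (?D0 \<rho>)) \<longlongrightarrow> exp (- a)) at_top"
  proof -
    have "eventually (\<lambda>\<rho>. mass W UNIV (rad a \<rho>) \<rho> = intensity_exceed (\<lambda>_. rad a \<rho>) (?D0 \<rho>)) at_top"
      using rr by eventually_elim (rule mean_box[OF W_borel order_refl, symmetric], auto)
    with mass_total show ?thesis by (rule Lim_transform_eventually)
  qed
  have I1: "((\<lambda>\<rho>. intensity_exceed (\<lambda>_. rad a \<rho>) (?D1 \<rho>)) \<longlongrightarrow> p * exp (- a)) at_top"
  proof -
    have "eventually (\<lambda>\<rho>. mass B C (rad a \<rho>) \<rho> = intensity_exceed (\<lambda>_. rad a \<rho>) (?D1 \<rho>)) at_top"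
      using rr by eventually_elim (rule mean_box[OF B Cb, symmetric], auto)
    with mB show ?thesis by (rule Lim_transform_eventually)
  qed
  have const: "eventually (\<lambda>\<rho>. simple_threshold (\<lambda>_. rad a \<rho>) (D \<rho>) \<and> D \<rho> \<subseteq> UNIV \<times> {0..A} \<and>
      (\<forall>p\<in>D \<rho>. rad a \<rho> \<le> rad a \<rho> \<and> rad a \<rho> \<le> 9/8 * rad a \<rho>)) at_top"
    if D: "\<And>\<rho>. \<rho> > 0 \<Longrightarrow> D \<rho> \<in> sets borel" "\<And>\<rho>. D \<rho> \<subseteq> ?D0 \<rho>" for D
    using rr
  proof eventually_elim
    case (elim \<rho>)
    have "simple_threshold (\<lambda>_. rad a \<rho>) (D \<rho>)" using elim by (intro simple_box[OF D(1) D(2)]) auto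
    moreover have "rad a \<rho> \<le> 9/8 * rad a \<rho>" using elim A by simp
    ultimately show ?case using box_marks[OF D(2)] by simp
  qed
  have V0: "((\<lambda>\<rho>. prob {\<omega>\<in>space P. number (\<lambda>_. rad a \<rho>) (?D0 \<rho>) \<omega> = 0}) \<longlongrightarrow> exp (- exp (- a))) at_top"
    by (rule void_tendsto[OF const[of ?D0] I0]) (auto intro: D0b)
  have V1: "((\<lambda>\<rho>. prob {\<omega>\<in>space P. number (\<lambda>_. rad a \<rho>) (?D1 \<rho>) \<omega> = 0}) \<longlongrightarrow> exp (- (p * exp (- a)))) at_top"
    by (rule void_tendsto[OF const[of ?D1] I1]) (use D1b sub in auto)
  have simpleT: "eventually (\<lambda>\<rho>. simple_threshold (?T \<rho>) (?D0 \<rho>) \<and> ?D0 \<rho> \<subseteq> UNIV \<times> {0..A} \<and>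
      (\<forall>p\<in>?D0 \<rho>. rad a \<rho> \<le> ?T \<rho> p \<and> ?T \<rho> p \<le> 9/8 * rad a \<rho>)) at_top"
    using rr
  proof eventually_elim
    case (elim \<rho>)
    have "simple_threshold (?T \<rho>) (?D0 \<rho>)"
      using elim by (intro simple_box[OF D0b order_refl measurable_two_level[OF B(1) Cb] range_two_level]) auto
    then show ?case using elim A box_marks[OF order_refl, of \<rho>] by (auto simp: two_level_def)
  qed
  have VT: "((\<lambda>\<rho>. prob {\<omega>\<in>space P. number (?T \<rho>) (?D0 \<rho>) \<omega> = 0}) \<longlongrightarrow> exp (- (p * exp (- b) + (exp (- a) - p * exp (- a))))) at_top"
    by (rule void_tendsto[OF simpleT IT])
  define low where "low \<rho> = prob {\<omega>\<in>space P. number (?T \<rho>) (?D0 \<rho>) \<omega> = 0} - prob {\<omega>\<in>space P. number (\<lambda>_. rad a \<rho>) (?D0 \<rho>) \<omega> = 0}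
     - (intensity_exceed (\<lambda>_. rad a \<rho>) (?D1 \<rho>) - 1 + prob {\<omega>\<in>space P. number (\<lambda>_. rad a \<rho>) (?D1 \<rho>) \<omega> = 0})" for \<rho>
  define lim where "lim = exp (- (p * exp (- b) + (exp (- a) - p * exp (- a)))) - exp (- exp (- a))
     - (p * exp (- a) - 1 + exp (- (p * exp (- a))))"
  have lim: "(low \<longlongrightarrow> lim) at_top"
    unfolding low_def[abs_def] lim_def by (intro tendsto_intros VT V0 V1 I1)
  have p0: "0 \<le> p" unfolding p_def \<pi>_def by simp
  have "exp (- exp (- a)) * (p * (exp (- a) - exp (- b))) - (p * exp (- a))\<^sup>2 / 2 \<le> lim"
  proof -
    let ?d = "p * (exp (- a) - exp (- b))"
    have "exp (- (p * exp (- b) + (exp (- a) - p * exp (- a)))) = exp (- exp (- a)) * exp ?d"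
      by (simp add: algebra_simps flip: exp_add)
    also have "\<dots> \<ge> exp (- exp (- a)) * (1 + ?d)" by (intro mult_left_mono exp_ge_add_one_self) auto
    finally have 1: "exp (- exp (- a)) * ?d \<le> exp (- (p * exp (- b) + (exp (- a) - p * exp (- a)))) - exp (- exp (- a))"
      by (simp add: algebra_simps)
    let ?x = "p * exp (- a)"
    have x: "0 \<le> ?x" using p0 by simp
    \<comment> \<open>Follows from the quadratic lower bound for \<open>exp x\<close>, because the
      product of \<open>1 + x + x\<^sup>2 / 2\<close> and \<open>1 - x + x\<^sup>2 / 2\<close> is
      \<open>1 + x ^ 4 / 4\<close>.\<close>
    have "exp (- ?x) \<le> 1 - ?x + ?x\<^sup>2 / 2"
    proof -
      have "1 + ?x + ?x\<^sup>2 / 2 \<le> exp ?x" by (rule exp_lower_Taylor_quadratic[OF x])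
      then have "(1 + ?x + ?x\<^sup>2 / 2) * (1 - ?x + ?x\<^sup>2 / 2) \<le> exp ?x * (1 - ?x + ?x\<^sup>2 / 2)"
      proof (rule mult_right_mono)
        have "0 \<le> (1 - ?x / 2)\<^sup>2 + ?x\<^sup>2 / 4" by simp
        then show "0 \<le> 1 - ?x + ?x\<^sup>2 / 2" by (simp add: power2_eq_square algebra_simps)
      qed
      moreover have "1 \<le> (1 + ?x + ?x\<^sup>2 / 2) * (1 - ?x + ?x\<^sup>2 / 2)"
      proof -
        have "(1 + ?x + ?x\<^sup>2 / 2) * (1 - ?x + ?x\<^sup>2 / 2) = 1 + (?x\<^sup>2 / 2)\<^sup>2"
          by (simp add: power2_eq_square algebra_simps)
        then show ?thesis by simp
      qed
      ultimately have "1 \<le> exp ?x * (1 - ?x + ?x\<^sup>2 / 2)" by linarith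
      then have "exp (- ?x) * 1 \<le> exp (- ?x) * (exp ?x * (1 - ?x + ?x\<^sup>2 / 2))" by (intro mult_left_mono) auto
      then show ?thesis by (simp add: mult.assoc[symmetric] flip: exp_add)
    qed
    then have 2: "?x - 1 + exp (- ?x) \<le> ?x\<^sup>2 / 2" by simp
    show ?thesis unfolding lim_def using 1 2 by linarith
  qed
  moreover have "eventually (\<lambda>\<rho>. lim - e < low \<rho>) at_top"
    using e by (intro order_tendstoD(1)[OF lim]) simp
  then have "eventually (\<lambda>\<rho>. lim - e \<le> prob {\<omega>\<in>space P. max_triple \<gamma> s W \<rho> (pts \<omega>) \<in> B \<times> C \<times> {a..<b}}) at_top"
    using rr simpleT
  proof eventually_elim
    case (elim \<rho>)
    have \<rho>: "\<rho> > 0" and R: "2 * (A + 1) \<le> rad a \<rho>" using elim by auto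
    have R0: "0 < rad a \<rho>" using R A by simp
    define X where "X = {\<omega>\<in>space P. number (?T \<rho>) (?D0 \<rho>) \<omega> = 0}"
    define Y where "Y = {\<omega>\<in>space P. number (\<lambda>_. rad a \<rho>) (?D0 \<rho>) \<omega> = 0}"
    define Z where "Z = {\<omega>\<in>space P. 2 \<le> number (\<lambda>_. rad a \<rho>) (?D1 \<rho>) \<omega>}"
    have adm0: "admissible (\<lambda>_. rad a \<rho>) (?D0 \<rho>)" by (rule const_admissible[OF D0b[OF \<rho>] order_refl R])
    have adm1: "admissible (\<lambda>_. rad a \<rho>) (?D1 \<rho>)" by (rule const_admissible[OF D1b[OF \<rho>] sub R])
    have admT: "admissible (?T \<rho>) (?D0 \<rho>)"
      using elim R by (intro admissible_window[of _ _ "rad a \<rho>"]) auto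
    have ev: "X \<in> events" "Y \<in> events" "Z \<in> events"
      unfolding X_def Y_def Z_def by (rule number_zero_event[OF admT] number_zero_event[OF adm0] number_zero_event[OF adm1])+
    have mt: "{\<omega>\<in>space P. max_triple \<gamma> s W \<rho> (pts \<omega>) \<in> B \<times> C \<times> {a..<b}} \<in> events"
    proof -
      have "B \<times> C \<times> {a..<b} \<in> sets borel" using B Cb by (intro borel_Times) auto
      from measurable_sets[OF measurable_max_triple[OF W(1) \<rho>] this] show ?thesis
        by (simp add: vimage_def Int_def conj_commute)
    qed
    have "prob X \<le> prob (X - Y - Z) + prob Y + prob Z"
    proof -
      have "prob X \<le> prob ((X - Y - Z) \<union> (Y \<union> Z))" using ev by (intro finite_measure_mono) auto
      also have "\<dots> \<le> prob (X - Y - Z) + prob (Y \<union> Z)" using ev by (intro measure_Un_le sets.Diff sets.Un)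
      also have "prob (Y \<union> Z) \<le> prob Y + prob Z" using ev by (intro measure_Un_le sets.Diff sets.Un)
      finally show ?thesis by simp
    qed
    moreover have "prob (X - Y - Z) \<le> prob {\<omega>\<in>space P. max_triple \<gamma> s W \<rho> (pts \<omega>) \<in> B \<times> C \<times> {a..<b}}"
    proof (rule finite_measure_mono_AE[OF _ mt], use AE_good in eventually_elim)
      case (elim \<omega>)
      show ?case
      proof
        assume "\<omega> \<in> X - Y - Z"
        then show "\<omega> \<in> {\<omega>\<in>space P. max_triple \<gamma> s W \<rho> (pts \<omega>) \<in> B \<times> C \<times> {a..<b}}"
          using box_event[OF elim B(2) \<rho> R0 _ _ ab] \<open>0 < \<rho> \<and> _\<close> unfolding X_def Y_def Z_def by auto
      qed
    qed
    moreover have "prob Z \<le> intensity_exceed (\<lambda>_. rad a \<rho>) (?D1 \<rho>) - 1 + prob {\<omega>\<in>space P. number (\<lambda>_. rad a \<rho>) (?D1 \<rho>) \<omega> = 0}"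
      unfolding Z_def by (rule prob_number_ge_2[OF adm1])
    ultimately show ?case using elim(1) unfolding low_def X_def[symmetric] Y_def[symmetric] by linarith
  qed
  then show ?thesis
    by eventually_elim (use calculation in linarith)
qed

end

subsection \<open>Convergence in distribution\<close>

lemma measure_gumbel_Ico:
  assumes "a < b"
  shows "measure gumbel_distr {a..<b} = exp (- exp (- b)) - exp (- exp (- a))"
proof -
  interpret G: real_distribution gumbel_distr by (rule real_distribution_gumbel)
  have cont: "isCont (cdf gumbel_distr) x" for x
    unfolding cdf_gumbel[abs_def] by (intro continuous_intros)
  have 0: "measure gumbel_distr {x} = 0" for x using cont[of x] by (simp add: G.isCont_cdf)
  have "measure gumbel_distr {a..<b} = measure gumbel_distr {a<..b}"
  proof (rule measure_eq_AE)
    have "AE x in gumbel_distr. x \<noteq> a" "AE x in gumbel_distr. x \<noteq> b"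
      using 0 G.prob_eq_0[of "{a}"] G.prob_eq_0[of "{b}"] by simp_all
    then show "AE x in gumbel_distr. x \<in> {a..<b} \<longleftrightarrow> x \<in> {a<..b}" by eventually_elim auto
  qed auto
  also have "\<dots> = cdf gumbel_distr b - cdf gumbel_distr a"
    using assms by (simp add: G.cdf_diff_eq)
  finally show ?thesis by (simp add: cdf_gumbel)
qed

text \<open>For \<open>\<delta> = exp (- a) - exp (- b)\<close> the Gumbel mass of \<open>[a, b)\<close> is \<open>exp (- exp (- a)) * (exp \<delta> - 1)\<close>,
  and \<open>exp \<delta> - 1 \<le> \<delta> * exp \<delta>\<close>.\<close>
lemma gumbel_Ico_le:
  assumes "a < b" "exp (- a) * (b - a) \<le> e"
  shows "exp (- e) * measure gumbel_distr {a..<b} \<le> exp (- exp (- a)) * (exp (- a) - exp (- b))"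
proof -
  define \<delta> where "\<delta> = exp (- a) - exp (- b)"
  have \<delta>0: "0 \<le> \<delta>" using assms(1) by (simp add: \<delta>_def)
  have "1 - (b - a) \<le> exp (- (b - a))" using exp_ge_add_one_self[of "- (b - a)"] by linarith
  then have "exp (- a) * (1 - exp (- (b - a))) \<le> exp (- a) * (b - a)" by (intro mult_left_mono) auto
  then have \<delta>e: "\<delta> \<le> e" using assms(2) unfolding \<delta>_def by (simp add: algebra_simps flip: exp_add)
  have "1 - \<delta> \<le> exp (- \<delta>)" using exp_ge_add_one_self[of "- \<delta>"] by simp
  then have "1 - exp (- \<delta>) \<le> \<delta>" by simp
  have "exp (- e) * (exp \<delta> - 1) \<le> exp (- \<delta>) * (exp \<delta> - 1)" using \<delta>e \<delta>0 by (intro mult_right_mono) auto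
  also have "\<dots> = 1 - exp (- \<delta>)" by (simp add: right_diff_distrib flip: exp_add)
  also have "\<dots> \<le> \<delta>" by fact
  finally have "exp (- exp (- a)) * (exp (- e) * (exp \<delta> - 1)) \<le> exp (- exp (- a)) * \<delta>" by (intro mult_left_mono) auto
  moreover have "measure gumbel_distr {a..<b} = exp (- exp (- a)) * (exp \<delta> - 1)"
    unfolding measure_gumbel_Ico[OF assms(1)] \<delta>_def by (simp add: right_diff_distrib flip: exp_add)
  ultimately show ?thesis by (simp add: \<delta>_def mult_ac)
qed

context laguerre_shift
begin

section \<open>The limit law as a product of probability measures\<close>

lemma sets_L: "sets (limit_mark_distr DIM('a) \<gamma> Q A) = sets borel"
  using Q(2) by (simp add: limit_mark_distr_def)

text \<open>In the plane the normalisation comes from \<open>marks_ratio_dim2\<close>: the total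
  mass is the limit of a ratio that eventually equals one.\<close>

lemma prob_space_L: "prob_space (limit_mark_distr DIM('a) \<gamma> Q A)"
proof (cases "DIM('a) = 2")
  case True
  have "((\<lambda>R. marks_weight UNIV R / marks_weight UNIV R) \<longlongrightarrow> measure (limit_mark_distr DIM('a) \<gamma> Q A) UNIV) at_top"
    by (rule marks_ratio_dim2[OF True]) simp
  moreover have "eventually (\<lambda>R. marks_weight UNIV R / marks_weight UNIV R = 1) at_top"
    using eventually_gt_at_top[of A]
  proof eventually_elim
    case (elim R) then show ?case using marks_weight_pos[OF elim] by simp
  qed
  then have "((\<lambda>R. marks_weight UNIV R / marks_weight UNIV R) \<longlongrightarrow> 1) at_top" by (rule tendsto_eventually)
  ultimately have "measure (limit_mark_distr DIM('a) \<gamma> Q A) UNIV = 1" using tendsto_unique[OF trivial_limit_at_top_linorder] by blast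
  moreover have "space (limit_mark_distr DIM('a) \<gamma> Q A) = UNIV" using sets_eq_imp_space_eq[OF sets_L] by simp
  ultimately have "emeasure (limit_mark_distr DIM('a) \<gamma> Q A) (space (limit_mark_distr DIM('a) \<gamma> Q A)) = 1"
    by (metis emeasure_eq_ennreal_measure ennreal_1 measure_zero_top zero_neq_one)
  then show ?thesis by (rule prob_spaceI)
next
  case False
  then show ?thesis by (simp add: limit_mark_distr_def prob_space_return)
qed

abbreviation limit_law where "limit_law \<equiv> uniform_measure lborel W \<Otimes>\<^sub>M ((limit_mark_distr DIM('a) \<gamma> Q A) \<Otimes>\<^sub>M gumbel_distr)"

lemma prob_space_U: "prob_space (uniform_measure lborel W)"
  using W by (intro prob_space_uniform_measure) auto

lemma sets_limit_law: "sets limit_law = sets borel"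
proof -
  interpret G: real_distribution gumbel_distr by (rule real_distribution_gumbel)
  have "sets ((limit_mark_distr DIM('a) \<gamma> Q A) \<Otimes>\<^sub>M gumbel_distr) = sets (borel \<Otimes>\<^sub>M (borel :: real measure))"
    by (intro sets_pair_measure_cong sets_L) simp
  also have "\<dots> = sets (borel :: (real \<times> real) measure)" unfolding borel_prod ..
  finally have "sets limit_law = sets ((borel :: 'a measure) \<Otimes>\<^sub>M (borel :: (real \<times> real) measure))"
    by (intro sets_pair_measure_cong) simp_all
  then show ?thesis unfolding borel_prod .
qed

lemma prob_space_limit_law: "prob_space limit_law"
proof -
  interpret G: real_distribution gumbel_distr by (rule real_distribution_gumbel)
  interpret U: prob_space "uniform_measure lborel W" by (rule prob_space_U)
  interpret lim: prob_space "limit_mark_distr DIM('a) \<gamma> Q A" by (rule prob_space_L)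
  interpret LG: pair_prob_space "limit_mark_distr DIM('a) \<gamma> Q A" gumbel_distr ..
  interpret pair_prob_space "uniform_measure lborel W" "(limit_mark_distr DIM('a) \<gamma> Q A) \<Otimes>\<^sub>M gumbel_distr" ..
  show ?thesis by (rule prob_space_axioms)
qed

lemma measure_limit_law_Times:
  assumes B: "B \<in> sets borel" "B \<subseteq> W" and C: "C \<in> sets borel" and I: "I \<in> sets borel"
  shows "measure limit_law (B \<times> C \<times> I) = measure lborel B * \<pi> C * measure gumbel_distr I"
proof -
  interpret G: real_distribution gumbel_distr by (rule real_distribution_gumbel)
  interpret lim: prob_space "limit_mark_distr DIM('a) \<gamma> Q A" by (rule prob_space_L)
  interpret LG: pair_prob_space "limit_mark_distr DIM('a) \<gamma> Q A" gumbel_distr ..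
  have CI: "C \<times> I \<in> sets ((limit_mark_distr DIM('a) \<gamma> Q A) \<Otimes>\<^sub>M gumbel_distr)" using C I sets_L by (intro pair_measureI) auto
  have "emeasure limit_law (B \<times> C \<times> I) = emeasure (uniform_measure lborel W) B * (emeasure (limit_mark_distr DIM('a) \<gamma> Q A) C * emeasure gumbel_distr I)"
    using B C I CI sets_L by (simp add: LG.emeasure_pair_measure_Times G.emeasure_pair_measure_Times)
  also have "emeasure (uniform_measure lborel W) B = emeasure lborel B"
    using B W W_borel by (simp add: Int_absorb1 divide_ennreal_def)
  finally show ?thesis by (simp add: measure_def enn2real_mult \<pi>_def)
qed

lemma AE_limit_law: "AE z in limit_law. fst z \<in> W \<and> fst (snd z) \<in> {0..A}"
proof -
  interpret P: prob_space limit_law by (rule prob_space_limit_law)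
  interpret lim: prob_space "limit_mark_distr DIM('a) \<gamma> Q A" by (rule prob_space_L)
  interpret G: real_distribution gumbel_distr by (rule real_distribution_gumbel)
  have "\<pi> {0..A} = 1"
  proof (cases "DIM('a) = 2")
    case True
    have "AE x in limit_mark_distr DIM('a) \<gamma> Q A. 0 \<le> x \<and> x \<le> A"
    proof -
      let ?g = "\<lambda>m. ennreal (exp (2 * unit_ball_vol 2 * \<gamma> * m\<^sup>2) / (\<integral>t. exp (2 * unit_ball_vol 2 * \<gamma> * t\<^sup>2) \<partial>Q))"
      have g: "?g \<in> borel_measurable Q" by (rule measurable_Q) measurable
      have "AE x in density Q ?g. 0 \<le> x \<and> x \<le> A"
        unfolding AE_density[OF g] using AE_marks by eventually_elim simp
      then show ?thesis unfolding limit_mark_distr_def if_P[OF True] .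
    qed
    then show ?thesis unfolding \<pi>_def using lim.prob_eq_1[of "{0..A}"] sets_L by auto
  next
    case False
    then show ?thesis using A by (simp add: \<pi>_def limit_mark_distr_def measure_return)
  qed
  then have "measure limit_law (W \<times> {0..A} \<times> UNIV) = 1"
    using measure_limit_law_Times[OF W_borel order_refl, of "{0..A}" UNIV] W_measure G.prob_space by simp
  moreover have "W \<times> {0..A} \<times> UNIV \<in> sets limit_law"
    unfolding sets_limit_law by (intro borel_Times W_borel) auto
  ultimately have "AE z in limit_law. z \<in> W \<times> {0..A} \<times> UNIV" using P.prob_eq_1 by blast
  then show ?thesis by eventually_elim auto
qed

text \<open>Ceilings for marks and floors for heights: mark cells must be closed on the right, as in
  \<open>marks_ratio\<close>, and height cells on the left, as exceedance is a weak
  inequality.\<close>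

definition lab :: "nat \<Rightarrow> 'a \<times> real \<times> real \<Rightarrow> nat \<times> int \<times> int" where
  "lab n z = (mesh_label n (fst z), \<lceil>fst (snd z) * Suc n\<rceil>, \<lfloor>snd (snd z) * Suc n\<rfloor>)"

definition cube :: "nat \<Rightarrow> nat \<times> int \<times> int \<Rightarrow> ('a \<times> real \<times> real) set" where
  "cube n i = {z. fst z \<in> W \<and> lab n z = i}"

definition space_cell :: "nat \<Rightarrow> nat \<Rightarrow> 'a set" where
  "space_cell n k = {x\<in>W. mesh_label n x = k}"

definition mark_cell :: "nat \<Rightarrow> int \<Rightarrow> real set" where
  "mark_cell n j = {(j - 1) / Suc n <.. j / Suc n}"

text \<open>Mark label 0 is included because mark zero lies in the cell that ends at zero. Heights
  are truncated to \<open>[- K, K)\<close>, which keeps the set finite.\<close>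

definition labels :: "nat \<Rightarrow> nat \<Rightarrow> (nat \<times> int \<times> int) set" where
  "labels K n = mesh_label n ` W \<times> {0..\<lceil>A * Suc n\<rceil>} \<times> {- (int K * Suc n)..<int K * Suc n}"

lemma cube_eq: "cube n (k, j, l) = space_cell n k \<times> mark_cell n j \<times> {l / Suc n ..< (l + 1) / Suc n}"
proof -
  have 1: "\<lceil>m * real (Suc n)\<rceil> = j \<longleftrightarrow> m \<in> mark_cell n j" for m
    unfolding mark_cell_def greaterThanAtMost_iff ceiling_eq_iff by (simp add: pos_divide_less_eq pos_le_divide_eq)
  have 2: "\<lfloor>g * real (Suc n)\<rfloor> = l \<longleftrightarrow> g \<in> {l / Suc n ..< (l + 1) / Suc n}" for g
    unfolding atLeastLessThan_iff floor_eq_iff by (simp add: pos_divide_le_eq pos_less_divide_eq)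
  show ?thesis
    by (rule set_eqI)
      (simp only: cube_def lab_def space_cell_def mem_Collect_eq mem_Times_iff prod.inject 1 2 conj_assoc fst_conv snd_conv of_int_add of_int_1)
qed

lemma space_cell_borel: "space_cell n k \<in> sets borel"
proof -
  have "space_cell n k = W \<inter> {x. mesh_label n x = k}" by (auto simp: space_cell_def)
  then show ?thesis using W_borel sets_mesh_label by auto
qed

lemma cube_borel: "cube n i \<in> sets borel"
  by (cases i) (auto simp: cube_eq mark_cell_def intro!: borel_Times space_cell_borel)

lemma finite_labels: "finite (labels K n)"
  unfolding labels_def using finite_mesh_label[OF compact_imp_bounded[OF W(1)], of n] by simp

text \<open>Two powers of the mesh are needed: one absorbs the number of height intervals above a
  spatial cell, the other makes the summed error vanish.\<close>

lemma space_cell_small: "measure lborel (space_cell n k) \<le> unit_ball_vol (real DIM('a)) / (Suc n)\<^sup>2"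
proof (cases "space_cell n k = {}")
  case False
  then obtain x where x: "x \<in> W" "mesh_label n x = k" by (auto simp: space_cell_def)
  have sub: "space_cell n k \<subseteq> ball x (1 / Suc n)"
  proof
    fix y assume "y \<in> space_cell n k"
    then have "mesh_label n x = mesh_label n y" using x by (simp add: space_cell_def)
    then show "y \<in> ball x (1 / Suc n)" unfolding mem_ball by (rule dist_mesh_label)
  qed
  have "measure lborel (space_cell n k) \<le> measure lborel (ball x (1 / Suc n))"
    by (intro measure_mono_fmeasurable sub fmeasurableI emeasure_bounded_finite) (auto simp: space_cell_borel)
  also have "\<dots> = unit_ball_vol (real DIM('a)) * (1 / Suc n) ^ DIM('a)" by (simp add: content_ball)
  also have "\<dots> \<le> unit_ball_vol (real DIM('a)) * (1 / Suc n)\<^sup>2"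
    using dim by (intro mult_left_mono power_decreasing) auto
  finally show ?thesis by (simp add: power_divide)
qed simp

lemma sum_space_cells: "(\<Sum>k\<in>mesh_label n ` W. measure lborel (space_cell n k)) \<le> 1"
proof -
  have "(\<Sum>k\<in>mesh_label n ` W. measure lborel (space_cell n k)) = measure lborel (\<Union>k\<in>mesh_label n ` W. space_cell n k)"
  proof (rule measure_finite_Union[symmetric])
    show "finite (mesh_label n ` W)" using finite_mesh_label[OF compact_imp_bounded[OF W(1)]] .
    show "emeasure lborel (space_cell n k) \<noteq> \<infinity>" for k
    proof -
      have "emeasure lborel (space_cell n k) \<le> emeasure lborel W"
        using W_borel by (intro emeasure_mono) (auto simp: space_cell_def)
      also have "\<dots> < \<infinity>" using W(2) by simp
      finally show ?thesis by simp
    qed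
  qed (auto simp: disjoint_family_on_def space_cell_borel, auto simp: space_cell_def)
  also have "(\<Union>k\<in>mesh_label n ` W. space_cell n k) = W" by (auto simp: space_cell_def)
  finally show ?thesis using W_measure by simp
qed

lemma sum_mark_cells:
  fixes J :: "int set"
  assumes J: "finite J"
  shows "(\<Sum>j\<in>J. \<pi> (mark_cell n j)) \<le> 1"
proof -
  interpret lim: prob_space "limit_mark_distr DIM('a) \<gamma> Q A" by (rule prob_space_L)
  have "(\<Sum>j\<in>J. \<pi> (mark_cell n j)) = measure (limit_mark_distr DIM('a) \<gamma> Q A) (\<Union>j\<in>J. mark_cell n j)"
    unfolding \<pi>_def
  proof (rule lim.finite_measure_finite_Union[OF J, symmetric])
    show "mark_cell n ` J \<subseteq> lim.events" by (auto simp: sets_L mark_cell_def)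
    show "disjoint_family_on (mark_cell n) J"
    proof (unfold disjoint_family_on_def, intro ballI impI)
      fix i j :: int assume "i \<noteq> j"
      have "\<lceil>m * real (Suc n)\<rceil> = j" if "m \<in> mark_cell n j" for m j
        using that unfolding mark_cell_def greaterThanAtMost_iff ceiling_eq_iff
        by (simp add: pos_divide_less_eq pos_le_divide_eq)
      then show "mark_cell n i \<inter> mark_cell n j = {}" using \<open>i \<noteq> j\<close> by blast
    qed
  qed
  also have "\<dots> \<le> 1" by (rule lim.prob_le_1)
  finally show ?thesis .
qed

abbreviation X :: "real \<Rightarrow> 'w \<Rightarrow> 'a \<times> real \<times> real" where "X \<rho> \<omega> \<equiv> max_triple \<gamma> s W \<rho> (pts \<omega>)"

text \<open>Heights are at least \<open>- K\<close>, so \<open>exp (- a) \<le> exp K\<close>. This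
  controls the relative loss in \<open>gumbel_Ico_le\<close> and the quadratic error, in which one
  factor \<open>p\<close> is estimated by the volume of the spatial cell.\<close>

lemma cube_prob_lower:
  assumes i: "(k, j, l) \<in> labels K n" and e: "e > 0"
  shows "eventually (\<lambda>\<rho>. exp (- (exp (real K) / Suc n)) * measure limit_law (cube n (k, j, l))
     - (measure lborel (space_cell n k) * \<pi> (mark_cell n j)) * (unit_ball_vol (real DIM('a)) / (Suc n)\<^sup>2) * (exp (2 * real K) / 2) - e
     \<le> prob {\<omega>\<in>space P. X \<rho> \<omega> \<in> cube n (k, j, l)}) at_top"
proof -
  interpret lim: prob_space "limit_mark_distr DIM('a) \<gamma> Q A" by (rule prob_space_L)
  define a where "a = real_of_int l / Suc n"
  define b where "b = real_of_int (l + 1) / Suc n"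
  have ab: "a < b" unfolding a_def b_def by (intro divide_strict_right_mono) auto
  have ba: "b - a = 1 / Suc n" unfolding a_def b_def by (simp add: diff_divide_distrib[symmetric])
  have "- (int K * Suc n) \<le> l" using i by (simp add: labels_def)
  then have "real_of_int (- (int K * Suc n)) \<le> real_of_int l" by (simp only: of_int_le_iff)
  then have "- (real K * Suc n) \<le> real_of_int l" by simp
  then have aK: "- real K \<le> a" unfolding a_def by (simp add: pos_le_divide_eq)
  define B where "B = space_cell n k"
  define C where "C = mark_cell n j"
  have B: "B \<in> sets borel" "B \<subseteq> W" unfolding B_def by (rule space_cell_borel) (auto simp: space_cell_def)
  have C: "C = {real_of_int (j - 1) / Suc n <.. j / Suc n}" by (simp add: C_def mark_cell_def)
  define p where "p = measure lborel B * \<pi> C"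
  have \<pi>1: "0 \<le> \<pi> C" "\<pi> C \<le> 1" unfolding \<pi>_def by auto
  have p0: "0 \<le> p" unfolding p_def using \<pi>1 by simp
  have ps: "p \<le> unit_ball_vol (real DIM('a)) / (Suc n)\<^sup>2"
  proof -
    have "p \<le> measure lborel B * 1" unfolding p_def using \<pi>1 by (intro mult_left_mono) auto
    then show ?thesis using space_cell_small[of n k] by (simp add: B_def)
  qed
  have cub: "cube n (k, j, l) = B \<times> C \<times> {a..<b}" unfolding cube_eq B_def C_def a_def b_def by simp
  have meas: "measure limit_law (cube n (k, j, l)) = p * measure gumbel_distr {a..<b}"
    unfolding cub p_def by (rule measure_limit_law_Times[OF B]) (auto simp: C)
  have eaK: "exp (- a) \<le> exp (real K)" using aK by simp
  have "exp (- a) * (b - a) \<le> exp (real K) / Suc n" unfolding ba using eaK by (simp add: divide_right_mono)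
  from gumbel_Ico_le[OF ab this]
  have "p * (exp (- (exp (real K) / Suc n)) * measure gumbel_distr {a..<b}) \<le> p * (exp (- exp (- a)) * (exp (- a) - exp (- b)))"
    by (rule mult_left_mono[OF _ p0])
  then have 1: "exp (- (exp (real K) / Suc n)) * measure limit_law (cube n (k, j, l)) \<le> exp (- exp (- a)) * (p * (exp (- a) - exp (- b)))"
    unfolding meas by (simp only: mult_ac)
  have 2: "(p * exp (- a))\<^sup>2 / 2 \<le> p * (unit_ball_vol (real DIM('a)) / (Suc n)\<^sup>2) * (exp (2 * real K) / 2)"
  proof -
    have "(p * exp (- a))\<^sup>2 = (p * p) * (exp (- a) * exp (- a))" by (simp add: power2_eq_square)
    also have "\<dots> \<le> (p * (unit_ball_vol (real DIM('a)) / (Suc n)\<^sup>2)) * (exp (real K) * exp (real K))"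
      using p0 ps eaK by (intro mult_mono) auto
    also have "exp (real K) * exp (real K) = exp (2 * real K)" by (simp flip: exp_add)
    finally show ?thesis by simp
  qed
  have "eventually (\<lambda>\<rho>. exp (- exp (- a)) * (p * (exp (- a) - exp (- b))) - (p * exp (- a))\<^sup>2 / 2 - e
      \<le> prob {\<omega>\<in>space P. X \<rho> \<omega> \<in> B \<times> C \<times> {a..<b}}) at_top"
    unfolding p_def by (rule box_lower[OF B C ab e])
  then show ?thesis unfolding cub[symmetric]
  proof eventually_elim
    case (elim \<rho>)
    then show ?case using 1 2 unfolding p_def B_def C_def by linarith
  qed
qed

section \<open>Approximation of test functions from below by step functions\<close>

definition low :: "('a \<times> real \<times> real \<Rightarrow> real) \<Rightarrow> nat \<Rightarrow> nat \<times> int \<times> int \<Rightarrow> real" where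
  "low f n i = (if cube n i = {} then 0 else INF z\<in>cube n i. f z)"

text \<open>Zero outside the finitely many cubes, so it stays below every nonnegative
  \<open>f\<close> on the whole space and not only where the cubes approximate it.\<close>

definition step :: "('a \<times> real \<times> real \<Rightarrow> real) \<Rightarrow> nat \<Rightarrow> nat \<Rightarrow> 'a \<times> real \<times> real \<Rightarrow> real" where
  "step f K n z = (\<Sum>i\<in>labels K n. low f n i * indicator (cube n i) z)"

lemma step_eq: "step f K n z = (if fst z \<in> W \<and> lab n z \<in> labels K n then low f n (lab n z) else 0)"
proof (cases "fst z \<in> W \<and> lab n z \<in> labels K n")
  case True
  have "step f K n z = (\<Sum>i\<in>{lab n z}. low f n i * indicator (cube n i) z)"
    unfolding step_def using True finite_labels by (intro sum.mono_neutral_right) (auto simp: cube_def indicator_def)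
  then show ?thesis using True by (simp add: cube_def)
next
  case False
  then show ?thesis unfolding step_def by (auto simp: cube_def indicator_def intro!: sum.neutral)
qed

lemma low_le:
  assumes "\<And>z. 0 \<le> f z" "z \<in> cube n i"
  shows "low f n i \<le> f z"
proof -
  have "bdd_below (f ` cube n i)" using assms(1) by (intro bdd_belowI[of _ 0]) auto
  then show ?thesis using assms(2) by (auto simp: low_def intro: cINF_lower)
qed

lemma low_nonneg: "(\<And>z. 0 \<le> f z) \<Longrightarrow> 0 \<le> low f n i"
  by (auto simp: low_def intro: cINF_greatest)

lemma step_le: "(\<And>z. 0 \<le> f z) \<Longrightarrow> step f K n z \<le> f z"
  unfolding step_eq using low_le[of f z n "lab n z"] by (auto simp: cube_def)

lemma step_nonneg: "(\<And>z. 0 \<le> f z) \<Longrightarrow> 0 \<le> step f K n z"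
  unfolding step_eq using low_nonneg by auto

lemma cube_diam:
  assumes "z \<in> cube n i" "z' \<in> cube n i"
  shows "dist z z' \<le> 3 / Suc n"
proof -
  obtain x m g x' m' g' where z: "z = (x, m, g)" "z' = (x', m', g')" by (cases z; cases z') auto
  have l: "mesh_label n x = mesh_label n x'" "\<lceil>m * Suc n\<rceil> = \<lceil>m' * Suc n\<rceil>" "\<lfloor>g * Suc n\<rfloor> = \<lfloor>g' * Suc n\<rfloor>"
    using assms by (auto simp: cube_def lab_def z)
  have "\<bar>m * Suc n - m' * Suc n\<bar> \<le> 1" "\<bar>g * Suc n - g' * Suc n\<bar> \<le> 1" using l(2,3) by linarith+
  then have "\<bar>m - m'\<bar> * Suc n \<le> 1" "\<bar>g - g'\<bar> * Suc n \<le> 1" by (simp_all only: left_diff_distrib[symmetric] abs_mult abs_of_nat)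
  then have mg: "dist m m' \<le> 1 / Suc n" "dist g g' \<le> 1 / Suc n" by (simp_all only: dist_real_def pos_le_divide_eq of_nat_0_less_iff zero_less_Suc)
  have x: "dist x x' \<le> 1 / Suc n" using dist_mesh_label[OF l(1)] by simp
  have "dist z z' \<le> dist x x' + dist (m, g) (m', g')"
    unfolding z dist_Pair_Pair[of x] by (intro sqrt_sum_squares_le_sum) auto
  also have "dist (m, g) (m', g') \<le> dist m m' + dist g g'"
    unfolding dist_Pair_Pair by (intro sqrt_sum_squares_le_sum) auto
  finally show ?thesis using x mg by (simp add: add_divide_distrib[symmetric])
qed

lemma step_tendsto:
  assumes f: "continuous_on UNIV f" "\<And>z. 0 \<le> f z" and z: "fst z \<in> W" "fst (snd z) \<in> {0..A}" "- real K \<le> snd (snd z)" "snd (snd z) < real K"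
  shows "(\<lambda>n. step f K n z) \<longlonglongrightarrow> f z"
proof -
  have lab: "lab n z \<in> labels K n" for n
  proof -
    have "0 \<le> \<lceil>fst (snd z) * Suc n\<rceil>" using z(2) by (simp add: less_le_trans[of "-1" 0])
    moreover have "\<lceil>fst (snd z) * Suc n\<rceil> \<le> \<lceil>A * Suc n\<rceil>" using z(2) by (intro ceiling_mono mult_right_mono) auto
    moreover have "- (int K * Suc n) \<le> \<lfloor>snd (snd z) * Suc n\<rfloor>"
    proof -
      have "real_of_int (- (int K * Suc n)) \<le> snd (snd z) * Suc n"
        using mult_right_mono[OF z(3), of "real (Suc n)"] by simp
      then show ?thesis by (simp only: le_floor_iff)
    qed
    moreover have "\<lfloor>snd (snd z) * Suc n\<rfloor> < int K * Suc n"
    proof -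
      have "snd (snd z) * Suc n < real_of_int (int K * Suc n)"
        using mult_strict_right_mono[OF z(4), of "real (Suc n)"] by simp
      then show ?thesis by (simp only: floor_less_iff)
    qed
    ultimately show ?thesis using z(1) by (simp add: lab_def labels_def)
  qed
  show ?thesis
  proof (rule tendstoI)
    fix e :: real assume e: "e > 0"
    have "isCont f z" using f(1) continuous_on_eq_continuous_at[OF open_UNIV, of f] by blast
    then obtain d where d: "d > 0" "\<And>z'. dist z' z < d \<Longrightarrow> dist (f z') (f z) < e / 2"
      unfolding continuous_at_eps_delta using e by (metis half_gt_zero)
    have "d / 3 > 0" using d by simp
    from eventually_mesh[OF this] show "eventually (\<lambda>n. dist (step f K n z) (f z) < e) sequentially"
    proof eventually_elim
      case (elim n)
      have zc: "z \<in> cube n (lab n z)" using z(1) by (simp add: cube_def)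
      have "f z - e / 2 \<le> low f n (lab n z)"
      proof -
        have "f z - e / 2 \<le> f z'" if "z' \<in> cube n (lab n z)" for z'
        proof -
          have "dist z' z \<le> 3 / Suc n" by (rule cube_diam[OF that zc])
          also have "\<dots> < d" using elim by simp
          finally have "dist z' z < d" .
          from d(2)[OF this] show ?thesis unfolding dist_real_def by linarith
        qed
        then show ?thesis using zc by (auto simp: low_def intro!: cINF_greatest)
      qed
      moreover have "step f K n z = low f n (lab n z)" using z(1) lab by (simp add: step_eq)
      ultimately show ?case using step_le[of f K n z, OF f(2)] e by (simp add: dist_real_def)
    qed
  qed
qed

lemma measurable_limit_law: "g \<in> borel_measurable borel \<Longrightarrow> g \<in> borel_measurable limit_law"
  by (subst measurable_cong_sets[OF sets_limit_law refl])

lemma step_borel: "step f K n \<in> borel_measurable borel"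
  unfolding step_def[abs_def] using cube_borel by (intro borel_measurable_sum borel_measurable_times borel_measurable_indicator) auto

lemma truncation_tendsto:
  assumes f: "continuous_on UNIV f" "\<And>z. 0 \<le> f z" "\<And>z. f z \<le> M"
  shows "(\<lambda>n. \<integral>z. step f K n z \<partial>limit_law) \<longlonglongrightarrow> (\<integral>z. f z * indicator {z. snd (snd z) \<in> {- real K..<real K}} z \<partial>limit_law)"
    "(\<lambda>K. \<integral>z. f z * indicator {z. snd (snd z) \<in> {- real K..<real K}} z \<partial>limit_law) \<longlonglongrightarrow> (\<integral>z. f z \<partial>limit_law)"
proof -
  interpret nu: prob_space limit_law by (rule prob_space_limit_law)
  have fm: "f \<in> borel_measurable limit_law" by (intro measurable_limit_law borel_measurable_continuous_onI f(1))
  have S: "{z::'a \<times> real \<times> real. snd (snd z) \<in> {- real K..<real K}} \<in> sets borel" for K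
  proof -
    have "(\<lambda>z::'a \<times> real \<times> real. snd (snd z)) \<in> borel_measurable borel"
      by (intro borel_measurable_continuous_onI continuous_intros)
    from measurable_sets[OF this, of "{- real K..<real K}"] show ?thesis by (simp add: vimage_def)
  qed
  have tm: "(\<lambda>z. f z * indicator {z. snd (snd z) \<in> {- real K..<real K}} z) \<in> borel_measurable limit_law" for K
    by (intro borel_measurable_times fm borel_measurable_indicator) (subst sets_limit_law, rule S)
  show "(\<lambda>n. \<integral>z. step f K n z \<partial>limit_law) \<longlonglongrightarrow> (\<integral>z. f z * indicator {z. snd (snd z) \<in> {- real K..<real K}} z \<partial>limit_law)"
  proof (rule integral_dominated_convergence[where w = "\<lambda>_. M"])
    show "AE z in limit_law. (\<lambda>n. step f K n z) \<longlonglongrightarrow> f z * indicator {z. snd (snd z) \<in> {- real K..<real K}} z"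
      using AE_limit_law
    proof eventually_elim
      case (elim z)
      show ?case
      proof (cases "snd (snd z) \<in> {- real K..<real K}")
        case True then show ?thesis using step_tendsto[OF f(1,2), of z K] elim by simp
      next
        case False
        have "step f K n z = 0" for n
        proof -
          have "lab n z \<notin> labels K n"
          proof
            assume "lab n z \<in> labels K n"
            then have "- (int K * Suc n) \<le> \<lfloor>snd (snd z) * Suc n\<rfloor>" "\<lfloor>snd (snd z) * Suc n\<rfloor> < int K * Suc n"
              by (auto simp: lab_def labels_def)
            then have "real_of_int (- (int K * Suc n)) \<le> snd (snd z) * Suc n" "snd (snd z) * Suc n < real_of_int (int K * Suc n)"
              by (simp_all only: le_floor_iff floor_less_iff)
            then have "(- real K) * Suc n \<le> snd (snd z) * Suc n" "snd (snd z) * Suc n < real K * Suc n" by simp_all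
            then have "- real K \<le> snd (snd z)" "snd (snd z) < real K"
              using mult_right_le_imp_le[of "- real K" "real (Suc n)"] mult_right_less_imp_less[of _ "real (Suc n)" "real K"]
              by simp_all
            then show False using False by simp
          qed
          then show ?thesis by (simp add: step_eq)
        qed
        then show ?thesis using False by simp
      qed
    qed
    show "AE z in limit_law. norm (step f K n z) \<le> M" for n
    proof (rule AE_I2)
      fix z
      show "norm (step f K n z) \<le> M"
        using step_le[of f K n z, OF f(2)] step_nonneg[of f K n z, OF f(2)] f(3)[of z] by simp
    qed
  qed (rule tm measurable_limit_law[OF step_borel] | simp)+
  show "(\<lambda>K. \<integral>z. f z * indicator {z. snd (snd z) \<in> {- real K..<real K}} z \<partial>limit_law) \<longlonglongrightarrow> (\<integral>z. f z \<partial>limit_law)"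
  proof (rule integral_dominated_convergence[where w = "\<lambda>_. M"])
    show "AE z in limit_law. (\<lambda>K. f z * indicator {z. snd (snd z) \<in> {- real K..<real K}} z) \<longlonglongrightarrow> f z"
    proof (rule AE_I2)
      fix z :: "'a \<times> real \<times> real"
      obtain N :: nat where N: "\<bar>snd (snd z)\<bar> < real N" using reals_Archimedean2 by blast
      have "eventually (\<lambda>K. f z * indicator {z. snd (snd z) \<in> {- real K..<real K}} z = f z) sequentially"
        using eventually_ge_at_top[of N]
      proof eventually_elim
        case (elim K)
        then have "real N \<le> real K" by simp
        then show ?case using N by (auto simp: indicator_def)
      qed
      then show "(\<lambda>K. f z * indicator {z. snd (snd z) \<in> {- real K..<real K}} z) \<longlonglongrightarrow> f z" by (rule tendsto_eventually)
    qed
    show "AE z in limit_law. norm (f z * indicator {z. snd (snd z) \<in> {- real K..<real K}} z) \<le> M" for K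
    proof (rule AE_I2)
      fix z
      show "norm (f z * indicator {z. snd (snd z) \<in> {- real K..<real K}} z) \<le> M"
        using f(2)[of z] f(3)[of z] by (simp add: indicator_def)
    qed
  qed (rule tm fm | simp)+
qed

lemma integral_step: "(\<integral>z. step f K n z \<partial>limit_law) = (\<Sum>i\<in>labels K n. low f n i * measure limit_law (cube n i))"
proof -
  interpret nu: prob_space limit_law by (rule prob_space_limit_law)
  have c: "cube n i \<in> sets limit_law" for i unfolding sets_limit_law by (rule cube_borel)
  show ?thesis unfolding step_def using c
    by (subst Bochner_Integration.integral_sum)
      (auto intro!: integrable_mult_right integrable_real_indicator sum.cong simp: nu.emeasure_eq_measure)
qed

lemma measurable_X: "\<rho> > 0 \<Longrightarrow> X \<rho> \<in> borel_measurable P"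
  by (rule measurable_max_triple[OF W(1)])

lemma integrable_X:
  assumes "continuous_on UNIV f" "\<And>z. \<bar>f z\<bar> \<le> M" "\<rho> > 0"
  shows "integrable P (\<lambda>\<omega>. f (X \<rho> \<omega>) :: real)"
  using assms measurable_compose[OF measurable_X[OF assms(3)] borel_measurable_continuous_onI[OF assms(1)]]
  by (intro integrable_const_bound[where B = M]) auto

text \<open>The quadratic errors decay like the squared mesh, and there are
  \<open>2 * K * Suc n\<close> height labels; hence a total error of order \<open>1 / Suc n\<close>
  for fixed \<open>K\<close>.\<close>

lemma step_lower:
  assumes f: "continuous_on UNIV f" "\<And>z. 0 \<le> f z" "\<And>z. f z \<le> M" and e: "e > 0"
  shows "eventually (\<lambda>\<rho>. exp (- (exp (real K) / Suc n)) * (\<integral>z. step f K n z \<partial>limit_law)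
     - M * (unit_ball_vol (real DIM('a)) * real K * exp (2 * real K)) / Suc n - e \<le> (\<integral>\<omega>. f (X \<rho> \<omega>) \<partial>P)) at_top"
proof -
  define c where "c = (unit_ball_vol (real DIM('a)) / (Suc n)\<^sup>2) * (exp (2 * real K) / 2)"
  have c0: "0 \<le> c" unfolding c_def by simp
  have M0: "0 \<le> M" using f(2,3) order_trans by blast
  \<comment> \<open>The slack \<open>e\<close> is shared among the finitely many cubes; the added 1
    covers \<open>M = 0\<close>.\<close>
  define e' where "e' = e / (1 + M * card (labels K n))"
  have e': "e' > 0" unfolding e'_def using e M0 by (intro divide_pos_pos add_pos_nonneg) auto
  define q where "q i = measure lborel (space_cell n (fst i)) * \<pi> (mark_cell n (fst (snd i)))" for i :: "nat \<times> int \<times> int"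
  have q0: "0 \<le> q i" for i unfolding q_def \<pi>_def by simp
  have all: "eventually (\<lambda>\<rho>. \<forall>i\<in>labels K n. exp (- (exp (real K) / Suc n)) * measure limit_law (cube n i) - q i * c - e'
     \<le> prob {\<omega>\<in>space P. X \<rho> \<omega> \<in> cube n i}) at_top"
  proof (intro eventually_ball_finite finite_labels ballI)
    fix i assume i: "i \<in> labels K n"
    obtain k j l where kjl: "i = (k, j, l)" by (cases i) auto
    show "eventually (\<lambda>\<rho>. exp (- (exp (real K) / Suc n)) * measure limit_law (cube n i) - q i * c - e'
       \<le> prob {\<omega>\<in>space P. X \<rho> \<omega> \<in> cube n i}) at_top"
      using cube_prob_lower[OF i[unfolded kjl] e'] unfolding kjl q_def c_def by (simp add: mult.assoc)
  qed
  \<comment> \<open>\<open>q\<close> carries no height factor, so the sum over heights merely counts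
    labels, while volumes and mark probabilities each sum to at most one.\<close>
  have sumq: "(\<Sum>i\<in>labels K n. q i) \<le> 2 * real K * Suc n"
  proof -
    let ?S = "mesh_label n ` W" and ?J = "{0..\<lceil>A * Suc n\<rceil>}" and ?L = "{- (int K * Suc n)..<int K * Suc n}"
    have "(\<Sum>i\<in>labels K n. q i) = (\<Sum>k\<in>?S. \<Sum>j\<in>?J. \<Sum>l\<in>?L. measure lborel (space_cell n k) * \<pi> (mark_cell n j))"
      unfolding labels_def q_def by (simp only: sum.cartesian_product case_prod_unfold fst_conv snd_conv)
    also have "\<dots> = (\<Sum>k\<in>?S. measure lborel (space_cell n k)) * (\<Sum>j\<in>?J. \<pi> (mark_cell n j)) * real (card ?L)"
    proof -
      have "(\<Sum>k\<in>?S. \<Sum>j\<in>?J. \<Sum>l\<in>?L. measure lborel (space_cell n k) * \<pi> (mark_cell n j))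
        = (\<Sum>k\<in>?S. \<Sum>j\<in>?J. measure lborel (space_cell n k) * \<pi> (mark_cell n j) * real (card ?L))"
        by (intro sum.cong refl) (simp only: sum_constant mult.commute)
      then show ?thesis unfolding sum_product[of "\<lambda>k. measure lborel (space_cell n k)"] by (simp only: sum_distrib_right)
    qed
    also have "\<dots> \<le> 1 * 1 * real (card ?L)"
      using sum_space_cells[of n] sum_mark_cells[of ?J n]
      by (intro mult_right_mono mult_mono) (auto intro!: sum_nonneg simp: \<pi>_def)
    also have "real (card ?L) = 2 * real K * Suc n"
      by (simp add: nat_diff_distrib algebra_simps flip: of_nat_mult)
    finally show ?thesis by simp
  qed
  show ?thesis using all eventually_gt_at_top[of 0]
  proof eventually_elim
    case (elim \<rho>)
    have ev: "{\<omega>\<in>space P. X \<rho> \<omega> \<in> cube n i} \<in> events" for i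
      using measurable_sets[OF measurable_X[OF elim(2)] cube_borel[of n i]] by (simp add: vimage_def Int_def conj_commute)
    have lowM: "low f n i \<le> M" for i
    proof (cases "cube n i = {}")
      case False
      then obtain z where "z \<in> cube n i" by blast
      then show ?thesis using low_le[of f z n i, OF f(2)] f(3)[of z] by linarith
    qed (simp add: low_def M0)
    have "exp (- (exp (real K) / Suc n)) * (\<integral>z. step f K n z \<partial>limit_law) - M * c * (\<Sum>i\<in>labels K n. q i) - M * card (labels K n) * e'
      = (\<Sum>i\<in>labels K n. low f n i * (exp (- (exp (real K) / Suc n)) * measure limit_law (cube n i)) - M * (q i * c) - M * e')"
    proof -
      have "(\<Sum>i\<in>labels K n. low f n i * (exp (- (exp (real K) / Suc n)) * measure limit_law (cube n i))) =
          exp (- (exp (real K) / Suc n)) * (\<Sum>i\<in>labels K n. low f n i * measure limit_law (cube n i))"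
        by (simp only: sum_distrib_left mult.left_commute)
      moreover have "(\<Sum>i\<in>labels K n. M * (q i * c)) = M * c * (\<Sum>i\<in>labels K n. q i)"
        unfolding sum_distrib_left by (intro sum.cong refl) simp
      ultimately show ?thesis unfolding integral_step sum_subtractf by simp
    qed
    also have "\<dots> \<le> (\<Sum>i\<in>labels K n. low f n i * prob {\<omega>\<in>space P. X \<rho> \<omega> \<in> cube n i})"
    proof (rule sum_mono)
      fix i assume "i \<in> labels K n"
      then have "low f n i * (exp (- (exp (real K) / Suc n)) * measure limit_law (cube n i) - q i * c - e') \<le> low f n i * prob {\<omega>\<in>space P. X \<rho> \<omega> \<in> cube n i}"
        using elim(1) low_nonneg[OF f(2)] by (intro mult_left_mono) auto
      moreover have "low f n i * (q i * c) \<le> M * (q i * c)" "low f n i * e' \<le> M * e'"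
        using lowM q0 c0 e' by (intro mult_right_mono mult_nonneg_nonneg; simp)+
      ultimately show "low f n i * (exp (- (exp (real K) / Suc n)) * measure limit_law (cube n i)) - M * (q i * c) - M * e' \<le> low f n i * prob {\<omega>\<in>space P. X \<rho> \<omega> \<in> cube n i}"
        by (simp add: right_diff_distrib)
    qed
    also have "\<dots> = (\<Sum>i\<in>labels K n. \<integral>\<omega>. low f n i * indicator {\<omega>\<in>space P. X \<rho> \<omega> \<in> cube n i} \<omega> \<partial>P)"
      using ev by (intro sum.cong refl) (simp add: Int_absorb1 Int_absorb2)
    also have "\<dots> = (\<integral>\<omega>. (\<Sum>i\<in>labels K n. low f n i * indicator {\<omega>\<in>space P. X \<rho> \<omega> \<in> cube n i} \<omega>) \<partial>P)"
      using ev by (intro Bochner_Integration.integral_sum[symmetric] integrable_mult_right integrable_real_indicator) (auto simp: emeasure_eq_measure)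
    also have "\<dots> \<le> (\<integral>\<omega>. f (X \<rho> \<omega>) \<partial>P)"
    proof (rule integral_mono)
      show "integrable P (\<lambda>\<omega>. \<Sum>i\<in>labels K n. low f n i * indicator {\<omega>\<in>space P. X \<rho> \<omega> \<in> cube n i} \<omega>)"
        using ev by (intro Bochner_Integration.integrable_sum integrable_mult_right integrable_real_indicator) (auto simp: emeasure_eq_measure)
      show "integrable P (\<lambda>\<omega>. f (X \<rho> \<omega>))" using f by (intro integrable_X[OF f(1) _ elim(2), of M]) auto
      fix \<omega> assume "\<omega> \<in> space P"
      then have "(\<Sum>i\<in>labels K n. low f n i * indicator {\<omega>\<in>space P. X \<rho> \<omega> \<in> cube n i} \<omega>) = step f K n (X \<rho> \<omega>)"
        unfolding step_def by (intro sum.cong refl) (simp add: indicator_def)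
      then show "(\<Sum>i\<in>labels K n. low f n i * indicator {\<omega>\<in>space P. X \<rho> \<omega> \<in> cube n i} \<omega>) \<le> f (X \<rho> \<omega>)"
        using step_le[OF f(2)] by simp
    qed
    finally have main: "exp (- (exp (real K) / Suc n)) * (\<integral>z. step f K n z \<partial>limit_law) - M * c * (\<Sum>i\<in>labels K n. q i) - M * card (labels K n) * e' \<le> (\<integral>\<omega>. f (X \<rho> \<omega>) \<partial>P)" .
    have "M * c * (\<Sum>i\<in>labels K n. q i) \<le> M * c * (2 * real K * Suc n)"
      using sumq M0 c0 by (intro mult_left_mono) auto
    also have "\<dots> = M * (unit_ball_vol (real DIM('a)) * real K * exp (2 * real K)) / Suc n"
    proof -
      have "M * (v / y\<^sup>2 * (x / 2)) * (2 * k * y) = M * (v * k * x) / y" if "y \<noteq> 0" for v x y k :: real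
        using that by (simp add: power2_eq_square)
      then show ?thesis unfolding c_def by simp
    qed
    finally have 1: "M * c * (\<Sum>i\<in>labels K n. q i) \<le> M * (unit_ball_vol (real DIM('a)) * real K * exp (2 * real K)) / Suc n" .
    have "M * card (labels K n) * e' \<le> (1 + M * card (labels K n)) * e'" using e' by (intro mult_right_mono) auto
    also have "\<dots> = e"
    proof -
      have "1 + M * card (labels K n) > 0" using M0 by (intro add_pos_nonneg) auto
      then show ?thesis unfolding e'_def by simp
    qed
    finally show ?case using main 1 by linarith
  qed
qed

text \<open>The order of choices matters: the truncation \<open>K\<close> first, then the mesh
  \<open>n\<close>, whose error contains \<open>K * exp (2 * K) / Suc n\<close>, and
  \<open>\<rho>\<close> last.\<close>

lemma integral_lower:
  fixes f :: "'a \<times> real \<times> real \<Rightarrow> real"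
  assumes f: "continuous_on UNIV f" "\<And>z. 0 \<le> f z" "\<And>z. f z \<le> M" and e: "e > 0"
  shows "eventually (\<lambda>\<rho>. (\<integral>z. f z \<partial>limit_law) - e < (\<integral>\<omega>. f (X \<rho> \<omega>) \<partial>P)) at_top"
proof -
  let ?I = "\<integral>z. f z \<partial>limit_law"
  let ?IK = "\<lambda>K. \<integral>z. f z * indicator {z. snd (snd z) \<in> {- real K..<real K}} z \<partial>limit_law"
  have "eventually (\<lambda>K. ?I - e / 3 < ?IK K) sequentially"
    using e by (intro order_tendstoD(1)[OF truncation_tendsto(2)[OF f]]) simp
  then obtain K where K: "?I - e / 3 < ?IK K" by (auto simp: eventually_sequentially)
  have inv: "(\<lambda>n. 1 / real (Suc n)) \<longlonglongrightarrow> 0" using LIMSEQ_inverse_real_of_nat by (simp add: inverse_eq_divide)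
  have "(\<lambda>n. exp (- (exp (real K) * (1 / Suc n))) * (\<integral>z. step f K n z \<partial>limit_law)
     - M * (unit_ball_vol (real DIM('a)) * real K * exp (2 * real K)) * (1 / Suc n))
     \<longlonglongrightarrow> exp (- (exp (real K) * 0)) * ?IK K - M * (unit_ball_vol (real DIM('a)) * real K * exp (2 * real K)) * 0"
    by (intro tendsto_intros inv truncation_tendsto(1)[OF f])
  then have "(\<lambda>n. exp (- (exp (real K) / Suc n)) * (\<integral>z. step f K n z \<partial>limit_law)
     - M * (unit_ball_vol (real DIM('a)) * real K * exp (2 * real K)) / Suc n) \<longlonglongrightarrow> ?IK K"
    by simp
  then have "eventually (\<lambda>n. ?I - e / 3 < exp (- (exp (real K) / Suc n)) * (\<integral>z. step f K n z \<partial>limit_law)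
     - M * (unit_ball_vol (real DIM('a)) * real K * exp (2 * real K)) / Suc n) sequentially"
    using K by (rule order_tendstoD(1))
  then obtain n where n: "?I - e / 3 < exp (- (exp (real K) / Suc n)) * (\<integral>z. step f K n z \<partial>limit_law)
     - M * (unit_ball_vol (real DIM('a)) * real K * exp (2 * real K)) / Suc n"
    by (auto simp: eventually_sequentially)
  have "e / 3 > 0" using e by simp
  from step_lower[OF f this, of K n] show ?thesis
    by eventually_elim (use n e in linarith)
qed

text \<open>Lower bounds suffice: applied to the nonnegative functions \<open>f + M\<close> and
  \<open>M - f\<close> they enclose the integral of \<open>f\<close>, since both measures have total
  mass one.\<close>

lemma max_triple_conv: "conv_in_distr P X limit_law at_top"
  unfolding conv_in_distr_def
proof (intro conjI allI impI)
  show "eventually (\<lambda>\<rho>. X \<rho> \<in> borel_measurable P) at_top"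
    using eventually_gt_at_top[of 0] by eventually_elim (rule measurable_X)
  fix f :: "'a \<times> real \<times> real \<Rightarrow> real"
  assume f: "continuous_on UNIV f" and bd: "bounded (range f)"
  interpret nu: prob_space limit_law by (rule prob_space_limit_law)
  obtain M where M: "\<And>z. \<bar>f z\<bar> \<le> M" using bd by (auto simp: bounded_iff)
  have fi: "integrable limit_law f"
    using M by (intro nu.integrable_const_bound[where B = M] measurable_limit_law borel_measurable_continuous_onI f) auto
  have b: "0 \<le> f z + M" "f z + M \<le> 2 * M" "0 \<le> M - f z" "M - f z \<le> 2 * M" for z
    using M[of z] by auto
  show "((\<lambda>\<rho>. \<integral>\<omega>. f (X \<rho> \<omega>) \<partial>P) \<longlongrightarrow> (\<integral>z. f z \<partial>limit_law)) at_top"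
  proof (rule tendstoI)
    fix e :: real assume e: "e > 0"
    have 1: "eventually (\<lambda>\<rho>. (\<integral>z. f z + M \<partial>limit_law) - e < (\<integral>\<omega>. f (X \<rho> \<omega>) + M \<partial>P)) at_top"
      by (rule integral_lower[where M = "2 * M", OF _ _ _ e]) (use b in \<open>auto intro!: continuous_intros f\<close>)
    have 2: "eventually (\<lambda>\<rho>. (\<integral>z. M - f z \<partial>limit_law) - e < (\<integral>\<omega>. M - f (X \<rho> \<omega>) \<partial>P)) at_top"
      by (rule integral_lower[where M = "2 * M", OF _ _ _ e]) (use b in \<open>auto intro!: continuous_intros f\<close>)
    show "eventually (\<lambda>\<rho>. dist (\<integral>\<omega>. f (X \<rho> \<omega>) \<partial>P) (\<integral>z. f z \<partial>limit_law) < e) at_top"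
      using 1 2 eventually_gt_at_top[of 0]
    proof eventually_elim
      case (elim \<rho>)
      have i: "integrable P (\<lambda>\<omega>. f (X \<rho> \<omega>))" by (rule integrable_X[OF f M elim(3)])
      have "(\<integral>\<omega>. f (X \<rho> \<omega>) + M \<partial>P) = (\<integral>\<omega>. f (X \<rho> \<omega>) \<partial>P) + M" "(\<integral>\<omega>. M - f (X \<rho> \<omega>) \<partial>P) = M - (\<integral>\<omega>. f (X \<rho> \<omega>) \<partial>P)"
        using i prob_space by simp_all
      moreover have "(\<integral>z. f z + M \<partial>limit_law) = (\<integral>z. f z \<partial>limit_law) + M" "(\<integral>z. M - f z \<partial>limit_law) = M - (\<integral>z. f z \<partial>limit_law)"
        using fi nu.prob_space by simp_all
      ultimately show ?case using elim(1,2) by (simp add: dist_real_def abs_less_iff)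
    qed
  qed
qed

end

theorem corollary1p2:
  fixes P :: "'w measure"
    and \<eta> :: "'w \<Rightarrow> ('a::euclidean_space \<times> real) measure"
    and Q :: "real measure"
    and W :: "'a set"
    and \<gamma> A :: real
    and s :: "real \<Rightarrow> real"
  assumes dim: "DIM('a) \<ge> 2"
    and gamma: "\<gamma> > 0"
    and W: "compact W" "convex W" "emeasure lborel W = 1"
    and Q: "prob_space Q" "sets Q = sets borel" "emeasure Q {..<0} = 0"
    and A: "A > 0" "measure Q {0..A} = 1"
      "\<And>\<epsilon>. 0 < \<epsilon> \<Longrightarrow> \<epsilon> < A \<Longrightarrow> measure Q {0..A - \<epsilon>} < 1"
    and P: "prob_space P"
    and eta: "poisson_process P (UNIV \<times> {0..}) (scale_measure (ennreal \<gamma>) lborel \<Otimes>\<^sub>M Q) \<eta>"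
    and shift: "correct_shift P \<eta> \<gamma> W A s"
  shows "conv_in_distr P (\<lambda>\<rho> \<omega>. max_triple \<gamma> s W \<rho> (points (\<eta> \<omega>)))
           (uniform_measure lborel W \<Otimes>\<^sub>M (limit_mark_distr (DIM('a)) \<gamma> Q A \<Otimes>\<^sub>M gumbel_distr))
           at_top"
proof -
  note top_mark = A(3)
  interpret laguerre_process P \<eta> Q \<gamma> A
    by (rule laguerre_process.intro) (fact gamma Q(1) Q(2) A(1) A(2) P eta)+
  interpret laguerre_shift P \<eta> Q \<gamma> A W s
    by unfold_locales (fact dim W(1) W(3) top_mark shift)+
  show ?thesis by (rule max_triple_conv)
qed

end
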